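(* Let $\Bbbk$ be a field, $C,D$ dg bicategories over $\Bbbk$, $F,G\colon C\to D$ strong dg functors, $\eta,\theta\colon F\Rightarrow G$ strong dg natural transformations, and let $A=A(C,D)(F,G)(\eta,\theta)\colon\Theta_2\to C^\bullet(\Bbbk)$ be the associated 2-cocellular complex. Let $T_*=([0];\varnothing)$, so that $A_{T_*}=\prod_{x\in C_0}D_2(\eta_x,\theta_x)$. Then the vector space $V\subset A_{T_*}$ of those elements of degree $0$ which are closed in $\mathrm{Tot}_{\Theta_2}(A)$ is isomorphic to the vector space of (degree $0$) modifications $\eta\Rrightarrow\theta$.
   Context: **Bicategories.** A dg bicategory $C$ has a set of objects $C_0$, sets of 1-morphisms $C_1(x,y)$, complexes $C_2(f,g)$ of 2-morphisms for parallel $f,g$, vertical composition $\circ^v$ making each $C(x,y)$ a dg category, horizontal composition $\circ^h$ given by dg functors, and closed degree 0 invertible associativity and unit constraints. A strong functor $F$ has closed degree 0 invertible constraints $F(g)\circ F(f)\Rightarrow F(g\circ f)$, $\mathrm{id}\Rightarrow F(\mathrm{id})$. A strong natural transformation $\eta\colon F\Rightarrow G$ has 1-morphisms $\eta_x\colon F(x)\to G(x)$ and natural closed degree 0 invertible 2-morphisms $\eta_f\colon G(f)\circ\eta_x\Rightarrow\eta_y\circ F(f)$, $f\in C_1(x,y)$, compatible with composition and units. A degree 0 modification $\Gamma\colon\eta\Rrightarrow\theta$ is a family of closed degree 0 elements $\Gamma_x\in D_2(\eta_x,\theta_x)$, $x\in C_0$, with $\theta_f\circ^v(\mathrm{id}_{G(f)}\circ^h\Gamma_x)=(\Gamma_y\circ^h\mathrm{id}_{F(f)})\circ^v\eta_f$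 for all $f\in C_1(x,y)$. **The category $\Theta_2$.** $\Delta$ is the category of ordinals $[n]=\{0<\dots<n\}$, $n\ge0$, and monotone maps; $\partial^i$ is the injection $[n]\to[n+1]$ missing $i$. Objects of $\Theta_2$: $T=([n];[k_1],\dots,[k_n])$, $n,k_i\ge 0$ (for $n=0$: $([0];\varnothing)$). A morphism $([n];[\ell_1],\dots,[\ell_n])\to([m];[k_1],\dots,[k_m])$ is $(\phi;\{\phi_i^s\})$ with $\phi\colon[n]\to[m]$ in $\Delta$ and $\phi_i^s\colon[\ell_i]\to[k_s]$ in $\Delta$ for $1\le i\le n$, $\phi(i-1)<s\le\phi(i)$; composition is componentwise. $\dim T=n+k_1+\dots+k_n$. Elementary cofaces out of $T=([n];[k_1],\dots,[k_n])$: (a) $\partial_p^i$, $1\le p\le n$, $0\le i\le k_p+1$: identity except $\partial^i\colon[k_p]\to[k_p+1]$ in column $p$; (b) $D_{p,\sigma}$, $1\le p\le n$, $k_p=a+b$, $\sigma$ an $(a,b)$-shuffle: the map to $([n+1];\dots,[k_{p-1}],[a],[b],[k_{p+1}],\dots)$ with $\phi=\partial^p$, sending $[k_p]$ to the maximal chain in $[a]\times[b]$ whose $r$-th step raises the first coordinate if $r\in\sigma(\{1,\dots,a\})$ and the second otherwise, identities on other columns; (c) $D_{\min}$ with $\phi=\partial^0$, inserting a new first column $[0]$, and $D_{\max}$ with $\phi=\partial^{n+1}$, inserting a new last column $[0]$. **Totalization.** For $X\colon\Theta_2\to C^\bullet(\Bbbk)$, $\mathrm{Tot}_{\Theta_2}(X)^m=\prod_\ell\bigoplus_{\dim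 T=\ell}X_T^{m-\ell}$ with differential $d_\Theta+(-1)^\ell d_X$, where on $X_T$, $T=([n];[k_1],\dots,[k_n])$, with $e_p=\sum_{q\le p}(k_q+1)$, $$d_\Theta=\sum_{p,i}(-1)^{e_{p-1}+i+1}X(\partial_p^i)+\sum_{p,\,a+b=k_p,\,\sigma}(-1)^{e_{p-1}+a+1}\mathrm{sgn}(\sigma)X(D_{p,\sigma})+X(D_{\min})+(-1)^{e_n+1}X(D_{\max}).$$ **The functor $A(C,D)(F,G)(\eta,\theta)$.** For $T=([k];[n_1],\dots,[n_k])$ let $T^*$ be the 2-globular set with objects $0,\dots,k$, 1-cells $(i,j)\colon i-1\to i$ for $0\le j\le n_i$, and 2-cells $(i,j-1)\Rightarrow(i,j)$ for $1\le j\le n_i$. $\hat\Theta_2$ has the same objects as $\Theta_2$, and its morphisms $S\to T$ are the strict functors of free bicategories $\hat\omega_2(S^* )\to\hat\omega_2(T^* )$. Morphisms $S\to T$ of $\Theta_2$ are the same as strict 2-functors between the free strict 2-categories on $S^*$ and $T^*$, whence a functor $\hat\Theta_2\to\Theta_2$, identity on objects. A $T$-datum in $C$ consists of $x_0,\dots,x_k\in C_0$ and $f_{ij}\in C_1(x_{i-1},x_i)$ ($1\le i\le k$, $0\le j\le n_i$); put $f_{\min}=f_{k0}\circ(f_{k-1,0}\circ(\dots\circ f_{10}))$, $f_{\max}=f_{kn_k}\circ(\dots\circ f_{1n_1})$. Set $$\hat A_T=\prod_{T\text{-data}}\underline{\mathrm{Hom}}_\Bbbk\Big(\bigotimes_{i,\,1\le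 j\le n_i}C_2(f_{i,j-1},f_{ij}),\,D_2(\eta_{x_k}\circ F(f_{\min}),G(f_{\max})\circ\theta_{x_0})\Big),$$ and $\hat A_{([0];\varnothing)}=\prod_{x\in C_0}D_2(\eta_x,\theta_x)$. For $\hat\Phi\colon S=([k];[m_1],\dots,[m_k])\to T=([\ell];[n_1],\dots,[n_\ell])$ in $\hat\Theta_2$ with underlying morphism $(\phi;\{\phi_i^s\})$, $\Psi\in\hat A_S$ and a $T$-datum with $\sigma_{sj}\in C_2(f_{s,j-1},f_{sj})$, define $$(\hat\Phi_*\Psi)(\sigma)=G(B_{r})\circ^h\big((G(A^+)\circ^h\mathrm{id})\circ^v\Psi(\tau)\circ^v(\mathrm{id}\circ^hF(A^-))\big)\circ^hF(B_{l}).$$ Here the $S$-datum has objects $x_{\phi(i)}$ and $(i,a)$-th 1-morphism the composite of the $f_{s,\phi_i^s(a)}$, $\phi(i-1)<s\le\phi(i)$, and of identity 1-morphisms, bracketed as prescribed by $\hat\Phi$; $\tau_{ia}$ is the horizontal composite over these $s$ of the vertical composites of the $\sigma_{sj}$ with $\phi_i^s(a-1)<j\le\phi_i^s(a)$; $A^-$ (resp. $A^+$) is the horizontal composite over all $i$ and $s$ of the vertical composites of the $\sigma_{sj}$ with $j\le\phi_i^s(0)$ (resp. $j>\phi_i^s(m_i)$); $B_l$ (resp. $B_r$) is the horizontal composite over $s\le\phi(0)$ (resp. $s>\phi(k)$) of the full vertical composites of the $\sigma_{sj}$. Empty composites are identities, Koszul signs are used, and the result is regarded as a 2-morphism $\eta_{x_\ell}\circ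 F(f_{\min})\Rightarrow G(f_{\max})\circ\theta_{x_0}$ by inserting the structure isomorphisms of $C,D,F,G$, the isomorphism $\eta_h^{-1}\colon\eta_{x_\ell}\circ F(h)\Rightarrow G(h)\circ\eta_{x_{\phi(k)}}$ for $h$ the composite of the $f_{s0}$, $s>\phi(k)$, and $\theta_{h'}^{-1}\colon\theta_{x_{\phi(0)}}\circ F(h')\Rightarrow G(h')\circ\theta_{x_0}$ for $h'$ the composite of the $f_{s,n_s}$, $s\le\phi(0)$. This makes $\hat A$ a functor $\hat\Theta_2\to C^\bullet(\Bbbk)$. Finally $A_T\subset\hat A_T$ is the subcomplex of all $\Psi$ such that $\hat\Phi_*\Psi=\hat\Phi'_*\Psi$ whenever $\hat\Phi,\hat\Phi'\colon T\to T'$ in $\hat\Theta_2$ have the same image in $\Theta_2$; morphisms of $\Theta_2$ act on $A$ via arbitrary lifts to $\hat\Theta_2$. *)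

theory Defs
  imports Complex_Main "HOL-Library.Function_Algebras" "HOL-Combinatorics.Permutations"
begin

section \<open>Graded linear algebra\<close>

definition sgn_pow :: "int \<Rightarrow> 'a::ab_group_add \<Rightarrow> 'a" where
  "sgn_pow n v = (if even n then v else - v)"

definition linear_on ::
  "('k \<Rightarrow> 'a::ab_group_add \<Rightarrow> 'a) \<Rightarrow> 'a set \<Rightarrow> ('k \<Rightarrow> 'b::ab_group_add \<Rightarrow> 'b) \<Rightarrow> ('a \<Rightarrow> 'b) \<Rightarrow> bool" where
  "linear_on s V s' L \<longleftrightarrow>
     (\<forall>u\<in>V. \<forall>v\<in>V. L (u + v) = L u + L v) \<and> (\<forall>c. \<forall>u\<in>V. L (s c u) = s' c (L u))"

definition vs_isomorphic ::
  "('k::field \<Rightarrow> 'a::ab_group_add \<Rightarrow> 'a) \<Rightarrow> 'a set \<Rightarrow> ('k \<Rightarrow> 'b::ab_group_add \<Rightarrow> 'b) \<Rightarrow> 'b set \<Rightarrow> bool" where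
  "vs_isomorphic s V s' W \<longleftrightarrow>
     module.subspace s V \<and> module.subspace s' W \<and> (\<exists>L. linear_on s V s' L \<and> bij_betw L V W)"


section \<open>Dg bicategories\<close>

text \<open>
  The operations are not indexed by the objects and 1-morphisms they depend on.  This is no
  restriction, since the hom-sets may be taken disjoint, and the complexes of 2-morphisms may be
  taken to sit in the direct sum of all of them: the degree \<open>n\<close> component of the complex of
  2-morphisms from \<open>f\<close> to \<open>g\<close> is a linear subspace \<open>hom C f g n\<close> of one ambient vector space.
  All axioms only concern elements of these subspaces.

  Conventions: \<open>g \<odot> f\<close> is the composite of \<open>f : x \<rightarrow> y\<close> and \<open>g : y \<rightarrow> z\<close>; \<open>\<beta> \<cdot> \<alpha>\<close> is vertical
  and \<open>\<beta> \<star> \<alpha>\<close> horizontal composition; \<open>asc h g f : (h \<odot> g) \<odot> f \<Rightarrow> h \<odot> (g \<odot> f)\<close>,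
  \<open>lun f : id \<odot> f \<Rightarrow> f\<close> and \<open>run f : f \<odot> id \<Rightarrow> f\<close>.
\<close>

record ('o, 'm, 'c) bicat =
  obj :: "'o set"
  arr :: "'o \<Rightarrow> 'o \<Rightarrow> 'm set"
  id1 :: "'o \<Rightarrow> 'm"
  cmp :: "'m \<Rightarrow> 'm \<Rightarrow> 'm" (infixr "\<odot>\<index>" 75)
  id2 :: "'m \<Rightarrow> 'c"
  vc  :: "'c \<Rightarrow> 'c \<Rightarrow> 'c" (infixr "\<cdot>\<index>" 70)
  hc  :: "'c \<Rightarrow> 'c \<Rightarrow> 'c" (infixr "\<star>\<index>" 72)
  asc :: "'m \<Rightarrow> 'm \<Rightarrow> 'm \<Rightarrow> 'c"
  lun :: "'m \<Rightarrow> 'c"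
  run :: "'m \<Rightarrow> 'c"

record ('o, 'm, 'c, 'k) dgbicat = "('o, 'm, 'c) bicat" +
  scl :: "'k \<Rightarrow> 'c \<Rightarrow> 'c"
  hom :: "'m \<Rightarrow> 'm \<Rightarrow> int \<Rightarrow> 'c set"
  dif :: "'c \<Rightarrow> 'c"

definition is_inverse2 :: "('o, 'm, 'c::zero, 'k) dgbicat \<Rightarrow> 'm \<Rightarrow> 'm \<Rightarrow> 'c \<Rightarrow> 'c \<Rightarrow> bool" where
  "is_inverse2 C f g \<alpha> \<beta> \<longleftrightarrow>
     \<beta> \<in> hom C g f 0 \<and> \<beta> \<cdot>\<^bsub>C\<^esub> \<alpha> = id2 C f \<and> \<alpha> \<cdot>\<^bsub>C\<^esub> \<beta> = id2 C g"

definition closed_iso :: "('o, 'm, 'c::zero, 'k) dgbicat \<Rightarrow> 'm \<Rightarrow> 'm \<Rightarrow> 'c \<Rightarrow> bool" where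
  "closed_iso C f g \<alpha> \<longleftrightarrow> \<alpha> \<in> hom C f g 0 \<and> dif C \<alpha> = 0 \<and> (\<exists>\<beta>. is_inverse2 C f g \<alpha> \<beta>)"

definition inv2 :: "('o, 'm, 'c::zero, 'k) dgbicat \<Rightarrow> 'm \<Rightarrow> 'm \<Rightarrow> 'c \<Rightarrow> 'c" where
  "inv2 C f g \<alpha> = (THE \<beta>. is_inverse2 C f g \<alpha> \<beta>)"

locale dg_bicategory =
  fixes C :: "('o, 'm, 'c::ab_group_add, 'k::field) dgbicat" (structure)
  assumes vector_space_scl: "vector_space (scl C)"
    and id1_arr: "x \<in> obj C \<Longrightarrow> id1 C x \<in> arr C x x"
    and cmp_arr: "\<lbrakk>x \<in> obj C; y \<in> obj C; z \<in> obj C; f \<in> arr C x y; g \<in> arr C y z\<rbrakk>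
      \<Longrightarrow> g \<odot> f \<in> arr C x z"
    \<comment> \<open>complexes of 2-morphisms\<close>
    and hom_subspace: "\<lbrakk>x \<in> obj C; y \<in> obj C; f \<in> arr C x y; g \<in> arr C x y\<rbrakk>
      \<Longrightarrow> module.subspace (scl C) (hom C f g n)"
    and dif_hom: "\<lbrakk>x \<in> obj C; y \<in> obj C; f \<in> arr C x y; g \<in> arr C x y; \<alpha> \<in> hom C f g n\<rbrakk>
      \<Longrightarrow> dif C \<alpha> \<in> hom C f g (n + 1)"
    and dif_linear: "\<lbrakk>x \<in> obj C; y \<in> obj C; f \<in> arr C x y; g \<in> arr C x y\<rbrakk>
      \<Longrightarrow> linear_on (scl C) (hom C f g n) (scl C) (dif C)"
    and dif_dif: "\<lbrakk>x \<in> obj C; y \<in> obj C; f \<in> arr C x y; g \<in> arr C x y; \<alpha> \<in> hom C f g n\<rbrakk>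
      \<Longrightarrow> dif C (dif C \<alpha>) = 0"
    \<comment> \<open>vertical composition: the dg categories \<open>C(x,y)\<close>\<close>
    and id2_hom: "\<lbrakk>x \<in> obj C; y \<in> obj C; f \<in> arr C x y\<rbrakk> \<Longrightarrow> id2 C f \<in> hom C f f 0"
    and dif_id2: "\<lbrakk>x \<in> obj C; y \<in> obj C; f \<in> arr C x y\<rbrakk> \<Longrightarrow> dif C (id2 C f) = 0"
    and vc_hom: "\<lbrakk>x \<in> obj C; y \<in> obj C; f \<in> arr C x y; g \<in> arr C x y; h \<in> arr C x y;
        \<alpha> \<in> hom C f g m; \<beta> \<in> hom C g h n\<rbrakk> \<Longrightarrow> \<beta> \<cdot> \<alpha> \<in> hom C f h (n + m)"
    and vc_linear_left: "\<lbrakk>x \<in> obj C; y \<in> obj C; f \<in> arr C x y; g \<in> arr C x y; h \<in> arr C x y;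
        \<alpha> \<in> hom C f g m\<rbrakk> \<Longrightarrow> linear_on (scl C) (hom C g h n) (scl C) (\<lambda>\<beta>. \<beta> \<cdot> \<alpha>)"
    and vc_linear_right: "\<lbrakk>x \<in> obj C; y \<in> obj C; f \<in> arr C x y; g \<in> arr C x y; h \<in> arr C x y;
        \<beta> \<in> hom C g h n\<rbrakk> \<Longrightarrow> linear_on (scl C) (hom C f g m) (scl C) (\<lambda>\<alpha>. \<beta> \<cdot> \<alpha>)"
    and vc_assoc: "\<lbrakk>x \<in> obj C; y \<in> obj C; f \<in> arr C x y; g \<in> arr C x y; h \<in> arr C x y; k \<in> arr C x y;
        \<alpha> \<in> hom C f g m; \<beta> \<in> hom C g h n; \<gamma> \<in> hom C h k l\<rbrakk> \<Longrightarrow> (\<gamma> \<cdot> \<beta>) \<cdot> \<alpha> = \<gamma> \<cdot> (\<beta> \<cdot> \<alpha>)"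
    and vc_id2: "\<lbrakk>x \<in> obj C; y \<in> obj C; f \<in> arr C x y; g \<in> arr C x y; \<alpha> \<in> hom C f g n\<rbrakk>
      \<Longrightarrow> id2 C g \<cdot> \<alpha> = \<alpha> \<and> \<alpha> \<cdot> id2 C f = \<alpha>"
    and dif_vc: "\<lbrakk>x \<in> obj C; y \<in> obj C; f \<in> arr C x y; g \<in> arr C x y; h \<in> arr C x y;
        \<alpha> \<in> hom C f g m; \<beta> \<in> hom C g h n\<rbrakk>
      \<Longrightarrow> dif C (\<beta> \<cdot> \<alpha>) = dif C \<beta> \<cdot> \<alpha> + sgn_pow n (\<beta> \<cdot> dif C \<alpha>)"
    \<comment> \<open>horizontal composition: dg functors \<open>C(y,z) \<otimes> C(x,y) \<rightarrow> C(x,z)\<close>\<close>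
    and hc_hom: "\<lbrakk>x \<in> obj C; y \<in> obj C; z \<in> obj C; f \<in> arr C x y; f' \<in> arr C x y;
        g \<in> arr C y z; g' \<in> arr C y z; \<alpha> \<in> hom C f f' m; \<beta> \<in> hom C g g' n\<rbrakk>
      \<Longrightarrow> \<beta> \<star> \<alpha> \<in> hom C (g \<odot> f) (g' \<odot> f') (n + m)"
    and hc_linear_left: "\<lbrakk>x \<in> obj C; y \<in> obj C; z \<in> obj C; f \<in> arr C x y; f' \<in> arr C x y;
        g \<in> arr C y z; g' \<in> arr C y z; \<alpha> \<in> hom C f f' m\<rbrakk>
      \<Longrightarrow> linear_on (scl C) (hom C g g' n) (scl C) (\<lambda>\<beta>. \<beta> \<star> \<alpha>)"
    and hc_linear_right: "\<lbrakk>x \<in> obj C; y \<in> obj C; z \<in> obj C; f \<in> arr C x y; f' \<in> arr C x y;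
        g \<in> arr C y z; g' \<in> arr C y z; \<beta> \<in> hom C g g' n\<rbrakk>
      \<Longrightarrow> linear_on (scl C) (hom C f f' m) (scl C) (\<lambda>\<alpha>. \<beta> \<star> \<alpha>)"
    and dif_hc: "\<lbrakk>x \<in> obj C; y \<in> obj C; z \<in> obj C; f \<in> arr C x y; f' \<in> arr C x y;
        g \<in> arr C y z; g' \<in> arr C y z; \<alpha> \<in> hom C f f' m; \<beta> \<in> hom C g g' n\<rbrakk>
      \<Longrightarrow> dif C (\<beta> \<star> \<alpha>) = dif C \<beta> \<star> \<alpha> + sgn_pow n (\<beta> \<star> dif C \<alpha>)"
    and hc_id2: "\<lbrakk>x \<in> obj C; y \<in> obj C; z \<in> obj C; f \<in> arr C x y; g \<in> arr C y z\<rbrakk>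
      \<Longrightarrow> id2 C g \<star> id2 C f = id2 C (g \<odot> f)"
    and interchange: "\<lbrakk>x \<in> obj C; y \<in> obj C; z \<in> obj C;
        f \<in> arr C x y; f' \<in> arr C x y; f'' \<in> arr C x y; g \<in> arr C y z; g' \<in> arr C y z; g'' \<in> arr C y z;
        \<alpha> \<in> hom C f f' m; \<alpha>' \<in> hom C f' f'' m'; \<beta> \<in> hom C g g' n; \<beta>' \<in> hom C g' g'' n'\<rbrakk>
      \<Longrightarrow> (\<beta>' \<star> \<alpha>') \<cdot> (\<beta> \<star> \<alpha>) = sgn_pow (m' * n) ((\<beta>' \<cdot> \<beta>) \<star> (\<alpha>' \<cdot> \<alpha>))"
    \<comment> \<open>constraints\<close>
    and asc_iso: "\<lbrakk>w \<in> obj C; x \<in> obj C; y \<in> obj C; z \<in> obj C;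
        f \<in> arr C w x; g \<in> arr C x y; h \<in> arr C y z\<rbrakk>
      \<Longrightarrow> closed_iso C ((h \<odot> g) \<odot> f) (h \<odot> (g \<odot> f)) (asc C h g f)"
    and asc_natural: "\<lbrakk>w \<in> obj C; x \<in> obj C; y \<in> obj C; z \<in> obj C;
        f \<in> arr C w x; g \<in> arr C x y; h \<in> arr C y z; f' \<in> arr C w x; g' \<in> arr C x y; h' \<in> arr C y z;
        \<alpha> \<in> hom C f f' l; \<beta> \<in> hom C g g' m; \<gamma> \<in> hom C h h' n\<rbrakk>
      \<Longrightarrow> asc C h' g' f' \<cdot> ((\<gamma> \<star> \<beta>) \<star> \<alpha>) = (\<gamma> \<star> (\<beta> \<star> \<alpha>)) \<cdot> asc C h g f"
    and lun_iso: "\<lbrakk>x \<in> obj C; y \<in> obj C; f \<in> arr C x y\<rbrakk>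
      \<Longrightarrow> closed_iso C (id1 C y \<odot> f) f (lun C f)"
    and lun_natural: "\<lbrakk>x \<in> obj C; y \<in> obj C; f \<in> arr C x y; g \<in> arr C x y; \<alpha> \<in> hom C f g n\<rbrakk>
      \<Longrightarrow> lun C g \<cdot> (id2 C (id1 C y) \<star> \<alpha>) = \<alpha> \<cdot> lun C f"
    and run_iso: "\<lbrakk>x \<in> obj C; y \<in> obj C; f \<in> arr C x y\<rbrakk>
      \<Longrightarrow> closed_iso C (f \<odot> id1 C x) f (run C f)"
    and run_natural: "\<lbrakk>x \<in> obj C; y \<in> obj C; f \<in> arr C x y; g \<in> arr C x y; \<alpha> \<in> hom C f g n\<rbrakk>
      \<Longrightarrow> run C g \<cdot> (\<alpha> \<star> id2 C (id1 C x)) = \<alpha> \<cdot> run C f"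
    and pentagon: "\<lbrakk>v \<in> obj C; w \<in> obj C; x \<in> obj C; y \<in> obj C; z \<in> obj C;
        f \<in> arr C v w; g \<in> arr C w x; h \<in> arr C x y; k \<in> arr C y z\<rbrakk>
      \<Longrightarrow> asc C k h (g \<odot> f) \<cdot> asc C (k \<odot> h) g f
        = (id2 C k \<star> asc C h g f) \<cdot> asc C k (h \<odot> g) f \<cdot> (asc C k h g \<star> id2 C f)"
    and triangle: "\<lbrakk>x \<in> obj C; y \<in> obj C; z \<in> obj C; f \<in> arr C x y; g \<in> arr C y z\<rbrakk>
      \<Longrightarrow> (id2 C g \<star> lun C f) \<cdot> asc C g (id1 C y) f = run C g \<star> id2 C f"


section \<open>Strong functors, strong natural transformations, modifications\<close>

text \<open>
  Constraints: \<open>fcmp F g f : F g \<odot> F f \<Rightarrow> F (g \<odot> f)\<close> and \<open>funit F x : id \<Rightarrow> F id\<close>.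
\<close>

record ('o, 'm, 'c, 'p, 'n, 'd) sfun =
  fob   :: "'o \<Rightarrow> 'p"
  farr  :: "'m \<Rightarrow> 'n"
  fcell :: "'c \<Rightarrow> 'd"
  fcmp  :: "'m \<Rightarrow> 'm \<Rightarrow> 'd"
  funit :: "'o \<Rightarrow> 'd"

locale strong_dg_functor = C: dg_bicategory C + D: dg_bicategory D
  for C :: "('o, 'm, 'c::ab_group_add, 'k::field) dgbicat"
    and D :: "('p, 'n, 'd::ab_group_add, 'k) dgbicat" +
  fixes F :: "('o, 'm, 'c, 'p, 'n, 'd) sfun"
  assumes fob_obj: "x \<in> obj C \<Longrightarrow> fob F x \<in> obj D"
    and farr_arr: "\<lbrakk>x \<in> obj C; y \<in> obj C; f \<in> arr C x y\<rbrakk> \<Longrightarrow> farr F f \<in> arr D (fob F x) (fob F y)"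
    and fcell_hom: "\<lbrakk>x \<in> obj C; y \<in> obj C; f \<in> arr C x y; g \<in> arr C x y; \<alpha> \<in> hom C f g n\<rbrakk>
      \<Longrightarrow> fcell F \<alpha> \<in> hom D (farr F f) (farr F g) n"
    and fcell_linear: "\<lbrakk>x \<in> obj C; y \<in> obj C; f \<in> arr C x y; g \<in> arr C x y\<rbrakk>
      \<Longrightarrow> linear_on (scl C) (hom C f g n) (scl D) (fcell F)"
    and fcell_dif: "\<lbrakk>x \<in> obj C; y \<in> obj C; f \<in> arr C x y; g \<in> arr C x y; \<alpha> \<in> hom C f g n\<rbrakk>
      \<Longrightarrow> fcell F (dif C \<alpha>) = dif D (fcell F \<alpha>)"
    and fcell_id2: "\<lbrakk>x \<in> obj C; y \<in> obj C; f \<in> arr C x y\<rbrakk> \<Longrightarrow> fcell F (id2 C f) = id2 D (farr F f)"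
    and fcell_vc: "\<lbrakk>x \<in> obj C; y \<in> obj C; f \<in> arr C x y; g \<in> arr C x y; h \<in> arr C x y;
        \<alpha> \<in> hom C f g m; \<beta> \<in> hom C g h n\<rbrakk>
      \<Longrightarrow> fcell F (\<beta> \<cdot>\<^bsub>C\<^esub> \<alpha>) = fcell F \<beta> \<cdot>\<^bsub>D\<^esub> fcell F \<alpha>"
    and fcmp_iso: "\<lbrakk>x \<in> obj C; y \<in> obj C; z \<in> obj C; f \<in> arr C x y; g \<in> arr C y z\<rbrakk>
      \<Longrightarrow> closed_iso D (farr F g \<odot>\<^bsub>D\<^esub> farr F f) (farr F (g \<odot>\<^bsub>C\<^esub> f)) (fcmp F g f)"
    and fcmp_natural: "\<lbrakk>x \<in> obj C; y \<in> obj C; z \<in> obj C; f \<in> arr C x y; f' \<in> arr C x y;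
        g \<in> arr C y z; g' \<in> arr C y z; \<alpha> \<in> hom C f f' m; \<beta> \<in> hom C g g' n\<rbrakk>
      \<Longrightarrow> fcmp F g' f' \<cdot>\<^bsub>D\<^esub> (fcell F \<beta> \<star>\<^bsub>D\<^esub> fcell F \<alpha>) = fcell F (\<beta> \<star>\<^bsub>C\<^esub> \<alpha>) \<cdot>\<^bsub>D\<^esub> fcmp F g f"
    and funit_iso: "x \<in> obj C
      \<Longrightarrow> closed_iso D (id1 D (fob F x)) (farr F (id1 C x)) (funit F x)"
    and fcmp_asc: "\<lbrakk>w \<in> obj C; x \<in> obj C; y \<in> obj C; z \<in> obj C;
        f \<in> arr C w x; g \<in> arr C x y; h \<in> arr C y z\<rbrakk>
      \<Longrightarrow> fcell F (asc C h g f) \<cdot>\<^bsub>D\<^esub> fcmp F (h \<odot>\<^bsub>C\<^esub> g) f \<cdot>\<^bsub>D\<^esub> (fcmp F h g \<star>\<^bsub>D\<^esub> id2 D (farr F f))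
        = fcmp F h (g \<odot>\<^bsub>C\<^esub> f) \<cdot>\<^bsub>D\<^esub> (id2 D (farr F h) \<star>\<^bsub>D\<^esub> fcmp F g f)
            \<cdot>\<^bsub>D\<^esub> asc D (farr F h) (farr F g) (farr F f)"
    and fcmp_lun: "\<lbrakk>x \<in> obj C; y \<in> obj C; f \<in> arr C x y\<rbrakk>
      \<Longrightarrow> fcell F (lun C f) \<cdot>\<^bsub>D\<^esub> fcmp F (id1 C y) f \<cdot>\<^bsub>D\<^esub> (funit F y \<star>\<^bsub>D\<^esub> id2 D (farr F f))
        = lun D (farr F f)"
    and fcmp_run: "\<lbrakk>x \<in> obj C; y \<in> obj C; f \<in> arr C x y\<rbrakk>
      \<Longrightarrow> fcell F (run C f) \<cdot>\<^bsub>D\<^esub> fcmp F f (id1 C x) \<cdot>\<^bsub>D\<^esub> (id2 D (farr F f) \<star>\<^bsub>D\<^esub> funit F x)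
        = run D (farr F f)"

text \<open>Constraints: \<open>tcell \<eta> f : G f \<odot> \<eta>\<^sub>x \<Rightarrow> \<eta>\<^sub>y \<odot> F f\<close>, where \<open>\<eta>\<^sub>x\<close> is \<open>tarr \<eta> x\<close>.\<close>

record ('o, 'm, 'n, 'd) strans =
  tarr  :: "'o \<Rightarrow> 'n"
  tcell :: "'m \<Rightarrow> 'd"

locale strong_dg_transformation = F: strong_dg_functor C D F + G: strong_dg_functor C D G
  for C :: "('o, 'm, 'c::ab_group_add, 'k::field) dgbicat"
    and D :: "('p, 'n, 'd::ab_group_add, 'k) dgbicat"
    and F G :: "('o, 'm, 'c, 'p, 'n, 'd) sfun" +
  fixes \<eta> :: "('o, 'm, 'n, 'd) strans"
  assumes tarr_arr: "x \<in> obj C \<Longrightarrow> tarr \<eta> x \<in> arr D (fob F x) (fob G x)"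
    and tcell_iso: "\<lbrakk>x \<in> obj C; y \<in> obj C; f \<in> arr C x y\<rbrakk>
      \<Longrightarrow> closed_iso D (farr G f \<odot>\<^bsub>D\<^esub> tarr \<eta> x) (tarr \<eta> y \<odot>\<^bsub>D\<^esub> farr F f) (tcell \<eta> f)"
    and tcell_natural: "\<lbrakk>x \<in> obj C; y \<in> obj C; f \<in> arr C x y; g \<in> arr C x y; \<alpha> \<in> hom C f g n\<rbrakk>
      \<Longrightarrow> tcell \<eta> g \<cdot>\<^bsub>D\<^esub> (fcell G \<alpha> \<star>\<^bsub>D\<^esub> id2 D (tarr \<eta> x))
        = (id2 D (tarr \<eta> y) \<star>\<^bsub>D\<^esub> fcell F \<alpha>) \<cdot>\<^bsub>D\<^esub> tcell \<eta> f"
    and tcell_cmp: "\<lbrakk>x \<in> obj C; y \<in> obj C; z \<in> obj C; f \<in> arr C x y; g \<in> arr C y z\<rbrakk>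
      \<Longrightarrow> tcell \<eta> (g \<odot>\<^bsub>C\<^esub> f) \<cdot>\<^bsub>D\<^esub> (fcmp G g f \<star>\<^bsub>D\<^esub> id2 D (tarr \<eta> x))
        = (id2 D (tarr \<eta> z) \<star>\<^bsub>D\<^esub> fcmp F g f)
          \<cdot>\<^bsub>D\<^esub> asc D (tarr \<eta> z) (farr F g) (farr F f)
          \<cdot>\<^bsub>D\<^esub> (tcell \<eta> g \<star>\<^bsub>D\<^esub> id2 D (farr F f))
          \<cdot>\<^bsub>D\<^esub> inv2 D ((farr G g \<odot>\<^bsub>D\<^esub> tarr \<eta> y) \<odot>\<^bsub>D\<^esub> farr F f) (farr G g \<odot>\<^bsub>D\<^esub> (tarr \<eta> y \<odot>\<^bsub>D\<^esub> farr F f))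
              (asc D (farr G g) (tarr \<eta> y) (farr F f))
          \<cdot>\<^bsub>D\<^esub> (id2 D (farr G g) \<star>\<^bsub>D\<^esub> tcell \<eta> f)
          \<cdot>\<^bsub>D\<^esub> asc D (farr G g) (farr G f) (tarr \<eta> x)"
    and tcell_id1: "x \<in> obj C
      \<Longrightarrow> tcell \<eta> (id1 C x) \<cdot>\<^bsub>D\<^esub> (funit G x \<star>\<^bsub>D\<^esub> id2 D (tarr \<eta> x))
        = (id2 D (tarr \<eta> x) \<star>\<^bsub>D\<^esub> funit F x)
          \<cdot>\<^bsub>D\<^esub> inv2 D (tarr \<eta> x \<odot>\<^bsub>D\<^esub> id1 D (fob F x)) (tarr \<eta> x) (run D (tarr \<eta> x))
          \<cdot>\<^bsub>D\<^esub> lun D (tarr \<eta> x)"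

text \<open>
  Families indexed by the objects of \<open>C\<close> are extended by \<open>0\<close>, so that they form a vector space of
  functions under the pointwise operations.
\<close>

definition prod_hom ::
  "('o, 'm, 'c, 'k) dgbicat \<Rightarrow> ('p, 'n, 'd::zero, 'k) dgbicat \<Rightarrow>
   ('o, 'm, 'n, 'd) strans \<Rightarrow> ('o, 'm, 'n, 'd) strans \<Rightarrow> int \<Rightarrow> ('o \<Rightarrow> 'd) set" where
  "prod_hom C D \<eta> \<theta> n =
     {\<Gamma>. (\<forall>x \<in> obj C. \<Gamma> x \<in> hom D (tarr \<eta> x) (tarr \<theta> x) n) \<and> (\<forall>x. x \<notin> obj C \<longrightarrow> \<Gamma> x = 0)}"

definition modifications ::
  "('o, 'm, 'c, 'k) dgbicat \<Rightarrow> ('p, 'n, 'd::zero, 'k) dgbicat \<Rightarrow>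
   ('o, 'm, 'c, 'p, 'n, 'd) sfun \<Rightarrow> ('o, 'm, 'c, 'p, 'n, 'd) sfun \<Rightarrow>
   ('o, 'm, 'n, 'd) strans \<Rightarrow> ('o, 'm, 'n, 'd) strans \<Rightarrow> ('o \<Rightarrow> 'd) set" where
  "modifications C D F G \<eta> \<theta> =
     {\<Gamma> \<in> prod_hom C D \<eta> \<theta> 0.
        (\<forall>x \<in> obj C. dif D (\<Gamma> x) = 0) \<and>
        (\<forall>x \<in> obj C. \<forall>y \<in> obj C. \<forall>f \<in> arr C x y.
           tcell \<theta> f \<cdot>\<^bsub>D\<^esub> (id2 D (farr G f) \<star>\<^bsub>D\<^esub> \<Gamma> x)
             = (\<Gamma> y \<star>\<^bsub>D\<^esub> id2 D (farr F f)) \<cdot>\<^bsub>D\<^esub> tcell \<eta> f)}"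


section \<open>The category \<open>\<Theta>\<^sub>2\<close>\<close>

text \<open>
  The object \<open>([n];[k\<^sub>1],\<dots>,[k\<^sub>n])\<close> is the list of the \<open>k\<^sub>p\<close>, with columns counted from \<open>1\<close>.  A
  morphism \<open>(\<phi>;{\<phi>\<^sub>i\<^sup>s})\<close> is a pair of functions, only the values prescribed by source and target
  being relevant; \<open>theta_eq S\<close> is equality of morphisms with source \<open>S\<close>.
\<close>

type_synonym theta_ob = "nat list"
type_synonym theta_mor = "(nat \<Rightarrow> nat) \<times> (nat \<Rightarrow> nat \<Rightarrow> nat \<Rightarrow> nat)"

abbreviation col :: "theta_ob \<Rightarrow> nat \<Rightarrow> nat" where
  "col T p \<equiv> T ! (p - 1)"

definition tdim :: "theta_ob \<Rightarrow> nat" where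
  "tdim T = length T + sum_list T"

definition point :: theta_ob where
  "point = []"

definition theta_hom :: "theta_ob \<Rightarrow> theta_ob \<Rightarrow> theta_mor set" where
  "theta_hom S T = {(\<phi>, c).
     (\<forall>i \<le> length S. \<phi> i \<le> length T) \<and> mono_on {..length S} \<phi> \<and>
     (\<forall>i \<in> {1..length S}. \<forall>s \<in> {\<phi> (i - 1)<..\<phi> i}.
        (\<forall>a \<le> col S i. c i s a \<le> col T s) \<and> mono_on {..col S i} (c i s))}"

definition theta_eq :: "theta_ob \<Rightarrow> theta_mor \<Rightarrow> theta_mor \<Rightarrow> bool" where
  "theta_eq S \<Phi> \<Phi>' \<longleftrightarrow>
     (\<forall>i \<le> length S. fst \<Phi> i = fst \<Phi>' i) \<and>
     (\<forall>i \<in> {1..length S}. \<forall>s \<in> {fst \<Phi> (i - 1)<..fst \<Phi> i}. \<forall>a \<le> col S i.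
        snd \<Phi> i s a = snd \<Phi>' i s a)"

subsection \<open>Elementary cofaces\<close>

definition shuffle :: "nat \<Rightarrow> nat \<Rightarrow> (nat \<Rightarrow> nat) \<Rightarrow> bool" where
  "shuffle a b \<sigma> \<longleftrightarrow>
     \<sigma> permutes {1..a + b} \<and> strict_mono_on {1..a} \<sigma> \<and> strict_mono_on {a + 1..a + b} \<sigma>"

datatype coface = Face nat nat | Shuf nat nat nat "nat \<Rightarrow> nat" | DMin | DMax

definition cofaces :: "theta_ob \<Rightarrow> coface set" where
  "cofaces T =
     {Face p i | p i. p \<in> {1..length T} \<and> i \<le> col T p + 1}
     \<union> {Shuf p a b \<sigma> | p a b \<sigma>. p \<in> {1..length T} \<and> col T p = a + b \<and> shuffle a b \<sigma>}
     \<union> {DMin, DMax}"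

definition delta_face :: "nat \<Rightarrow> nat \<Rightarrow> nat" where
  "delta_face i r = (if r < i then r else r + 1)"

fun coface_tgt :: "theta_ob \<Rightarrow> coface \<Rightarrow> theta_ob" where
  "coface_tgt T (Face p i) = T[p - 1 := col T p + 1]"
| "coface_tgt T (Shuf p a b \<sigma>) = take (p - 1) T @ [a, b] @ drop p T"
| "coface_tgt T DMin = 0 # T"
| "coface_tgt T DMax = T @ [0]"

fun coface_mor :: "theta_ob \<Rightarrow> coface \<Rightarrow> theta_mor" where
  "coface_mor T (Face p i) = (id, \<lambda>j s. if j = p then delta_face i else id)"
| "coface_mor T (Shuf p a b \<sigma>) =
     (delta_face p,
      \<lambda>j s. if j = p \<and> s = p then (\<lambda>r. card {t \<in> {1..r}. t \<in> \<sigma> ` {1..a}})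
            else if j = p \<and> s = p + 1 then (\<lambda>r. card {t \<in> {1..r}. t \<notin> \<sigma> ` {1..a}})
            else id)"
| "coface_mor T DMin = (delta_face 0, \<lambda>j s. id)"
| "coface_mor T DMax = (delta_face (length T + 1), \<lambda>j s. id)"

definition esum :: "theta_ob \<Rightarrow> nat \<Rightarrow> nat" where
  "esum T p = (\<Sum>q = 1..p. col T q + 1)"

text \<open>The exponent of the sign of a coface in the differential of the totalization.\<close>

fun coface_sgn :: "theta_ob \<Rightarrow> coface \<Rightarrow> nat" where
  "coface_sgn T (Face p i) = esum T (p - 1) + i + 1"
| "coface_sgn T (Shuf p a b \<sigma>) = esum T (p - 1) + a + 1 + (if sign \<sigma> = (1::int) then 0 else 1)"
| "coface_sgn T DMin = 0"
| "coface_sgn T DMax = esum T (length T) + 1"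

lemma coface_mor_theta_hom:
  assumes "\<delta> \<in> cofaces T"
  shows "coface_mor T \<delta> \<in> theta_hom T (coface_tgt T \<delta>)"
proof (cases \<delta>)
  case (Face p i)
  then have p: "1 \<le> p" "p \<le> length T" and i: "i \<le> col T p + 1"
    using assms by (auto simp: cofaces_def)
  let ?T = "coface_tgt T \<delta>"
  have "(\<forall>r \<le> col T j. snd (coface_mor T \<delta>) j s r \<le> col ?T s) \<and>
        mono_on {..col T j} (snd (coface_mor T \<delta>) j s)"
    if j: "j \<in> {1..length T}" and s: "s \<in> {j - 1<..j}" for j s
  proof -
    have "s = j" using j s by auto
    then show ?thesis
      using j p by (auto simp: Face nth_list_update delta_face_def mono_on_def)
  qed
  then show ?thesis
    by (auto simp: theta_hom_def Face mono_on_def)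
next
  case (Shuf p a b \<sigma>)
  then have p: "1 \<le> p" "p \<le> length T" and ab: "col T p = a + b" and \<sigma>: "shuffle a b \<sigma>"
    using assms by (auto simp: cofaces_def)
  have per: "\<sigma> permutes {1..a + b}"
    using \<sigma> by (simp add: shuffle_def)
  have inj: "inj \<sigma>"
    using per by (rule permutes_inj)
  have img: "\<sigma> ` {1..a + b} = {1..a + b}"
    using per by (rule permutes_image)
  have first: "card {t \<in> {1..r}. t \<in> \<sigma> ` {1..a}} \<le> a" for r
  proof -
    have "card {t \<in> {1..r}. t \<in> \<sigma> ` {1..a}} \<le> card (\<sigma> ` {1..a})"
      by (intro card_mono) auto
    also have "\<dots> = a"
      using inj by (simp add: card_image inj_on_subset)
    finally show ?thesis .
  qed
  have second: "card {t \<in> {1..r}. t \<notin> \<sigma> ` {1..a}} \<le> b" if "r \<le> a + b" for r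
  proof -
    have "{t \<in> {1..r}. t \<notin> \<sigma> ` {1..a}} \<subseteq> \<sigma> ` {a + 1..a + b}"
    proof
      fix t assume t: "t \<in> {t \<in> {1..r}. t \<notin> \<sigma> ` {1..a}}"
      then have "t \<in> \<sigma> ` {1..a + b}"
        using that unfolding img by auto
      then obtain u where "t = \<sigma> u" "u \<in> {1..a + b}" by auto
      then show "t \<in> \<sigma> ` {a + 1..a + b}"
        using t by (cases "u \<le> a") auto
    qed
    then have "card {t \<in> {1..r}. t \<notin> \<sigma> ` {1..a}} \<le> card (\<sigma> ` {a + 1..a + b})"
      by (intro card_mono) auto
    also have "\<dots> = b"
      using inj by (simp add: card_image inj_on_subset)
    finally show ?thesis .
  qed
  have mono: "mono_on {..m} (\<lambda>r. card {t \<in> {1..r}. Q t})" for m :: nat and Q :: "nat \<Rightarrow> bool"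
    by (intro mono_onI card_mono) auto
  let ?T = "coface_tgt T \<delta>"
  have len: "length ?T = length T + 1"
    using p by (simp add: Shuf)
  have colT: "col ?T s = (if s < p then col T s else if s = p then a else if s = p + 1 then b else col T (s - 1))"
    if "s \<ge> 1" "s \<le> length T + 1" for s
  proof -
    consider "s < p" | "s = p" | "s = p + 1" | k where "s = p + 2 + k"
    proof -
      have "s < p \<or> s = p \<or> s = p + 1 \<or> s = p + 2 + (s - (p + 2))" by linarith
      then show thesis using that by blast
    qed
    then show ?thesis
      using p that by cases (auto simp: Shuf nth_append min_def)
  qed
  have "(\<forall>r \<le> col T j. snd (coface_mor T \<delta>) j s r \<le> col ?T s) \<and>
        mono_on {..col T j} (snd (coface_mor T \<delta>) j s)"
    if j: "j \<in> {1..length T}" and s: "s \<in> {delta_face p (j - 1)<..delta_face p j}" for j s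
  proof -
    consider "j < p" "s = j" | "j = p" "s = p" | "j = p" "s = p + 1" | "j > p" "s = j + 1"
    proof -
      have "j < p \<and> s = j \<or> j = p \<and> (s = p \<or> s = p + 1) \<or> j > p \<and> s = j + 1"
        using j s p unfolding delta_face_def by (simp split: if_splits) linarith+
      then show thesis using that by blast
    qed
    then show ?thesis
    proof cases
      case 1
      then show ?thesis using j p by (subst colT) (auto simp: Shuf mono_on_def)
    next
      case 2
      then show ?thesis using p first mono by (subst colT) (auto simp: Shuf)
    next
      case 3
      then show ?thesis using p second mono ab by (subst colT) (auto simp: Shuf)
    next
      case 4
      then show ?thesis using j p by (subst colT) (auto simp: Shuf mono_on_def)
    qed
  qed
  moreover have "mono_on {..length T} (delta_face p)" "\<forall>i \<le> length T. delta_face p i \<le> length ?T"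
    unfolding len by (auto simp: mono_on_def delta_face_def)
  ultimately show ?thesis
    by (auto simp: theta_hom_def Shuf)
next
  case DMin
  have "\<forall>r \<le> col T j. r \<le> col (0 # T) s"
    if j: "j \<in> {1..length T}" and s: "s \<in> {delta_face 0 (j - 1)<..delta_face 0 j}" for j s
  proof -
    have "s = Suc j" using j s by (auto simp: delta_face_def)
    then show ?thesis using j by (simp add: nth_Cons')
  qed
  then show ?thesis
    unfolding DMin by (auto simp: theta_hom_def delta_face_def mono_on_def)
next
  case DMax
  have "(\<forall>r \<le> col T j. r \<le> col (T @ [0]) s)"
    if j: "j \<in> {1..length T}" and s: "s \<in> {j - 1<..j}" for j s
  proof -
    have "s = j" using j s by auto
    then show ?thesis using j by (auto simp: nth_append)
  qed
  then show ?thesis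
    unfolding DMax by (auto simp: theta_hom_def delta_face_def mono_on_def)
qed

subsection \<open>Totalization\<close>

text \<open>
  \<open>cpx X T n\<close> is the degree \<open>n\<close> part of \<open>X\<^sub>T\<close>; \<open>cdif X T n\<close> is the differential and
  \<open>cact X S T \<Phi> n\<close> the action of \<open>\<Phi> : S \<rightarrow> T\<close> on degree \<open>n\<close> elements.
\<close>

record 'x cocellular =
  cpx  :: "theta_ob \<Rightarrow> int \<Rightarrow> 'x set"
  cdif :: "theta_ob \<Rightarrow> int \<Rightarrow> 'x \<Rightarrow> 'x"
  cact :: "theta_ob \<Rightarrow> theta_ob \<Rightarrow> theta_mor \<Rightarrow> int \<Rightarrow> 'x \<Rightarrow> 'x"

definition Tot :: "'x::ab_group_add cocellular \<Rightarrow> int \<Rightarrow> (theta_ob \<Rightarrow> 'x) set" where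
  "Tot X m = {u. (\<forall>T. u T \<noteq> 0 \<longrightarrow> u T \<in> cpx X T (m - int (tdim T))) \<and>
                 (\<forall>l. finite {T. tdim T = l \<and> u T \<noteq> 0})}"

definition Tot_dif :: "'x::ab_group_add cocellular \<Rightarrow> int \<Rightarrow> (theta_ob \<Rightarrow> 'x) \<Rightarrow> theta_ob \<Rightarrow> 'x" where
  "Tot_dif X m u T' =
     (\<Sum>T | tdim T + 1 = tdim T' \<and> u T \<noteq> 0. \<Sum>\<delta> | \<delta> \<in> cofaces T \<and> coface_tgt T \<delta> = T'.
        sgn_pow (int (coface_sgn T \<delta>)) (cact X T T' (coface_mor T \<delta>) (m - int (tdim T)) (u T)))
     + sgn_pow (int (tdim T')) (cdif X T' (m - int (tdim T')) (u T'))"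

definition Tot_incl :: "theta_ob \<Rightarrow> 'x::zero \<Rightarrow> theta_ob \<Rightarrow> 'x" where
  "Tot_incl S \<Psi> T = (if T = S then \<Psi> else 0)"

text \<open>The elements of \<open>X\<^sub>S\<close> which have total degree \<open>m\<close> and are closed in the totalization.\<close>

definition Tot_closed :: "'x::ab_group_add cocellular \<Rightarrow> theta_ob \<Rightarrow> int \<Rightarrow> 'x set" where
  "Tot_closed X S m =
     {\<Psi> \<in> cpx X S (m - int (tdim S)). Tot_incl S \<Psi> \<in> Tot X m \<and> Tot_dif X m (Tot_incl S \<Psi>) = 0}"


section \<open>Free bicategories and the category \<open>\<Theta>\<^sub>2\<close>-hat\<close>

record ('o, 'm, 't) globset =
  gobj :: "'o set"
  garr :: "'m set"
  gcel :: "'t set"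
  s0 :: "'m \<Rightarrow> 'o"
  t0 :: "'m \<Rightarrow> 'o"
  s1 :: "'t \<Rightarrow> 'm"
  t1 :: "'t \<Rightarrow> 'm"

datatype ('o, 'm) word =
  WGen 'm | WId 'o | WComp "('o, 'm) word" "('o, 'm) word"
  for map: map_word

primrec letters :: "('o, 'm) word \<Rightarrow> 'm set" where
  "letters (WGen f) = {f}"
| "letters (WId x) = {}"
| "letters (WComp u v) = letters u \<union> letters v"

datatype ('o, 'm, 't) fcell2 =
    CGen 't
  | CId "('o, 'm) word"
  | CV "('o, 'm, 't) fcell2" "('o, 'm, 't) fcell2"
  | CH "('o, 'm, 't) fcell2" "('o, 'm, 't) fcell2"
  | CAsc "('o, 'm) word" "('o, 'm) word" "('o, 'm) word"
  | CAscInv "('o, 'm) word" "('o, 'm) word" "('o, 'm) word"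
  | CLun "('o, 'm) word"
  | CLunInv "('o, 'm) word"
  | CRun "('o, 'm) word"
  | CRunInv "('o, 'm) word"

inductive wty :: "('o, 'm, 't) globset \<Rightarrow> ('o, 'm) word \<Rightarrow> 'o \<Rightarrow> 'o \<Rightarrow> bool" for X where
  "f \<in> garr X \<Longrightarrow> wty X (WGen f) (s0 X f) (t0 X f)"
| "x \<in> gobj X \<Longrightarrow> wty X (WId x) x x"
| "\<lbrakk>wty X u y z; wty X v x y\<rbrakk> \<Longrightarrow> wty X (WComp u v) x z"

inductive cty ::
  "('o, 'm, 't) globset \<Rightarrow> ('o, 'm, 't) fcell2 \<Rightarrow> ('o, 'm) word \<Rightarrow> ('o, 'm) word \<Rightarrow> 'o \<Rightarrow> 'o \<Rightarrow> bool"
  for X where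
  "\<lbrakk>t \<in> gcel X; wty X (WGen (s1 X t)) x y; wty X (WGen (t1 X t)) x y\<rbrakk>
     \<Longrightarrow> cty X (CGen t) (WGen (s1 X t)) (WGen (t1 X t)) x y"
| "wty X f x y \<Longrightarrow> cty X (CId f) f f x y"
| "\<lbrakk>cty X b g h x y; cty X a f g x y\<rbrakk> \<Longrightarrow> cty X (CV b a) f h x y"
| "\<lbrakk>cty X b g g' y z; cty X a f f' x y\<rbrakk> \<Longrightarrow> cty X (CH b a) (WComp g f) (WComp g' f') x z"
| "\<lbrakk>wty X h y z; wty X g x y; wty X f w x\<rbrakk>
     \<Longrightarrow> cty X (CAsc h g f) (WComp (WComp h g) f) (WComp h (WComp g f)) w z"
| "\<lbrakk>wty X h y z; wty X g x y; wty X f w x\<rbrakk>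
     \<Longrightarrow> cty X (CAscInv h g f) (WComp h (WComp g f)) (WComp (WComp h g) f) w z"
| "wty X f x y \<Longrightarrow> cty X (CLun f) (WComp (WId y) f) f x y"
| "wty X f x y \<Longrightarrow> cty X (CLunInv f) f (WComp (WId y) f) x y"
| "wty X f x y \<Longrightarrow> cty X (CRun f) (WComp f (WId x)) f x y"
| "wty X f x y \<Longrightarrow> cty X (CRunInv f) f (WComp f (WId x)) x y"

text \<open>The congruence on formal 2-cells generated by the axioms of a bicategory.\<close>

inductive ceq :: "('o, 'm, 't) globset \<Rightarrow> ('o, 'm, 't) fcell2 \<Rightarrow> ('o, 'm, 't) fcell2 \<Rightarrow> bool" for X where
  ceq_refl: "cty X a f g x y \<Longrightarrow> ceq X a a"
| ceq_sym: "ceq X a b \<Longrightarrow> ceq X b a"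
| ceq_trans: "\<lbrakk>ceq X a b; ceq X b c\<rbrakk> \<Longrightarrow> ceq X a c"
| ceq_CV: "\<lbrakk>ceq X b b'; ceq X a a'; cty X b g h x y; cty X a f g x y\<rbrakk> \<Longrightarrow> ceq X (CV b a) (CV b' a')"
| ceq_CH: "\<lbrakk>ceq X b b'; ceq X a a'; cty X b g g' y z; cty X a f f' x y\<rbrakk> \<Longrightarrow> ceq X (CH b a) (CH b' a')"
| ceq_assoc: "\<lbrakk>cty X c h k x y; cty X b g h x y; cty X a f g x y\<rbrakk>
     \<Longrightarrow> ceq X (CV (CV c b) a) (CV c (CV b a))"
| ceq_id_left: "cty X a f g x y \<Longrightarrow> ceq X (CV (CId g) a) a"
| ceq_id_right: "cty X a f g x y \<Longrightarrow> ceq X (CV a (CId f)) a"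
| ceq_CH_id: "\<lbrakk>wty X g y z; wty X f x y\<rbrakk> \<Longrightarrow> ceq X (CH (CId g) (CId f)) (CId (WComp g f))"
| ceq_interchange: "\<lbrakk>cty X b' g' g'' y z; cty X b g g' y z; cty X a' f' f'' x y; cty X a f f' x y\<rbrakk>
     \<Longrightarrow> ceq X (CV (CH b' a') (CH b a)) (CH (CV b' b) (CV a' a))"
| ceq_asc_natural: "\<lbrakk>cty X c h h' y z; cty X b g g' x y; cty X a f f' w x\<rbrakk>
     \<Longrightarrow> ceq X (CV (CAsc h' g' f') (CH (CH c b) a)) (CV (CH c (CH b a)) (CAsc h g f))"
| ceq_asc_inv1: "\<lbrakk>wty X h y z; wty X g x y; wty X f w x\<rbrakk>
     \<Longrightarrow> ceq X (CV (CAscInv h g f) (CAsc h g f)) (CId (WComp (WComp h g) f))"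
| ceq_asc_inv2: "\<lbrakk>wty X h y z; wty X g x y; wty X f w x\<rbrakk>
     \<Longrightarrow> ceq X (CV (CAsc h g f) (CAscInv h g f)) (CId (WComp h (WComp g f)))"
| ceq_lun_natural: "cty X a f g x y \<Longrightarrow> ceq X (CV (CLun g) (CH (CId (WId y)) a)) (CV a (CLun f))"
| ceq_lun_inv1: "wty X f x y \<Longrightarrow> ceq X (CV (CLunInv f) (CLun f)) (CId (WComp (WId y) f))"
| ceq_lun_inv2: "wty X f x y \<Longrightarrow> ceq X (CV (CLun f) (CLunInv f)) (CId f)"
| ceq_run_natural: "cty X a f g x y \<Longrightarrow> ceq X (CV (CRun g) (CH a (CId (WId x)))) (CV a (CRun f))"
| ceq_run_inv1: "wty X f x y \<Longrightarrow> ceq X (CV (CRunInv f) (CRun f)) (CId (WComp f (WId x)))"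
| ceq_run_inv2: "wty X f x y \<Longrightarrow> ceq X (CV (CRun f) (CRunInv f)) (CId f)"
| ceq_pentagon: "\<lbrakk>wty X k y z; wty X h x y; wty X g w x; wty X f v w\<rbrakk>
     \<Longrightarrow> ceq X (CV (CAsc k h (WComp g f)) (CAsc (WComp k h) g f))
               (CV (CH (CId k) (CAsc h g f)) (CV (CAsc k (WComp h g) f) (CH (CAsc k h g) (CId f))))"
| ceq_triangle: "\<lbrakk>wty X g y z; wty X f x y\<rbrakk>
     \<Longrightarrow> ceq X (CV (CH (CId g) (CLun f)) (CAsc g (WId y) f)) (CH (CRun g) (CId f))"

definition cls :: "('o, 'm, 't) globset \<Rightarrow> ('o, 'm, 't) fcell2 \<Rightarrow> ('o, 'm, 't) fcell2 set" where
  "cls X a = {b. ceq X a b}"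

record ('o, 'm, 'c) bicat2 = "('o, 'm, 'c) bicat" +
  cells :: "'m \<Rightarrow> 'm \<Rightarrow> 'c set"

definition free_bicat ::
  "('o, 'm, 't) globset \<Rightarrow> ('o, ('o, 'm) word, ('o, 'm, 't) fcell2 set) bicat2" where
  "free_bicat X =
     \<lparr> obj = gobj X,
       arr = (\<lambda>x y. {f. wty X f x y}),
       id1 = WId,
       cmp = WComp,
       id2 = (\<lambda>f. cls X (CId f)),
       vc = (\<lambda>B A. \<Union>b\<in>B. \<Union>a\<in>A. cls X (CV b a)),
       hc = (\<lambda>B A. \<Union>b\<in>B. \<Union>a\<in>A. cls X (CH b a)),
       asc = (\<lambda>h g f. cls X (CAsc h g f)),
       lun = (\<lambda>f. cls X (CLun f)),
       run = (\<lambda>f. cls X (CRun f)),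
       cells = (\<lambda>f g. {cls X a | a x y. cty X a f g x y}) \<rparr>"

record ('o, 'm, 'c, 'p, 'n, 'd) strictfun =
  sob   :: "'o \<Rightarrow> 'p"
  sarr  :: "'m \<Rightarrow> 'n"
  scell :: "'c \<Rightarrow> 'd"

locale strict_functor =
  fixes B :: "('o, 'm, 'c) bicat2" and B' :: "('p, 'n, 'd) bicat2"
    and P :: "('o, 'm, 'c, 'p, 'n, 'd) strictfun"
  assumes sob_obj: "x \<in> obj B \<Longrightarrow> sob P x \<in> obj B'"
    and sarr_arr: "\<lbrakk>x \<in> obj B; y \<in> obj B; f \<in> arr B x y\<rbrakk> \<Longrightarrow> sarr P f \<in> arr B' (sob P x) (sob P y)"
    and scell_cells: "\<lbrakk>x \<in> obj B; y \<in> obj B; f \<in> arr B x y; g \<in> arr B x y; \<alpha> \<in> cells B f g\<rbrakk>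
      \<Longrightarrow> scell P \<alpha> \<in> cells B' (sarr P f) (sarr P g)"
    and sarr_id1: "x \<in> obj B \<Longrightarrow> sarr P (id1 B x) = id1 B' (sob P x)"
    and sarr_cmp: "\<lbrakk>x \<in> obj B; y \<in> obj B; z \<in> obj B; f \<in> arr B x y; g \<in> arr B y z\<rbrakk>
      \<Longrightarrow> sarr P (g \<odot>\<^bsub>B\<^esub> f) = sarr P g \<odot>\<^bsub>B'\<^esub> sarr P f"
    and scell_id2: "\<lbrakk>x \<in> obj B; y \<in> obj B; f \<in> arr B x y\<rbrakk> \<Longrightarrow> scell P (id2 B f) = id2 B' (sarr P f)"
    and scell_vc: "\<lbrakk>x \<in> obj B; y \<in> obj B; f \<in> arr B x y; g \<in> arr B x y; h \<in> arr B x y;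
        \<alpha> \<in> cells B f g; \<beta> \<in> cells B g h\<rbrakk> \<Longrightarrow> scell P (\<beta> \<cdot>\<^bsub>B\<^esub> \<alpha>) = scell P \<beta> \<cdot>\<^bsub>B'\<^esub> scell P \<alpha>"
    and scell_hc: "\<lbrakk>x \<in> obj B; y \<in> obj B; z \<in> obj B; f \<in> arr B x y; f' \<in> arr B x y;
        g \<in> arr B y z; g' \<in> arr B y z; \<alpha> \<in> cells B f f'; \<beta> \<in> cells B g g'\<rbrakk>
      \<Longrightarrow> scell P (\<beta> \<star>\<^bsub>B\<^esub> \<alpha>) = scell P \<beta> \<star>\<^bsub>B'\<^esub> scell P \<alpha>"
    and scell_asc: "\<lbrakk>w \<in> obj B; x \<in> obj B; y \<in> obj B; z \<in> obj B;
        f \<in> arr B w x; g \<in> arr B x y; h \<in> arr B y z\<rbrakk>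
      \<Longrightarrow> scell P (asc B h g f) = asc B' (sarr P h) (sarr P g) (sarr P f)"
    and scell_lun: "\<lbrakk>x \<in> obj B; y \<in> obj B; f \<in> arr B x y\<rbrakk> \<Longrightarrow> scell P (lun B f) = lun B' (sarr P f)"
    and scell_run: "\<lbrakk>x \<in> obj B; y \<in> obj B; f \<in> arr B x y\<rbrakk> \<Longrightarrow> scell P (run B f) = run B' (sarr P f)"

definition star :: "theta_ob \<Rightarrow> (nat, nat \<times> nat, nat \<times> nat) globset" where
  "star T =
     \<lparr> gobj = {0..length T},
       garr = {(i, j). i \<in> {1..length T} \<and> j \<le> col T i},
       gcel = {(i, j). i \<in> {1..length T} \<and> j \<in> {1..col T i}},
       s0 = (\<lambda>(i, j). i - 1),
       t0 = fst,
       s1 = (\<lambda>(i, j). (i, j - 1)),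
       t1 = id \<rparr>"

type_synonym tword = "(nat, nat \<times> nat) word"
type_synonym tcell2 = "(nat, nat \<times> nat, nat \<times> nat) fcell2 set"
type_synonym hat_mor = "(nat, tword, tcell2, nat, tword, tcell2) strictfun"

definition hat_hom :: "theta_ob \<Rightarrow> theta_ob \<Rightarrow> hat_mor set" where
  "hat_hom S T = {P. strict_functor (free_bicat (star S)) (free_bicat (star T)) P}"

text \<open>
  The functor to \<open>\<Theta>\<^sub>2\<close>: the image of the 1-cell \<open>(i,a)\<close> is a bracketed composite of exactly one
  1-cell \<open>(s, \<phi>\<^sub>i\<^sup>s(a))\<close> for each \<open>\<phi>(i-1) < s \<le> \<phi>(i)\<close>, and of identities.
\<close>

definition underlying :: "hat_mor \<Rightarrow> theta_mor" where
  "underlying P = (sob P, \<lambda>i s a. THE j. (s, j) \<in> letters (sarr P (WGen (i, a))))"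


section \<open>Structure isomorphisms\<close>

text \<open>
  A formal composite is normalized to the right-nested composite of its letters without
  identities (or to a single identity).  By coherence, any isomorphism composed of
  constraints between the values of two formal composites with equal normal form is the one
  obtained by passing through the normal form; the latter is given explicitly.
\<close>

primrec ev :: "('o, 'm, 'c, 'z) bicat_scheme \<Rightarrow> ('o, 'm) word \<Rightarrow> 'm" where
  "ev C (WGen f) = f"
| "ev C (WId x) = id1 C x"
| "ev C (WComp u v) = ev C u \<odot>\<^bsub>C\<^esub> ev C v"

fun is_WId :: "('o, 'm) word \<Rightarrow> bool" where
  "is_WId (WId x) = True"
| "is_WId _ = False"

text \<open>\<open>mg u v\<close> is the normal form of \<open>WComp u v\<close> for normal \<open>u\<close> and \<open>v\<close>; \<open>mg_iso C u v\<close> is the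
  isomorphism \<open>ev C u \<odot> ev C v \<Rightarrow> ev C (mg u v)\<close>.\<close>

primrec mg :: "('o, 'm) word \<Rightarrow> ('o, 'm) word \<Rightarrow> ('o, 'm) word" where
  "mg (WGen f) v = (if is_WId v then WGen f else WComp (WGen f) v)"
| "mg (WId x) v = v"
| "mg (WComp a b) v = mg a (mg b v)"

primrec mg_iso :: "('o, 'm, 'c, 'z) bicat_scheme \<Rightarrow> ('o, 'm) word \<Rightarrow> ('o, 'm) word \<Rightarrow> 'c" where
  "mg_iso C (WGen f) v = (if is_WId v then run C f else id2 C (f \<odot>\<^bsub>C\<^esub> ev C v))"
| "mg_iso C (WId x) v = lun C (ev C v)"
| "mg_iso C (WComp a b) v =
     mg_iso C a (mg b v) \<cdot>\<^bsub>C\<^esub> (id2 C (ev C a) \<star>\<^bsub>C\<^esub> mg_iso C b v) \<cdot>\<^bsub>C\<^esub> asc C (ev C a) (ev C b) (ev C v)"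

primrec nf :: "('o, 'm) word \<Rightarrow> ('o, 'm) word" where
  "nf (WGen f) = WGen f"
| "nf (WId x) = WId x"
| "nf (WComp u v) = mg (nf u) (nf v)"

primrec nf_iso :: "('o, 'm, 'c, 'z) bicat_scheme \<Rightarrow> ('o, 'm) word \<Rightarrow> 'c" where
  "nf_iso C (WGen f) = id2 C f"
| "nf_iso C (WId x) = id2 C (id1 C x)"
| "nf_iso C (WComp u v) = mg_iso C (nf u) (nf v) \<cdot>\<^bsub>C\<^esub> (nf_iso C u \<star>\<^bsub>C\<^esub> nf_iso C v)"

definition can :: "('o, 'm, 'c::zero, 'k) dgbicat \<Rightarrow> ('o, 'm) word \<Rightarrow> ('o, 'm) word \<Rightarrow> 'c" where
  "can C w w' = inv2 C (ev C w') (ev C (nf w')) (nf_iso C w') \<cdot>\<^bsub>C\<^esub> nf_iso C w"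

text \<open>
  Formal composites in \<open>D\<close> of 1-morphisms of \<open>D\<close> and of images under \<open>F\<close> or \<open>G\<close> of formal composites
  in \<open>C\<close>; \<open>spread\<close> moves the functors to the letters, using the constraints of \<open>F\<close> and \<open>G\<close>.
\<close>

datatype ('o, 'm, 'n) dword =
  DArr 'n | DF "('o, 'm) word" | DG "('o, 'm) word" | DComp "('o, 'm, 'n) dword" "('o, 'm, 'n) dword"

primrec spread_iso ::
  "('o, 'm, 'c, 'k) dgbicat \<Rightarrow> ('p, 'n, 'd::zero, 'k) dgbicat \<Rightarrow> ('o, 'm, 'c, 'p, 'n, 'd) sfun \<Rightarrow>
   ('o, 'm) word \<Rightarrow> 'd" where
  "spread_iso C D F (WGen f) = id2 D (farr F f)"
| "spread_iso C D F (WId x) = inv2 D (id1 D (fob F x)) (farr F (id1 C x)) (funit F x)"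
| "spread_iso C D F (WComp u v) =
     (spread_iso C D F u \<star>\<^bsub>D\<^esub> spread_iso C D F v) \<cdot>\<^bsub>D\<^esub>
     inv2 D (farr F (ev C u) \<odot>\<^bsub>D\<^esub> farr F (ev C v)) (farr F (ev C u \<odot>\<^bsub>C\<^esub> ev C v)) (fcmp F (ev C u) (ev C v))"

context
  fixes C :: "('o, 'm, 'c, 'k) dgbicat" and D :: "('p, 'n, 'd::zero, 'k) dgbicat"
    and F G :: "('o, 'm, 'c, 'p, 'n, 'd) sfun"
begin

primrec dev :: "('o, 'm, 'n) dword \<Rightarrow> 'n" where
  "dev (DArr a) = a"
| "dev (DF w) = farr F (ev C w)"
| "dev (DG w) = farr G (ev C w)"
| "dev (DComp u v) = dev u \<odot>\<^bsub>D\<^esub> dev v"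

primrec dspread :: "('o, 'm, 'n) dword \<Rightarrow> ('p, 'n) word" where
  "dspread (DArr a) = WGen a"
| "dspread (DF w) = map_word (fob F) (farr F) w"
| "dspread (DG w) = map_word (fob G) (farr G) w"
| "dspread (DComp u v) = WComp (dspread u) (dspread v)"

primrec dspread_iso :: "('o, 'm, 'n) dword \<Rightarrow> 'd" where
  "dspread_iso (DArr a) = id2 D a"
| "dspread_iso (DF w) = spread_iso C D F w"
| "dspread_iso (DG w) = spread_iso C D G w"
| "dspread_iso (DComp u v) = dspread_iso u \<star>\<^bsub>D\<^esub> dspread_iso v"

definition dcan :: "('o, 'm, 'n) dword \<Rightarrow> ('o, 'm, 'n) dword \<Rightarrow> 'd" where
  "dcan w w' =
     inv2 D (dev w') (ev D (dspread w')) (dspread_iso w')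
     \<cdot>\<^bsub>D\<^esub> can D (dspread w) (dspread w')
     \<cdot>\<^bsub>D\<^esub> dspread_iso w"

end


section \<open>The 2-cocellular complex \<open>A(C,D)(F,G)(\<eta>,\<theta>)\<close>\<close>

text \<open>
  A \<open>T\<close>-datum is a pair of lists \<open>(x, f)\<close> with \<open>x ! i\<close> the object \<open>x\<^sub>i\<close> and \<open>mor f i j\<close> the
  1-morphism \<open>f\<^sub>i\<^sub>j\<close>.  Homogeneous elements are pairs of a degree and an element;
  \<open>two \<sigma> i j\<close> is \<open>\<sigma>\<^sub>i\<^sub>j\<close>.
\<close>

type_synonym ('o, 'm) datum = "'o list \<times> 'm list list"
type_synonym 'c twos = "(int \<times> 'c) list list"
type_synonym ('o, 'm, 'c, 'd) cochain = "('o, 'm) datum \<Rightarrow> 'c twos \<Rightarrow> 'd"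

abbreviation mor :: "'m list list \<Rightarrow> nat \<Rightarrow> nat \<Rightarrow> 'm" where
  "mor f i j \<equiv> f ! (i - 1) ! j"

abbreviation two :: "'a list list \<Rightarrow> nat \<Rightarrow> nat \<Rightarrow> 'a" where
  "two \<sigma> i j \<equiv> \<sigma> ! (i - 1) ! (j - 1)"

definition upd_two :: "'a list list \<Rightarrow> nat \<Rightarrow> nat \<Rightarrow> 'a \<Rightarrow> 'a list list" where
  "upd_two \<sigma> i j y = \<sigma>[i - 1 := (\<sigma> ! (i - 1))[j - 1 := y]]"

definition data :: "('o, 'm, 'c, 'k) dgbicat \<Rightarrow> theta_ob \<Rightarrow> ('o, 'm) datum set" where
  "data C T = {(x, f).
     length x = length T + 1 \<and> set x \<subseteq> obj C \<and> length f = length T \<and>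
     (\<forall>i \<in> {1..length T}. length (f ! (i - 1)) = col T i + 1 \<and>
        (\<forall>j \<le> col T i. mor f i j \<in> arr C (x ! (i - 1)) (x ! i)))}"

definition places :: "theta_ob \<Rightarrow> (nat \<times> nat) set" where
  "places T = {(i, j). i \<in> {1..length T} \<and> j \<in> {1..col T i}}"

definition twos :: "('o, 'm, 'c, 'k) dgbicat \<Rightarrow> theta_ob \<Rightarrow> 'm list list \<Rightarrow> 'c twos set" where
  "twos C T f = {\<sigma>.
     length \<sigma> = length T \<and> (\<forall>i \<in> {1..length T}. length (\<sigma> ! (i - 1)) = col T i) \<and>
     (\<forall>(i, j) \<in> places T. snd (two \<sigma> i j) \<in> hom C (mor f i (j - 1)) (mor f i j) (fst (two \<sigma> i j)))}"

text \<open>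
  Tensor products are ordered lexicographically in \<open>(i,j)\<close>.  The place \<open>(0,0)\<close> stands for \<open>\<Psi>\<close>, which
  precedes all \<open>\<sigma>\<^sub>i\<^sub>j\<close>.
\<close>

definition before :: "nat \<times> nat \<Rightarrow> nat \<times> nat \<Rightarrow> bool" where
  "before a b \<longleftrightarrow> fst a < fst b \<or> (fst a = fst b \<and> snd a < snd b)"

text \<open>The exponent of the Koszul sign for rearranging \<open>\<Psi>, \<sigma>\<^sub>1\<^sub>1, \<sigma>\<^sub>1\<^sub>2, \<dots>\<close> in the order of the list.\<close>

definition koszul :: "(nat \<times> nat \<Rightarrow> int) \<Rightarrow> (nat \<times> nat) list \<Rightarrow> int" where
  "koszul deg ps =
     (\<Sum>v < length ps. \<Sum>u < v. if before (ps ! v) (ps ! u) then deg (ps ! u) * deg (ps ! v) else 0)"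

fun wcomps :: "'o \<Rightarrow> ('o, 'm) word list \<Rightarrow> ('o, 'm) word" where
  "wcomps x [] = WId x"
| "wcomps x [w] = w"
| "wcomps x (w # v # ws) = WComp w (wcomps x (v # ws))"

fun hcomps :: "('o, 'm, 'c, 'z) bicat_scheme \<Rightarrow> 'o \<Rightarrow> 'c list \<Rightarrow> 'c" where
  "hcomps C x [] = id2 C (id1 C x)"
| "hcomps C x [\<alpha>] = \<alpha>"
| "hcomps C x (\<alpha> # \<beta> # \<gamma>s) = \<alpha> \<star>\<^bsub>C\<^esub> hcomps C x (\<beta> # \<gamma>s)"

text \<open>Indices \<open>q, q - 1, \<dots>, p + 1\<close>, i.e. in the order of composition.\<close>

definition down :: "nat \<Rightarrow> nat \<Rightarrow> nat list" where
  "down p q = rev [p + 1..<q + 1]"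

text \<open>The composite of the \<open>f\<^sub>s\<^sub>,\<^sub>j\<^sub>(\<^sub>s\<^sub>)\<close>, \<open>p < s \<le> q\<close>.\<close>

definition seg :: "('o, 'm) datum \<Rightarrow> nat \<Rightarrow> nat \<Rightarrow> (nat \<Rightarrow> nat) \<Rightarrow> ('o, 'm) word" where
  "seg dat p q j = wcomps (fst dat ! p) (map (\<lambda>s. WGen (mor (snd dat) s (j s))) (down p q))"

text \<open>
  The horizontal composite over \<open>p < s \<le> q\<close> of the vertical composites of the \<open>\<sigma>\<^sub>s\<^sub>j\<close> with
  \<open>lo s < j \<le> hi s\<close>; and the places of these factors in their order of appearance.
\<close>

definition block ::
  "('o, 'm, 'c, 'k) dgbicat \<Rightarrow> ('o, 'm) datum \<Rightarrow> 'c twos \<Rightarrow> nat \<Rightarrow> nat \<Rightarrow> (nat \<Rightarrow> nat) \<Rightarrow> (nat \<Rightarrow> nat) \<Rightarrow> 'c"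
  where
  "block C dat \<sigma> p q lo hi =
     hcomps C (fst dat ! p)
       (map (\<lambda>s. foldr (vc C) (map (\<lambda>j. snd (two \<sigma> s j)) (down (lo s) (hi s))) (id2 C (mor (snd dat) s (lo s))))
         (down p q))"

definition block_places :: "nat \<Rightarrow> nat \<Rightarrow> (nat \<Rightarrow> nat) \<Rightarrow> (nat \<Rightarrow> nat) \<Rightarrow> (nat \<times> nat) list" where
  "block_places p q lo hi = concat (map (\<lambda>s. map (Pair s) (down (lo s) (hi s))) (down p q))"

text \<open>The formal composites \<open>f\<^sub>m\<^sub>i\<^sub>n\<close>, \<open>f\<^sub>m\<^sub>a\<^sub>x\<close> of a \<open>T\<close>-datum.\<close>

definition wmin :: "theta_ob \<Rightarrow> ('o, 'm) datum \<Rightarrow> ('o, 'm) word" where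
  "wmin T dat = seg dat 0 (length T) (\<lambda>s. 0)"

definition wmax :: "theta_ob \<Rightarrow> ('o, 'm) datum \<Rightarrow> ('o, 'm) word" where
  "wmax T dat = seg dat 0 (length T) (col T)"

text \<open>The value of a 1-cell of the free bicategory on \<open>T\<^sup>*\<close> at a \<open>T\<close>-datum, as a formal composite.\<close>

definition wsubst :: "('o, 'm) datum \<Rightarrow> tword \<Rightarrow> ('o, 'm) word" where
  "wsubst dat w = map_word (\<lambda>i. fst dat ! i) (\<lambda>(s, j). mor (snd dat) s j) w"

context
  fixes C :: "('o, 'm, 'c::ab_group_add, 'k::field) dgbicat" and D :: "('p, 'n, 'd::ab_group_add, 'k) dgbicat"
    and F G :: "('o, 'm, 'c, 'p, 'n, 'd) sfun"
    and \<eta> \<theta> :: "('o, 'm, 'n, 'd) strans"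
begin

text \<open>
  The source \<open>\<eta> \<odot> F w\<close> and target \<open>G w \<odot> \<theta>\<close> of the values of a cochain on an object with \<open>k\<close>
  columns; for \<open>k = 0\<close> they are \<open>\<eta>\<close> and \<open>\<theta>\<close>.
\<close>

definition src_word :: "nat \<Rightarrow> 'o \<Rightarrow> ('o, 'm) word \<Rightarrow> ('o, 'm, 'n) dword" where
  "src_word k x w = (if k = 0 then DArr (tarr \<eta> x) else DComp (DArr (tarr \<eta> x)) (DF w))"

definition tgt_word :: "nat \<Rightarrow> 'o \<Rightarrow> ('o, 'm) word \<Rightarrow> ('o, 'm, 'n) dword" where
  "tgt_word k x w = (if k = 0 then DArr (tarr \<theta> x) else DComp (DG w) (DArr (tarr \<theta> x)))"

text \<open>
  A homomorphism from a tensor product is a multilinear function; it is given on homogeneous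
  elements, in every degree, and extended by \<open>0\<close> off the relevant arguments.
\<close>

definition Ahat_cpx :: "theta_ob \<Rightarrow> int \<Rightarrow> ('o, 'm, 'c, 'd) cochain set" where
  "Ahat_cpx T d = {\<Psi>.
     (\<forall>dat \<sigma>. \<not> (dat \<in> data C T \<and> \<sigma> \<in> twos C T (snd dat)) \<longrightarrow> \<Psi> dat \<sigma> = 0) \<and>
     (\<forall>dat \<in> data C T.
        (\<forall>\<sigma> \<in> twos C T (snd dat).
           \<Psi> dat \<sigma> \<in> hom D (dev C D F G (src_word (length T) (fst dat ! length T) (wmin T dat)))
                       (dev C D F G (tgt_word (length T) (fst dat ! 0) (wmax T dat)))
                       (d + (\<Sum>(i, j) \<in> places T. fst (two \<sigma> i j)))) \<and>
        (\<forall>\<sigma> \<in> twos C T (snd dat). \<forall>(i, j) \<in> places T. \<forall>n.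
           linear_on (scl C) (hom C (mor (snd dat) i (j - 1)) (mor (snd dat) i j) n) (scl D)
             (\<lambda>\<alpha>. \<Psi> dat (upd_two \<sigma> i j (n, \<alpha>)))))}"

definition Ahat_dif :: "theta_ob \<Rightarrow> int \<Rightarrow> ('o, 'm, 'c, 'd) cochain \<Rightarrow> ('o, 'm, 'c, 'd) cochain" where
  "Ahat_dif T d \<Psi> = (\<lambda>dat \<sigma>.
     if dat \<in> data C T \<and> \<sigma> \<in> twos C T (snd dat) then
       dif D (\<Psi> dat \<sigma>)
       - sgn_pow d (\<Sum>(i, j) \<in> places T.
           sgn_pow (\<Sum>(i', j') | (i', j') \<in> places T \<and> before (i', j') (i, j). fst (two \<sigma> i' j'))
             (\<Psi> dat (upd_two \<sigma> i j (fst (two \<sigma> i j) + 1, dif C (snd (two \<sigma> i j))))))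
     else 0)"

text \<open>
  The action of \<open>P : S \<rightarrow> T\<close>.  The columns of \<open>T\<close> are cut at \<open>p = \<phi>(0)\<close> and \<open>q = \<phi>(k)\<close>; a column
  \<open>p < s \<le> q\<close> belongs to the column \<open>own s\<close> of \<open>S\<close>.  \<open>Ahat_act\<close> composes (factors
  listed from right to left)
  \<open>\<eta> F(f\<^sub>m\<^sub>i\<^sub>n) \<Rightarrow> (\<eta> F(h0)) (F(v0) F(u0)) \<Rightarrow> (G(h0) \<eta>) (F(v0) F(u0)) \<Rightarrow> G(h0) ((\<eta> F(v0)) F(u0))
   \<Rightarrow> G(h1) ((G(v3) \<theta>) F(u1)) \<Rightarrow> (G(h1) G(v3)) (\<theta> F(u1)) \<Rightarrow> (G(h1) G(v3)) (G(u1) \<theta>) \<Rightarrow> G(f\<^sub>m\<^sub>a\<^sub>x) \<theta>\<close>.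
\<close>

definition pull_datum :: "theta_ob \<Rightarrow> hat_mor \<Rightarrow> ('o, 'm) datum \<Rightarrow> ('o, 'm) datum" where
  "pull_datum S P dat =
     (map (\<lambda>i. fst dat ! sob P i) [0..<length S + 1],
      map (\<lambda>i. map (\<lambda>a. ev C (wsubst dat (sarr P (WGen (i, a))))) [0..<col S i + 1]) [1..<length S + 1])"

definition pull_two :: "hat_mor \<Rightarrow> ('o, 'm) datum \<Rightarrow> 'c twos \<Rightarrow> nat \<Rightarrow> nat \<Rightarrow> int \<times> 'c" where
  "pull_two P dat \<sigma> i a =
     (let \<phi> = sob P; c = snd (underlying P);
          lo = (\<lambda>s. c i s (a - 1)); hi = (\<lambda>s. c i s a);
          w = (\<lambda>b. wsubst dat (sarr P (WGen (i, b))))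
      in (\<Sum>(s, j) \<leftarrow> block_places (\<phi> (i - 1)) (\<phi> i) lo hi. fst (two \<sigma> s j),
          can C (seg dat (\<phi> (i - 1)) (\<phi> i) hi) (w a)
          \<cdot>\<^bsub>C\<^esub> block C dat \<sigma> (\<phi> (i - 1)) (\<phi> i) lo hi
          \<cdot>\<^bsub>C\<^esub> can C (w (a - 1)) (seg dat (\<phi> (i - 1)) (\<phi> i) lo)))"

definition pull_twos :: "theta_ob \<Rightarrow> hat_mor \<Rightarrow> ('o, 'm) datum \<Rightarrow> 'c twos \<Rightarrow> 'c twos" where
  "pull_twos S P dat \<sigma> =
     map (\<lambda>i. map (pull_two P dat \<sigma> i) [1..<col S i + 1]) [1..<length S + 1]"

definition own :: "(nat \<Rightarrow> nat) \<Rightarrow> nat \<Rightarrow> nat" where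
  "own \<phi> s = (LEAST i. s \<le> \<phi> i)"

definition act_places :: "theta_ob \<Rightarrow> theta_ob \<Rightarrow> hat_mor \<Rightarrow> (nat \<times> nat) list" where
  "act_places S T P =
     (let \<phi> = sob P; c = snd (underlying P); k = length S; p = \<phi> 0; q = \<phi> k; l = length T;
          lo = (\<lambda>s. c (own \<phi> s) s 0); hi = (\<lambda>s. c (own \<phi> s) s (col S (own \<phi> s)))
      in block_places q l (\<lambda>s. 0) (col T)
         @ block_places p q hi (col T)
         @ [(0, 0)]
         @ concat (map (\<lambda>i. concat (map (\<lambda>a. block_places (\<phi> (i - 1)) (\<phi> i) (\<lambda>s. c i s (a - 1)) (\<lambda>s. c i s a))
                                        [1..<col S i + 1])) [1..<k + 1])
         @ block_places p q (\<lambda>s. 0) lo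
         @ block_places 0 p (\<lambda>s. 0) (col T))"

definition act_mid ::
  "theta_ob \<Rightarrow> theta_ob \<Rightarrow> hat_mor \<Rightarrow> ('o, 'm, 'c, 'd) cochain \<Rightarrow> ('o, 'm, 'c, 'd) cochain" where
  "act_mid S T P \<Psi> dat \<sigma> =
     (let \<phi> = sob P; c = snd (underlying P); k = length S; p = \<phi> 0; q = \<phi> k;
          lo = (\<lambda>s. c (own \<phi> s) s 0); hi = (\<lambda>s. c (own \<phi> s) s (col S (own \<phi> s)));
          \<eta>q = tarr \<eta> (fst dat ! q); \<theta>p = tarr \<theta> (fst dat ! p);
          v1 = seg dat p q lo; v2 = seg dat p q hi;
          gmin = wcomps (fst dat ! p) (map (\<lambda>i. wsubst dat (sarr P (WGen (i, 0)))) (down 0 k));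
          gmax = wcomps (fst dat ! p) (map (\<lambda>i. wsubst dat (sarr P (WGen (i, col S i)))) (down 0 k));
          A_minus = block C dat \<sigma> p q (\<lambda>s. 0) lo;
          A_plus = block C dat \<sigma> p q hi (col T)
      in (fcell G A_plus \<star>\<^bsub>D\<^esub> id2 D \<theta>p)
         \<cdot>\<^bsub>D\<^esub> dcan C D F G (tgt_word k (fst dat ! p) gmax) (DComp (DG v2) (DArr \<theta>p))
         \<cdot>\<^bsub>D\<^esub> \<Psi> (pull_datum S P dat) (pull_twos S P dat \<sigma>)
         \<cdot>\<^bsub>D\<^esub> dcan C D F G (DComp (DArr \<eta>q) (DF v1)) (src_word k (fst dat ! q) gmin)
         \<cdot>\<^bsub>D\<^esub> (id2 D \<eta>q \<star>\<^bsub>D\<^esub> fcell F A_minus))"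

definition Ahat_act ::
  "theta_ob \<Rightarrow> theta_ob \<Rightarrow> hat_mor \<Rightarrow> int \<Rightarrow> ('o, 'm, 'c, 'd) cochain \<Rightarrow> ('o, 'm, 'c, 'd) cochain" where
  "Ahat_act S T P d \<Psi> = (\<lambda>dat \<sigma>.
     if dat \<in> data C T \<and> \<sigma> \<in> twos C T (snd dat) then
       let p = sob P 0; q = sob P (length S); l = length T; x = fst dat;
           h0 = seg dat q l (\<lambda>s. 0); h1 = seg dat q l (col T);
           v0 = seg dat p q (\<lambda>s. 0); v3 = seg dat p q (col T);
           u0 = seg dat 0 p (\<lambda>s. 0); u1 = seg dat 0 p (col T);
           \<eta>l = DArr (tarr \<eta> (x ! l)); \<eta>q = DArr (tarr \<eta> (x ! q));
           \<theta>p = DArr (tarr \<theta> (x ! p)); \<theta>0 = DArr (tarr \<theta> (x ! 0));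
           B_l = block C dat \<sigma> 0 p (\<lambda>s. 0) (col T);
           B_r = block C dat \<sigma> q l (\<lambda>s. 0) (col T);
           dv = dev C D F G; cn = dcan C D F G;
           deg = (\<lambda>(s, j). if s = 0 then d else fst (two \<sigma> s j))
       in sgn_pow (koszul deg (act_places S T P))
           (cn (DComp (DComp (DG h1) (DG v3)) (DComp (DG u1) \<theta>0)) (tgt_word l (x ! 0) (wmax T dat))
            \<cdot>\<^bsub>D\<^esub> (id2 D (dv (DComp (DG h1) (DG v3)))
                 \<star>\<^bsub>D\<^esub> inv2 D (dv (DComp (DG u1) \<theta>0)) (dv (DComp \<theta>p (DF u1))) (tcell \<theta> (ev C u1)))
            \<cdot>\<^bsub>D\<^esub> cn (DComp (DG h1) (DComp (DComp (DG v3) \<theta>p) (DF u1)))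
                    (DComp (DComp (DG h1) (DG v3)) (DComp \<theta>p (DF u1)))
            \<cdot>\<^bsub>D\<^esub> (fcell G B_r \<star>\<^bsub>D\<^esub> (act_mid S T P \<Psi> dat \<sigma> \<star>\<^bsub>D\<^esub> fcell F B_l))
            \<cdot>\<^bsub>D\<^esub> cn (DComp (DComp (DG h0) \<eta>q) (DComp (DF v0) (DF u0)))
                    (DComp (DG h0) (DComp (DComp \<eta>q (DF v0)) (DF u0)))
            \<cdot>\<^bsub>D\<^esub> (inv2 D (dv (DComp (DG h0) \<eta>q)) (dv (DComp \<eta>l (DF h0))) (tcell \<eta> (ev C h0))
                 \<star>\<^bsub>D\<^esub> id2 D (dv (DComp (DF v0) (DF u0))))
            \<cdot>\<^bsub>D\<^esub> cn (src_word l (x ! l) (wmin T dat))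
                    (DComp (DComp \<eta>l (DF h0)) (DComp (DF v0) (DF u0))))
     else 0)"

definition A_cpx :: "theta_ob \<Rightarrow> int \<Rightarrow> ('o, 'm, 'c, 'd) cochain set" where
  "A_cpx T d = {\<Psi> \<in> Ahat_cpx T d.
     \<forall>T'. \<forall>P \<in> hat_hom T T'. \<forall>P' \<in> hat_hom T T'.
       theta_eq T (underlying P) (underlying P') \<longrightarrow> Ahat_act T T' P d \<Psi> = Ahat_act T T' P' d \<Psi>}"

definition A_act ::
  "theta_ob \<Rightarrow> theta_ob \<Rightarrow> theta_mor \<Rightarrow> int \<Rightarrow> ('o, 'm, 'c, 'd) cochain \<Rightarrow> ('o, 'm, 'c, 'd) cochain" where
  "A_act S T \<Phi> = Ahat_act S T (SOME P. P \<in> hat_hom S T \<and> theta_eq S (underlying P) \<Phi>)"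

definition A_complex :: "('o, 'm, 'c, 'd) cochain cocellular" where
  "A_complex = \<lparr> cpx = A_cpx, cdif = Ahat_dif, cact = A_act \<rparr>"

end

text \<open>Scalar multiplication on cochains, and on families of 2-morphisms.\<close>

definition scl_cochain :: "('p, 'n, 'd, 'k) dgbicat \<Rightarrow> 'k \<Rightarrow> ('o, 'm, 'c, 'd) cochain \<Rightarrow> ('o, 'm, 'c, 'd) cochain"
  where "scl_cochain D r \<Psi> = (\<lambda>dat \<sigma>. scl D r (\<Psi> dat \<sigma>))"

definition scl_family :: "('p, 'n, 'd, 'k) dgbicat \<Rightarrow> 'k \<Rightarrow> ('o \<Rightarrow> 'd) \<Rightarrow> 'o \<Rightarrow> 'd"
  where "scl_family D r \<Gamma> = (\<lambda>x. scl D r (\<Gamma> x))"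

text \<open>The element of the product over all objects given by a cochain at \<open>([0];\<emptyset>)\<close>.\<close>

definition at_point :: "('o, 'm, 'c, 'd) cochain \<Rightarrow> 'o \<Rightarrow> 'd" where
  "at_point \<Psi> = (\<lambda>x. \<Psi> ([x], []) [])"

end

theory Submission
  imports Defs
begin

text \<open>
  A cochain at the point is a family \<open>\<Gamma>\<^sub>x\<close>, and the only nonzero components of its total differential
  are the differentials of the \<open>\<Gamma>\<^sub>x\<close> and the component at \<open>([1];[0])\<close>, which is the difference of the
  actions of \<open>D\<^sub>m\<^sub>i\<^sub>n\<close> and \<open>D\<^sub>m\<^sub>a\<^sub>x\<close>.  For \<open>f : x \<rightarrow> y\<close> these are
  \<open>\<theta>\<^sub>f\<inverse> \<cdot> (\<Gamma>\<^sub>y \<star> id)\<close> and \<open>(id \<star> \<Gamma>\<^sub>x) \<cdot> \<eta>\<^sub>f\<inverse>\<close>, so their equality is the modification axiom.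
  To identify the actions, write each canonical isomorphism \<open>dcan w w'\<close> as the normalization of \<open>w\<close>
  followed by the inverse of that of \<open>w'\<close>: such isomorphisms compose and are compatible with
  horizontal composition, inserting a word with trivial normal form is natural by the unit
  constraints, and the constraint of a transformation at an identity is itself canonical.
\<close>

section \<open>Degree 0 cells of a dg bicategory\<close>

text \<open>The orientation comes from the vertices. \<open>DMin\<close> omits 0 and sends the point
  to vertex 1, the target of \<open>f\<close>, so \<open>f\<close> lies in the segment
  \<open>u0\<close> and passes through \<theta>; \<open>DMax\<close> sends the point to vertex 0, so
  \<open>f\<close> lies in \<open>h0\<close> and passes through \<eta>. Their sign exponents are 0
  and \<open>esum [] 0 + 1 = 1\<close>, hence a difference.

  The obstacle is padding. Empty segments enter the action as \<open>F(id)\<close> and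
  \<open>G(id)\<close>, which need not be identities of \<open>D\<close>, and \<open>dcan\<close> is
  one fixed formula through normal forms, so each of its properties has to be proved for that
  formula. Left units are built into the recursion of \<open>mg\<close>; right units are not, which
  is why \<open>run_cmp\<close> is derived from the pentagon and triangle axioms.

  The condition that cuts \<open>A_cpx\<close> out of \<open>Ahat_cpx\<close> holds automatically at
  the point, because a functor out of the point acts only through its vertex. But
  \<open>A_act\<close> chooses a lift, so a strict functor of free bicategories has to be
  constructed over each vertex.\<close>

context dg_bicategory
begin

text \<open>Every axiom of the locale asks for the types of all its arguments; bundling them with
  the cell lets the rules be chained by \<open>OF\<close>. Fixing the degree to 0 makes the Koszul
  sign of \<open>interchange\<close> trivial and keeps composites in degree 0.\<close>

definition cell where
  "cell x y f g \<alpha> \<longleftrightarrow>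
     x \<in> obj C \<and> y \<in> obj C \<and> f \<in> arr C x y \<and> g \<in> arr C x y \<and> \<alpha> \<in> hom C f g 0"

definition iso2 where
  "iso2 x y f g \<alpha> \<longleftrightarrow> cell x y f g \<alpha> \<and> (\<exists>\<beta>. is_inverse2 C f g \<alpha> \<beta>)"

lemma cell_arrD:
  assumes "cell x y f g \<alpha>"
  shows "x \<in> obj C" "y \<in> obj C" "f \<in> arr C x y" "g \<in> arr C x y" "\<alpha> \<in> hom C f g 0"
  using assms by (auto simp: cell_def)

lemma cell_vc: "\<lbrakk>cell x y g h \<beta>; cell x y f g \<alpha>\<rbrakk> \<Longrightarrow> cell x y f h (\<beta> \<cdot> \<alpha>)"
  using vc_hom[of x y f g h \<alpha> 0 \<beta> 0] by (simp add: cell_def)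

lemma cell_hc: "\<lbrakk>cell y z g g' \<beta>; cell x y f f' \<alpha>\<rbrakk> \<Longrightarrow> cell x z (g \<odot> f) (g' \<odot> f') (\<beta> \<star> \<alpha>)"
  using hc_hom[of x y z f f' g g' \<alpha> 0 \<beta> 0] by (auto simp: cell_def intro: cmp_arr)

lemma cell_id2: "\<lbrakk>x \<in> obj C; y \<in> obj C; f \<in> arr C x y\<rbrakk> \<Longrightarrow> cell x y f f (id2 C f)"
  by (simp add: cell_def id2_hom)

lemma cell_assoc:
  "\<lbrakk>cell x y h k \<gamma>; cell x y g h \<beta>; cell x y f g \<alpha>\<rbrakk> \<Longrightarrow> (\<gamma> \<cdot> \<beta>) \<cdot> \<alpha> = \<gamma> \<cdot> (\<beta> \<cdot> \<alpha>)"
  unfolding cell_def by (elim conjE, rule vc_assoc)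

lemma cell_id_left: "cell x y f g \<alpha> \<Longrightarrow> id2 C g \<cdot> \<alpha> = \<alpha>"
  and cell_id_right: "cell x y f g \<alpha> \<Longrightarrow> \<alpha> \<cdot> id2 C f = \<alpha>"
  unfolding cell_def using vc_id2 by blast+

lemma cell_interchange:
  "\<lbrakk>cell y z g' g'' \<beta>'; cell y z g g' \<beta>; cell x y f' f'' \<alpha>'; cell x y f f' \<alpha>\<rbrakk>
     \<Longrightarrow> (\<beta>' \<star> \<alpha>') \<cdot> (\<beta> \<star> \<alpha>) = (\<beta>' \<cdot> \<beta>) \<star> (\<alpha>' \<cdot> \<alpha>)"
  using interchange[of x y z f f' f'' g g' g'' \<alpha> 0 \<alpha>' 0 \<beta> 0 \<beta>' 0] by (simp add: cell_def sgn_pow_def)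

lemma iso2_cell: "iso2 x y f g \<alpha> \<Longrightarrow> cell x y f g \<alpha>"
  by (simp add: iso2_def)

lemma iso2I:
  "\<lbrakk>cell x y f g \<alpha>; cell x y g f \<beta>; \<beta> \<cdot> \<alpha> = id2 C f; \<alpha> \<cdot> \<beta> = id2 C g\<rbrakk> \<Longrightarrow> iso2 x y f g \<alpha>"
  by (auto simp: iso2_def is_inverse2_def cell_def)

text \<open>\<open>inv2\<close> is a definite description, so it can be computed only once two-sided
  inverses are known to be unique: \<gamma> = \<gamma> (\<alpha> \<beta>) = (\<gamma> \<alpha>)
  \<beta> = \<beta>.\<close>

lemma inv2_eqI:
  assumes "cell x y f g \<alpha>" "cell x y g f \<beta>" "\<beta> \<cdot> \<alpha> = id2 C f" "\<alpha> \<cdot> \<beta> = id2 C g"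
  shows "inv2 C f g \<alpha> = \<beta>"
  unfolding inv2_def
proof (rule the_equality)
  show "is_inverse2 C f g \<alpha> \<beta>"
    using assms by (simp add: is_inverse2_def cell_def)
next
  fix \<gamma> assume "is_inverse2 C f g \<alpha> \<gamma>"
  then have \<gamma>: "cell x y g f \<gamma>" "\<gamma> \<cdot> \<alpha> = id2 C f"
    using assms(1) by (auto simp: is_inverse2_def cell_def)
  then have "\<gamma> = \<gamma> \<cdot> (\<alpha> \<cdot> \<beta>)"
    using assms(4) by (simp add: cell_id_right)
  also have "\<dots> = \<beta>"
    using cell_assoc[OF \<gamma>(1) assms(1,2)] \<gamma>(2) cell_id_left[OF assms(2)] by simp
  finally show "\<gamma> = \<beta>" .
qed

lemma
  assumes "iso2 x y f g \<alpha>"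
  shows cell_inv2: "cell x y g f (inv2 C f g \<alpha>)"
    and inv2_left: "inv2 C f g \<alpha> \<cdot> \<alpha> = id2 C f"
    and inv2_right: "\<alpha> \<cdot> inv2 C f g \<alpha> = id2 C g"
proof -
  obtain \<beta> where "cell x y g f \<beta>" "\<beta> \<cdot> \<alpha> = id2 C f" "\<alpha> \<cdot> \<beta> = id2 C g"
    using assms by (auto simp: iso2_def is_inverse2_def cell_def)
  moreover from this have "inv2 C f g \<alpha> = \<beta>"
    using assms by (intro inv2_eqI) (auto simp: iso2_def)
  ultimately show "cell x y g f (inv2 C f g \<alpha>)"
    "inv2 C f g \<alpha> \<cdot> \<alpha> = id2 C f" "\<alpha> \<cdot> inv2 C f g \<alpha> = id2 C g" by simp_all
qed

lemma iso2_inv2: "iso2 x y f g \<alpha> \<Longrightarrow> iso2 x y g f (inv2 C f g \<alpha>)"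
  by (rule iso2I[OF cell_inv2 iso2_cell inv2_right inv2_left])

lemma iso2_id2: "\<lbrakk>x \<in> obj C; y \<in> obj C; f \<in> arr C x y\<rbrakk> \<Longrightarrow> iso2 x y f f (id2 C f)"
  by (rule iso2I[OF cell_id2 cell_id2]) (simp_all add: cell_id_left[OF cell_id2])

lemma inv2_cancel_left:
  assumes "iso2 x y f g \<alpha>" "cell x y h f \<beta>"
  shows "inv2 C f g \<alpha> \<cdot> (\<alpha> \<cdot> \<beta>) = \<beta>"
  using cell_assoc[OF cell_inv2[OF assms(1)] iso2_cell[OF assms(1)] assms(2)]
  by (simp add: inv2_left[OF assms(1)] cell_id_left[OF assms(2)])

lemma inv2_cancel_left':
  assumes "iso2 x y f g \<alpha>" "cell x y h g \<beta>"
  shows "\<alpha> \<cdot> (inv2 C f g \<alpha> \<cdot> \<beta>) = \<beta>"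
  using cell_assoc[OF iso2_cell[OF assms(1)] cell_inv2[OF assms(1)] assms(2)]
  by (simp add: inv2_right[OF assms(1)] cell_id_left[OF assms(2)])

lemma inv2_cancel_right:
  assumes "iso2 x y f g \<alpha>" "cell x y g h \<beta>"
  shows "(\<beta> \<cdot> \<alpha>) \<cdot> inv2 C f g \<alpha> = \<beta>"
  using cell_assoc[OF assms(2) iso2_cell[OF assms(1)] cell_inv2[OF assms(1)]]
  by (simp add: inv2_right[OF assms(1)] cell_id_right[OF assms(2)])

lemma iso2_left_cancel:
  assumes "iso2 x y f g \<alpha>" "cell x y h f \<beta>" "cell x y h f \<gamma>" "\<alpha> \<cdot> \<beta> = \<alpha> \<cdot> \<gamma>"
  shows "\<beta> = \<gamma>"
  using inv2_cancel_left[OF assms(1,2)] inv2_cancel_left[OF assms(1,3)] assms(4) by argo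

lemma iso2_right_cancel:
  assumes "iso2 x y f g \<alpha>" "cell x y g h \<beta>" "cell x y g h \<gamma>" "\<beta> \<cdot> \<alpha> = \<gamma> \<cdot> \<alpha>"
  shows "\<beta> = \<gamma>"
  using inv2_cancel_right[OF assms(1,2)] inv2_cancel_right[OF assms(1,3)] assms(4) by argo

lemma iso2_vc:
  assumes "iso2 x y g h \<beta>" "iso2 x y f g \<alpha>"
  shows "iso2 x y f h (\<beta> \<cdot> \<alpha>)"
proof (rule iso2I)
  note c = iso2_cell[OF assms(1)] iso2_cell[OF assms(2)] cell_inv2[OF assms(1)] cell_inv2[OF assms(2)]
  show "cell x y f h (\<beta> \<cdot> \<alpha>)" "cell x y h f (inv2 C f g \<alpha> \<cdot> inv2 C g h \<beta>)"
    using c by (blast intro: cell_vc)+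
  show "(inv2 C f g \<alpha> \<cdot> inv2 C g h \<beta>) \<cdot> (\<beta> \<cdot> \<alpha>) = id2 C f"
    using cell_assoc[OF c(4,3) cell_vc[OF c(1,2)]] inv2_cancel_left[OF assms(1) c(2)] inv2_left[OF assms(2)]
    by simp
  show "(\<beta> \<cdot> \<alpha>) \<cdot> (inv2 C f g \<alpha> \<cdot> inv2 C g h \<beta>) = id2 C h"
    using cell_assoc[OF c(1,2) cell_vc[OF c(4,3)]] inv2_cancel_left'[OF assms(2) c(3)] inv2_right[OF assms(1)]
    by simp
qed

lemma iso2_hc:
  assumes "iso2 y z g g' \<beta>" "iso2 x y f f' \<alpha>"
  shows "iso2 x z (g \<odot> f) (g' \<odot> f') (\<beta> \<star> \<alpha>)"
proof (rule iso2I)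
  note c = iso2_cell[OF assms(1)] iso2_cell[OF assms(2)] cell_inv2[OF assms(1)] cell_inv2[OF assms(2)]
  note a = cell_arrD[OF c(1)] cell_arrD[OF c(2)]
  show "cell x z (g \<odot> f) (g' \<odot> f') (\<beta> \<star> \<alpha>)"
    "cell x z (g' \<odot> f') (g \<odot> f) (inv2 C g g' \<beta> \<star> inv2 C f f' \<alpha>)"
    using c by (blast intro: cell_hc)+
  show "(inv2 C g g' \<beta> \<star> inv2 C f f' \<alpha>) \<cdot> (\<beta> \<star> \<alpha>) = id2 C (g \<odot> f)"
    using cell_interchange[OF c(3,1,4,2)] a by (simp add: inv2_left[OF assms(1)] inv2_left[OF assms(2)] hc_id2)
  show "(\<beta> \<star> \<alpha>) \<cdot> (inv2 C g g' \<beta> \<star> inv2 C f f' \<alpha>) = id2 C (g' \<odot> f')"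
    using cell_interchange[OF c(1,3,2,4)] a by (simp add: inv2_right[OF assms(1)] inv2_right[OF assms(2)] hc_id2)
qed

lemma closed_iso_iso2:
  "\<lbrakk>x \<in> obj C; y \<in> obj C; f \<in> arr C x y; g \<in> arr C x y; closed_iso C f g \<alpha>\<rbrakk> \<Longrightarrow> iso2 x y f g \<alpha>"
  by (auto simp: closed_iso_def iso2_def cell_def)

lemma iso2_asc:
  "\<lbrakk>w \<in> obj C; x \<in> obj C; y \<in> obj C; z \<in> obj C; f \<in> arr C w x; g \<in> arr C x y; h \<in> arr C y z\<rbrakk>
     \<Longrightarrow> iso2 w z ((h \<odot> g) \<odot> f) (h \<odot> (g \<odot> f)) (asc C h g f)"
  by (rule closed_iso_iso2[OF _ _ _ _ asc_iso]) (blast intro: cmp_arr)+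

lemma iso2_lun: "\<lbrakk>x \<in> obj C; y \<in> obj C; f \<in> arr C x y\<rbrakk> \<Longrightarrow> iso2 x y (id1 C y \<odot> f) f (lun C f)"
  by (rule closed_iso_iso2[OF _ _ _ _ lun_iso]) (blast intro: cmp_arr id1_arr)+

lemma iso2_run: "\<lbrakk>x \<in> obj C; y \<in> obj C; f \<in> arr C x y\<rbrakk> \<Longrightarrow> iso2 x y (f \<odot> id1 C x) f (run C f)"
  by (rule closed_iso_iso2[OF _ _ _ _ run_iso]) (blast intro: cmp_arr id1_arr)+

lemma cell_lun_natural:
  "cell x y f g \<alpha> \<Longrightarrow> lun C g \<cdot> (id2 C (id1 C y) \<star> \<alpha>) = \<alpha> \<cdot> lun C f"
  unfolding cell_def using lun_natural by blast

lemma cell_run_natural: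
  "cell x y f g \<alpha> \<Longrightarrow> run C g \<cdot> (\<alpha> \<star> id2 C (id1 C x)) = \<alpha> \<cdot> run C f"
  unfolding cell_def using run_natural by blast

lemma cell_asc_natural:
  "\<lbrakk>cell y z h h' \<gamma>; cell x y g g' \<beta>; cell w x f f' \<alpha>\<rbrakk>
     \<Longrightarrow> asc C h' g' f' \<cdot> ((\<gamma> \<star> \<beta>) \<star> \<alpha>) = (\<gamma> \<star> (\<beta> \<star> \<alpha>)) \<cdot> asc C h g f"
  unfolding cell_def using asc_natural by blast

text \<open>The interchange law with identities in two places. Together with
  \<open>hc_split_right\<close> it slides a cell past the normalization of a unit word.\<close>

lemma hc_split_left:
  assumes "cell y z g g' \<beta>" "cell x y f f' \<alpha>"
  shows "(\<beta> \<star> id2 C f') \<cdot> (id2 C g \<star> \<alpha>) = \<beta> \<star> \<alpha>"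
  using cell_interchange[OF assms(1) cell_id2 cell_id2 assms(2)] cell_arrD[OF assms(1)] cell_arrD[OF assms(2)]
  by (simp add: cell_id_left[OF assms(2)] cell_id_right[OF assms(1)])

lemma hc_split_right:
  assumes "cell y z g g' \<beta>" "cell x y f f' \<alpha>"
  shows "(id2 C g' \<star> \<alpha>) \<cdot> (\<beta> \<star> id2 C f) = \<beta> \<star> \<alpha>"
  using cell_interchange[OF cell_id2 assms(1) assms(2) cell_id2] cell_arrD[OF assms(1)] cell_arrD[OF assms(2)]
  by (simp add: cell_id_right[OF assms(2)] cell_id_left[OF assms(1)])

lemma whisker_left_vc:
  assumes "y \<in> obj C" "z \<in> obj C" "g \<in> arr C y z" "cell x y f' f'' \<beta>" "cell x y f f' \<alpha>"
  shows "id2 C g \<star> (\<beta> \<cdot> \<alpha>) = (id2 C g \<star> \<beta>) \<cdot> (id2 C g \<star> \<alpha>)"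
  using cell_interchange[OF cell_id2 cell_id2 assms(4,5), of z g] assms
  by (simp add: cell_id_left[OF cell_id2])

lemma whisker_right_vc:
  assumes "x \<in> obj C" "y \<in> obj C" "f \<in> arr C x y" "cell y z g' g'' \<beta>" "cell y z g g' \<alpha>"
  shows "(\<beta> \<cdot> \<alpha>) \<star> id2 C f = (\<beta> \<star> id2 C f) \<cdot> (\<alpha> \<star> id2 C f)"
  using cell_interchange[OF assms(4,5) cell_id2 cell_id2, of x f] assms
  by (simp add: cell_id_left[OF cell_id2])

text \<open>Whiskering with a unit is faithful, so it suffices to compare both sides after \<open>\<star> id\<close>, where
  the triangle and pentagon axioms apply.\<close>

lemma run_cmp:
  assumes "x \<in> obj C" "y \<in> obj C" "z \<in> obj C" "b \<in> arr C x y" "a \<in> arr C y z"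
  shows "(id2 C a \<star> run C b) \<cdot> asc C a b (id1 C x) = run C (a \<odot> b)"
proof -
  let ?i = "id1 C x" and ?ii = "id1 C x \<odot> id1 C x"
  have i: "?i \<in> arr C x x" and ii: "?ii \<in> arr C x x" and ab: "a \<odot> b \<in> arr C x z"
    and bi: "b \<odot> ?i \<in> arr C x y" and abi: "(a \<odot> b) \<odot> ?i \<in> arr C x z"
    using assms by (blast intro: id1_arr cmp_arr)+
  have ci: "cell x x ?i ?i (id2 C ?i)" and ca: "cell y z a a (id2 C a)" and cb: "cell x y b b (id2 C b)"
    using assms i by (blast intro: cell_id2)+
  have rb: "cell x y (b \<odot> ?i) b (run C b)" and rab: "cell x z ((a \<odot> b) \<odot> ?i) (a \<odot> b) (run C (a \<odot> b))"
    and li: "cell x x ?ii ?i (lun C ?i)"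
    using assms i ab by (blast intro: iso2_cell iso2_run iso2_lun)+
  have s1: "iso2 x z ((a \<odot> b) \<odot> ?i) (a \<odot> (b \<odot> ?i)) (asc C a b ?i)"
    and s2: "iso2 x z (((a \<odot> b) \<odot> ?i) \<odot> ?i) ((a \<odot> b) \<odot> ?ii) (asc C (a \<odot> b) ?i ?i)"
    and s3: "iso2 x z ((a \<odot> b) \<odot> ?ii) (a \<odot> (b \<odot> ?ii)) (asc C a b ?ii)"
    and s4: "iso2 x y ((b \<odot> ?i) \<odot> ?i) (b \<odot> ?ii) (asc C b ?i ?i)"
    and s5: "iso2 x z ((a \<odot> (b \<odot> ?i)) \<odot> ?i) (a \<odot> ((b \<odot> ?i) \<odot> ?i)) (asc C a (b \<odot> ?i) ?i)"
    using assms i ii ab bi by (blast intro: iso2_asc)+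
  let ?L = "(id2 C a \<star> run C b) \<cdot> asc C a b ?i" and ?R = "run C (a \<odot> b)"
  have c1: "cell x z (a \<odot> (b \<odot> ?i)) (a \<odot> b) (id2 C a \<star> run C b)"
    by (rule cell_hc[OF ca rb])
  have L: "cell x z ((a \<odot> b) \<odot> ?i) (a \<odot> b) ?L"
    using c1 iso2_cell[OF s1] by (rule cell_vc)
  have c2: "cell x z (((a \<odot> b) \<odot> ?i) \<odot> ?i) ((a \<odot> (b \<odot> ?i)) \<odot> ?i) (asc C a b ?i \<star> id2 C ?i)"
    by (rule cell_hc[OF iso2_cell[OF s1] ci])
  have c3: "cell x z ((a \<odot> (b \<odot> ?i)) \<odot> ?i) ((a \<odot> b) \<odot> ?i) ((id2 C a \<star> run C b) \<star> id2 C ?i)"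
    by (rule cell_hc[OF c1 ci])
  have c4: "cell x y ((b \<odot> ?i) \<odot> ?i) (b \<odot> ?i) (run C b \<star> id2 C ?i)"
    by (rule cell_hc[OF rb ci])
  have c5: "cell x y (b \<odot> ?ii) (b \<odot> ?i) (id2 C b \<star> lun C ?i)"
    by (rule cell_hc[OF cb li])
  have c6: "cell x z (a \<odot> (b \<odot> ?ii)) (a \<odot> (b \<odot> ?i)) (id2 C a \<star> (id2 C b \<star> lun C ?i))"
    by (rule cell_hc[OF ca c5])
  have c7: "cell x z (a \<odot> ((b \<odot> ?i) \<odot> ?i)) (a \<odot> (b \<odot> ?ii)) (id2 C a \<star> asc C b ?i ?i)"
    by (rule cell_hc[OF ca iso2_cell[OF s4]])
  have c8: "cell x z ((a \<odot> b) \<odot> ?ii) ((a \<odot> b) \<odot> ?i) (id2 C (a \<odot> b) \<star> lun C ?i)"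
    using assms ab by (intro cell_hc[OF cell_id2 li]) auto
  \<comment> \<open>The associator in front lets naturality act on the whiskered
    \<open>run C b\<close>; being invertible, it is cancelled at the end.\<close>
  have "asc C a b ?i \<cdot> (?L \<star> id2 C ?i)
      = asc C a b ?i \<cdot> (((id2 C a \<star> run C b) \<star> id2 C ?i) \<cdot> (asc C a b ?i \<star> id2 C ?i))"
    using assms i by (simp add: whisker_right_vc[OF _ _ _ c1 iso2_cell[OF s1]])
  also have "\<dots> = (asc C a b ?i \<cdot> ((id2 C a \<star> run C b) \<star> id2 C ?i)) \<cdot> (asc C a b ?i \<star> id2 C ?i)"
    by (rule cell_assoc[OF iso2_cell[OF s1] c3 c2, symmetric])
  also have "\<dots> = ((id2 C a \<star> (run C b \<star> id2 C ?i)) \<cdot> asc C a (b \<odot> ?i) ?i) \<cdot> (asc C a b ?i \<star> id2 C ?i)"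
    by (simp add: cell_asc_natural[OF ca rb ci])
  \<comment> \<open>The triangle axiom trades \<open>run\<close> for \<open>lun\<close> at the unit.
    After the pentagon and naturality have moved the associators, the same axiom for
    \<open>a \<odot> b\<close> trades it back.\<close>
  also have "run C b \<star> id2 C ?i = (id2 C b \<star> lun C ?i) \<cdot> asc C b ?i ?i"
    using assms i by (simp add: triangle)
  also have "id2 C a \<star> \<dots> = (id2 C a \<star> (id2 C b \<star> lun C ?i)) \<cdot> (id2 C a \<star> asc C b ?i ?i)"
    using assms by (simp add: whisker_left_vc[OF _ _ _ c5 iso2_cell[OF s4]])
  also have "(\<dots> \<cdot> asc C a (b \<odot> ?i) ?i) \<cdot> (asc C a b ?i \<star> id2 C ?i)
      = (id2 C a \<star> (id2 C b \<star> lun C ?i)) \<cdot>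
          ((id2 C a \<star> asc C b ?i ?i) \<cdot> asc C a (b \<odot> ?i) ?i \<cdot> (asc C a b ?i \<star> id2 C ?i))"
    by (simp add: cell_assoc[OF c6 c7 iso2_cell[OF s5]] cell_assoc[OF c7 iso2_cell[OF s5] c2]
      cell_assoc[OF c6 cell_vc[OF c7 iso2_cell[OF s5]] c2])
  also have "(id2 C a \<star> asc C b ?i ?i) \<cdot> asc C a (b \<odot> ?i) ?i \<cdot> (asc C a b ?i \<star> id2 C ?i)
      = asc C a b ?ii \<cdot> asc C (a \<odot> b) ?i ?i"
    using assms i by (simp add: pentagon)
  also have "(id2 C a \<star> (id2 C b \<star> lun C ?i)) \<cdot> asc C a b ?ii \<cdot> asc C (a \<odot> b) ?i ?i
      = ((id2 C a \<star> (id2 C b \<star> lun C ?i)) \<cdot> asc C a b ?ii) \<cdot> asc C (a \<odot> b) ?i ?i"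
    by (rule cell_assoc[OF c6 iso2_cell[OF s3] iso2_cell[OF s2], symmetric])
  also have "(id2 C a \<star> (id2 C b \<star> lun C ?i)) \<cdot> asc C a b ?ii = asc C a b ?i \<cdot> (id2 C (a \<odot> b) \<star> lun C ?i)"
    using assms by (simp add: cell_asc_natural[OF ca cb li, symmetric] hc_id2)
  also have "(asc C a b ?i \<cdot> (id2 C (a \<odot> b) \<star> lun C ?i)) \<cdot> asc C (a \<odot> b) ?i ?i
      = asc C a b ?i \<cdot> ((id2 C (a \<odot> b) \<star> lun C ?i) \<cdot> asc C (a \<odot> b) ?i ?i)"
    by (rule cell_assoc[OF iso2_cell[OF s1] c8 iso2_cell[OF s2]])
  also have "(id2 C (a \<odot> b) \<star> lun C ?i) \<cdot> asc C (a \<odot> b) ?i ?i = ?R \<star> id2 C ?i"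
    using assms i ab by (simp add: triangle)
  finally have "?L \<star> id2 C ?i = ?R \<star> id2 C ?i"
    using iso2_left_cancel[OF s1] cell_hc[OF L ci] cell_hc[OF rab ci] by blast
  \<comment> \<open>Naturality of \<open>run\<close> replaces whiskering with the unit by
    composition with an invertible cell.\<close>
  then have "?L \<cdot> run C ((a \<odot> b) \<odot> ?i) = ?R \<cdot> run C ((a \<odot> b) \<odot> ?i)"
    by (simp only: cell_run_natural[OF L, symmetric] cell_run_natural[OF rab, symmetric])
  then show ?thesis
    using iso2_right_cancel[OF iso2_run[OF _ _ abi] L rab] assms by blast
qed

end

section \<open>Normal forms of words\<close>

text \<open>Typing of words whose letters are 1-morphisms of a bicategory. The ends are carried
  along because, unlike in a globular set, they cannot be read off from a letter: the sets
  \<open>arr C x y\<close> may overlap.\<close>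

inductive wtyp for C where
  wtyp_gen: "\<lbrakk>x \<in> obj C; y \<in> obj C; f \<in> arr C x y\<rbrakk> \<Longrightarrow> wtyp C (WGen f) x y"
| wtyp_id: "x \<in> obj C \<Longrightarrow> wtyp C (WId x) x x"
| wtyp_comp: "\<lbrakk>wtyp C u y z; wtyp C v x y\<rbrakk> \<Longrightarrow> wtyp C (WComp u v) x z"

lemma wtyp_obj: "wtyp C w x y \<Longrightarrow> x \<in> obj C \<and> y \<in> obj C"
  by (induction rule: wtyp.induct) auto

context dg_bicategory
begin

lemma wtyp_ev: "wtyp C w x y \<Longrightarrow> ev C w \<in> arr C x y"
  by (induction rule: wtyp.induct) (auto intro: id1_arr cmp_arr dest: wtyp_obj)

lemma wtyp_mg: "\<lbrakk>wtyp C u y z; wtyp C v x y\<rbrakk> \<Longrightarrow> wtyp C (mg u v) x z"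
proof (induction u arbitrary: v y z)
  case (WGen f)
  from WGen(1) have f: "y \<in> obj C" "z \<in> obj C" "f \<in> arr C y z"
    by (auto elim: wtyp.cases)
  show ?case
  proof (cases v)
    case (WId p)
    with WGen(2) have "x = y" by (auto elim: wtyp.cases)
    then show ?thesis using f WId by (auto intro: wtyp_gen)
  qed (use WGen in \<open>auto intro: wtyp_comp\<close>)
next
  case (WId p)
  then show ?case by (auto elim: wtyp.cases)
next
  case (WComp a b)
  then show ?case by (auto elim!: wtyp.cases[of _ "WComp a b"])
qed

lemma iso2_mg_iso:
  "\<lbrakk>wtyp C u y z; wtyp C v x y\<rbrakk> \<Longrightarrow> iso2 x z (ev C u \<odot> ev C v) (ev C (mg u v)) (mg_iso C u v)"
proof (induction u arbitrary: v y z)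
  case (WGen f)
  from WGen(1) have f: "y \<in> obj C" "z \<in> obj C" "f \<in> arr C y z"
    by (auto elim: wtyp.cases)
  show ?case
  proof (cases "is_WId v")
    case True
    then obtain p where v: "v = WId p" by (cases v) auto
    \<comment> \<open>Typing forces the identity to be the one at the source of \<open>f\<close>, as
      the type of \<open>run C f\<close> demands.\<close>
    with WGen(2) have "x = y" "p = y" by (auto elim: wtyp.cases)
    then show ?thesis using f v by (auto intro: iso2_run)
  next
    case False
    then show ?thesis
      using f wtyp_ev[OF WGen(2)] wtyp_obj[OF WGen(2)] by (auto intro: iso2_id2 cmp_arr)
  qed
next
  case (WId p)
  then have "p = y" "z = y" by (auto elim: wtyp.cases)
  then show ?case
    using wtyp_ev[OF WId(2)] wtyp_obj[OF WId(2)] by (auto intro: iso2_lun)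
next
  case (WComp a b)
  from WComp.prems(1) obtain q where ab: "wtyp C a q z" "wtyp C b y q"
    by (auto elim: wtyp.cases)
  note t = wtyp_ev[OF ab(1)] wtyp_ev[OF ab(2)] wtyp_ev[OF WComp.prems(2)]
    wtyp_obj[OF ab(1)] wtyp_obj[OF ab(2)] wtyp_obj[OF WComp.prems(2)]
  have "iso2 x z ((ev C a \<odot> ev C b) \<odot> ev C v) (ev C a \<odot> (ev C b \<odot> ev C v)) (asc C (ev C a) (ev C b) (ev C v))"
    using t by (blast intro: iso2_asc)
  moreover have "iso2 x z (ev C a \<odot> (ev C b \<odot> ev C v)) (ev C a \<odot> ev C (mg b v)) (id2 C (ev C a) \<star> mg_iso C b v)"
    using t WComp.IH(2)[OF ab(2) WComp.prems(2)] by (blast intro: iso2_hc iso2_id2)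
  moreover have "iso2 x z (ev C a \<odot> ev C (mg b v)) (ev C (mg a (mg b v))) (mg_iso C a (mg b v))"
    by (rule WComp.IH(1)[OF ab(1) wtyp_mg[OF ab(2) WComp.prems(2)]])
  ultimately show ?case
    by (auto intro: iso2_vc)
qed

lemma wtyp_nf: "wtyp C w x y \<Longrightarrow> wtyp C (nf w) x y"
  by (induction rule: wtyp.induct) (auto intro: wtyp.intros wtyp_mg)

lemma iso2_nf_iso: "wtyp C w x y \<Longrightarrow> iso2 x y (ev C w) (ev C (nf w)) (nf_iso C w)"
proof (induction rule: wtyp.induct)
  case (wtyp_comp u y z v x)
  then show ?case
    using iso2_mg_iso[OF wtyp_nf[OF wtyp_comp.hyps(1)] wtyp_nf[OF wtyp_comp.hyps(2)]] by (auto intro: iso2_vc iso2_hc)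
qed (auto intro: iso2_id2 id1_arr)

end

text \<open>Right unitality of \<open>mg_iso\<close> is only needed for words of length one and two, so that
  \<open>lun id = run id\<close> and general coherence are avoided.\<close>

definition short_word where
  "short_word w \<longleftrightarrow> (\<exists>a. w = WGen a) \<or> (\<exists>a b. w = WComp (WGen a) (WGen b))"

lemma mg_short_id: "short_word w \<Longrightarrow> mg w (WId p) = w"
  by (auto simp: short_word_def)

context dg_bicategory
begin

text \<open>One letter is the defining case. For two letters \<open>mg_iso\<close> unfolds to the
  left side of \<open>run_cmp\<close>, followed by an identity 2-cell.\<close>

lemma mg_iso_short_id:
  assumes "short_word w" "wtyp C w x y"
  shows "mg_iso C w (WId x) = run C (ev C w)"
  using assms(1) unfolding short_word_def
proof (elim disjE exE)
  fix a assume "w = WGen a"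
  then show ?thesis by simp
next
  fix a b assume w: "w = WComp (WGen a) (WGen b)"
  with assms(2) obtain q where ab: "x \<in> obj C" "q \<in> obj C" "y \<in> obj C" "b \<in> arr C x q" "a \<in> arr C q y"
    by (auto elim!: wtyp.cases)
  have "cell x y (a \<odot> (b \<odot> id1 C x)) (a \<odot> b) (id2 C a \<star> run C b)"
    using ab by (blast intro: cell_hc cell_id2 iso2_cell iso2_run)
  moreover have "cell x y ((a \<odot> b) \<odot> id1 C x) (a \<odot> (b \<odot> id1 C x)) (asc C a b (id1 C x))"
    using ab by (blast intro: iso2_cell iso2_asc id1_arr)
  ultimately have "cell x y ((a \<odot> b) \<odot> id1 C x) (a \<odot> b) ((id2 C a \<star> run C b) \<cdot> asc C a b (id1 C x))"
    by (rule cell_vc)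
  from cell_id_left[OF this] show ?thesis
    using run_cmp[OF ab] by (simp add: w)
qed

end

section \<open>Canonical isomorphisms\<close>

context strong_dg_functor
begin

lemma wtyp_map_word: "wtyp C w x y \<Longrightarrow> wtyp D (map_word (fob F) (farr F) w) (fob F x) (fob F y)"
  by (induction rule: wtyp.induct) (auto intro: wtyp.intros fob_obj farr_arr)

lemma iso2_fcmp:
  "\<lbrakk>x \<in> obj C; y \<in> obj C; z \<in> obj C; f \<in> arr C x y; g \<in> arr C y z\<rbrakk>
     \<Longrightarrow> D.iso2 (fob F x) (fob F z) (farr F g \<odot>\<^bsub>D\<^esub> farr F f) (farr F (g \<odot>\<^bsub>C\<^esub> f)) (fcmp F g f)"
  by (rule D.closed_iso_iso2[OF _ _ _ _ fcmp_iso]) (blast intro: fob_obj farr_arr D.cmp_arr C.cmp_arr)+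

lemma iso2_funit:
  "x \<in> obj C \<Longrightarrow> D.iso2 (fob F x) (fob F x) (id1 D (fob F x)) (farr F (id1 C x)) (funit F x)"
  by (rule D.closed_iso_iso2[OF _ _ _ _ funit_iso]) (blast intro: fob_obj farr_arr D.id1_arr C.id1_arr)+

lemma iso2_spread_iso:
  "wtyp C w x y \<Longrightarrow> D.iso2 (fob F x) (fob F y) (farr F (ev C w))
      (ev D (map_word (fob F) (farr F) w)) (spread_iso C D F w)"
proof (induction rule: wtyp.induct)
  case (wtyp_comp u y z v x)
  note t = C.wtyp_ev[OF wtyp_comp.hyps(1)] C.wtyp_ev[OF wtyp_comp.hyps(2)]
    wtyp_obj[OF wtyp_comp.hyps(1)] wtyp_obj[OF wtyp_comp.hyps(2)]
  then have "D.iso2 (fob F x) (fob F z) (farr F (ev C u) \<odot>\<^bsub>D\<^esub> farr F (ev C v))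
      (farr F (ev C u \<odot>\<^bsub>C\<^esub> ev C v)) (fcmp F (ev C u) (ev C v))"
    by (blast intro: iso2_fcmp)
  then show ?case
    using D.iso2_vc[OF D.iso2_hc[OF wtyp_comp.IH] D.iso2_inv2] by simp
qed (auto intro: D.iso2_id2 D.iso2_inv2 iso2_funit fob_obj farr_arr)

end

inductive dtyp for C D F G where
  dtyp_arr: "\<lbrakk>p \<in> obj D; q \<in> obj D; a \<in> arr D p q\<rbrakk> \<Longrightarrow> dtyp C D F G (DArr a) p q"
| dtyp_F: "wtyp C w x y \<Longrightarrow> dtyp C D F G (DF w) (fob F x) (fob F y)"
| dtyp_G: "wtyp C w x y \<Longrightarrow> dtyp C D F G (DG w) (fob G x) (fob G y)"
| dtyp_comp: "\<lbrakk>dtyp C D F G u q r; dtyp C D F G v p q\<rbrakk> \<Longrightarrow> dtyp C D F G (DComp u v) p r"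

locale dg_functor_pair =
  C: dg_bicategory C + D: dg_bicategory D + F: strong_dg_functor C D F + G: strong_dg_functor C D G
  for C :: "('o, 'm, 'c::ab_group_add, 'k::field) dgbicat"
    and D :: "('p, 'n, 'd::ab_group_add, 'k) dgbicat"
    and F G :: "('o, 'm, 'c, 'p, 'n, 'd) sfun"
begin

abbreviation "dty \<equiv> dtyp C D F G"
abbreviation "dv \<equiv> dev C D F G"
abbreviation "dw \<equiv> dspread F G"
abbreviation "cn \<equiv> dcan C D F G"
abbreviation "nv w \<equiv> ev D (nf (dw w))"

text \<open>Spreading the functors and normalizing in \<open>D\<close> are merged into one
  isomorphism, so that comparing words is a cancellation rather than a manipulation of the four
  factors of \<open>dcan\<close>.\<close>

definition "norm_iso w = nf_iso D (dw w) \<cdot>\<^bsub>D\<^esub> dspread_iso C D F G w"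

lemma dty_obj: "dty w p q \<Longrightarrow> p \<in> obj D \<and> q \<in> obj D"
  by (induction rule: dtyp.induct) (auto intro: F.fob_obj G.fob_obj dest: wtyp_obj)

lemma dty_dv: "dty w p q \<Longrightarrow> dv w \<in> arr D p q"
  by (induction rule: dtyp.induct)
    (auto intro: F.farr_arr G.farr_arr C.wtyp_ev D.cmp_arr dest: wtyp_obj dty_obj)

lemma wtyp_dw: "dty w p q \<Longrightarrow> wtyp D (dw w) p q"
  by (induction rule: dtyp.induct) (auto intro: wtyp.intros F.wtyp_map_word G.wtyp_map_word)

lemma iso2_dspread_iso: "dty w p q \<Longrightarrow> D.iso2 p q (dv w) (ev D (dw w)) (dspread_iso C D F G w)"
  by (induction rule: dtyp.induct)
    (auto intro: D.iso2_id2 D.iso2_hc F.iso2_spread_iso G.iso2_spread_iso)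

lemma iso2_norm_iso: "dty w p q \<Longrightarrow> D.iso2 p q (dv w) (nv w) (norm_iso w)"
  unfolding norm_iso_def by (rule D.iso2_vc[OF D.iso2_nf_iso[OF wtyp_dw] iso2_dspread_iso])

lemmas cell_norm_iso = D.iso2_cell[OF iso2_norm_iso]

lemma wtyp_nf_dw: "dty w p q \<Longrightarrow> wtyp D (nf (dw w)) p q"
  by (rule D.wtyp_nf[OF wtyp_dw])

text \<open>Interchange joins spreading and normalization within each part, which leaves a single
  merging step. This recursion makes \<open>norm_iso\<close> computable on composites.\<close>

lemma norm_iso_DComp:
  assumes "dty u q r" "dty v p q"
  shows "norm_iso (DComp u v) = mg_iso D (nf (dw u)) (nf (dw v)) \<cdot>\<^bsub>D\<^esub> (norm_iso u \<star>\<^bsub>D\<^esub> norm_iso v)"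
proof -
  note n = D.iso2_cell[OF D.iso2_nf_iso[OF wtyp_dw[OF assms(1)]]]
    D.iso2_cell[OF D.iso2_nf_iso[OF wtyp_dw[OF assms(2)]]]
  note s = D.iso2_cell[OF iso2_dspread_iso[OF assms(1)]] D.iso2_cell[OF iso2_dspread_iso[OF assms(2)]]
  note m = D.iso2_cell[OF D.iso2_mg_iso[OF wtyp_nf_dw[OF assms(1)] wtyp_nf_dw[OF assms(2)]]]
  show ?thesis
    unfolding norm_iso_def
    using D.cell_assoc[OF m D.cell_hc[OF n] D.cell_hc[OF s]]
    by (simp add: D.cell_interchange[OF n(1) s(1) n(2) s(2)])
qed

text \<open>The condition under which the factors of \<open>dcan w w'\<close> can be composed: both
  normalizations must end at the same 1-morphism.\<close>

definition similar where
  "similar p q w w' \<longleftrightarrow> dty w p q \<and> dty w' p q \<and> nf (dw w) = nf (dw w')"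

lemma similarD:
  assumes "similar p q w w'"
  shows "dty w p q" "dty w' p q" "nf (dw w) = nf (dw w')"
  using assms by (auto simp: similar_def)

lemma similar_DComp:
  "\<lbrakk>similar q r u u'; similar p q v v'\<rbrakk> \<Longrightarrow> similar p r (DComp u v) (DComp u' v')"
  by (auto simp: similar_def intro: dtyp_comp)

text \<open>\<open>dcan\<close> inverts the spreading and the normalization of \<open>w'\<close>
  separately; uniqueness of inverses identifies their composite with the inverse of
  \<open>norm_iso w'\<close>.\<close>

lemma dcan_eq:
  assumes "similar p q w w'"
  shows "cn w w' = inv2 D (dv w') (nv w') (norm_iso w') \<cdot>\<^bsub>D\<^esub> norm_iso w"
proof -
  note w = similarD(1)[OF assms] and w' = similarD(2)[OF assms] and e = similarD(3)[OF assms]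
  note n = D.iso2_nf_iso[OF wtyp_dw[OF w]] and s = iso2_dspread_iso[OF w]
  note n' = D.iso2_nf_iso[OF wtyp_dw[OF w']] and s' = iso2_dspread_iso[OF w']
  let ?n = "nf_iso D (dw w)" and ?s = "dspread_iso C D F G w"
  let ?n' = "inv2 D (ev D (dw w')) (nv w') (nf_iso D (dw w'))"
    and ?s' = "inv2 D (dv w') (ev D (dw w')) (dspread_iso C D F G w')"
  note c = D.cell_inv2[OF s'] D.cell_inv2[OF n'] D.iso2_cell[OF n, unfolded e] D.iso2_cell[OF s]
  have "inv2 D (dv w') (nv w') (norm_iso w') = ?s' \<cdot>\<^bsub>D\<^esub> ?n'"
    unfolding norm_iso_def
  proof (rule D.inv2_eqI)
    show "D.cell p q (dv w') (nv w') (nf_iso D (dw w') \<cdot>\<^bsub>D\<^esub> dspread_iso C D F G w')"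
      by (rule D.cell_vc[OF D.iso2_cell[OF n'] D.iso2_cell[OF s']])
    show "D.cell p q (nv w') (dv w') (?s' \<cdot>\<^bsub>D\<^esub> ?n')"
      by (rule D.cell_vc[OF c(1,2)])
    show "(?s' \<cdot>\<^bsub>D\<^esub> ?n') \<cdot>\<^bsub>D\<^esub> (nf_iso D (dw w') \<cdot>\<^bsub>D\<^esub> dspread_iso C D F G w') = id2 D (dv w')"
      using D.cell_assoc[OF c(1,2) D.cell_vc[OF D.iso2_cell[OF n'] D.iso2_cell[OF s']]]
      by (simp add: D.inv2_cancel_left[OF n' D.iso2_cell[OF s']] D.inv2_left[OF s'])
    show "(nf_iso D (dw w') \<cdot>\<^bsub>D\<^esub> dspread_iso C D F G w') \<cdot>\<^bsub>D\<^esub> (?s' \<cdot>\<^bsub>D\<^esub> ?n') = id2 D (nv w')"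
      using D.cell_assoc[OF D.iso2_cell[OF n'] D.iso2_cell[OF s'] D.cell_vc[OF c(1,2)]]
      by (simp add: D.inv2_cancel_left'[OF s' c(2)] D.inv2_right[OF n'])
  qed
  then show ?thesis
    unfolding dcan_def can_def norm_iso_def
    using D.cell_assoc[OF c(1,2) D.cell_vc[OF c(3,4)]] D.cell_assoc[OF c(2-4)] by simp
qed

lemma
  assumes "similar p q w w'"
  shows cell_dcan: "D.cell p q (dv w) (dv w') (cn w w')"
    and norm_iso_dcan: "norm_iso w' \<cdot>\<^bsub>D\<^esub> cn w w' = norm_iso w"
proof -
  note n = iso2_norm_iso[OF similarD(2)[OF assms]]
  have "D.cell p q (dv w) (nv w') (norm_iso w)"
    using cell_norm_iso[OF similarD(1)[OF assms]] similarD(3)[OF assms] by simp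
  then show "D.cell p q (dv w) (dv w') (cn w w')" "norm_iso w' \<cdot>\<^bsub>D\<^esub> cn w w' = norm_iso w"
    using D.cell_vc[OF D.cell_inv2[OF n]] D.inv2_cancel_left'[OF n] by (simp_all add: dcan_eq[OF assms])
qed

text \<open>Since \<open>norm_iso w'\<close> is invertible, at most one cell intertwines the two
  normalizations. This criterion is behind the calculus of canonical isomorphisms below.\<close>

lemma dcan_eqI:
  assumes "similar p q w w'" "D.cell p q (dv w) (dv w') \<alpha>" "norm_iso w' \<cdot>\<^bsub>D\<^esub> \<alpha> = norm_iso w"
  shows "\<alpha> = cn w w'"
  using D.iso2_left_cancel[OF iso2_norm_iso[OF similarD(2)[OF assms(1)]] assms(2) cell_dcan[OF assms(1)]]
    assms(3) norm_iso_dcan[OF assms(1)] by argo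

lemma dcan_dcan:
  assumes "similar p q w w'" "similar p q w' w''"
  shows "cn w' w'' \<cdot>\<^bsub>D\<^esub> cn w w' = cn w w''"
proof (rule dcan_eqI)
  show "similar p q w w''" using assms by (auto simp: similar_def)
  show "D.cell p q (dv w) (dv w'') (cn w' w'' \<cdot>\<^bsub>D\<^esub> cn w w')"
    by (rule D.cell_vc[OF cell_dcan[OF assms(2)] cell_dcan[OF assms(1)]])
  show "norm_iso w'' \<cdot>\<^bsub>D\<^esub> (cn w' w'' \<cdot>\<^bsub>D\<^esub> cn w w') = norm_iso w"
    using D.cell_assoc[OF cell_norm_iso[OF similarD(2)[OF assms(2)]] cell_dcan[OF assms(2)] cell_dcan[OF assms(1)]]
    by (simp add: norm_iso_dcan[OF assms(1)] norm_iso_dcan[OF assms(2)])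
qed

lemma dcan_refl: "dty w p q \<Longrightarrow> cn w w = id2 D (dv w)"
  by (rule dcan_eqI[symmetric, of p q])
    (auto simp: similar_def D.cell_id_right[OF cell_norm_iso] intro: D.cell_id2 dty_dv dest: dty_obj)

text \<open>Equal normal forms give the same \<open>mg_iso\<close> on both sides, so after
  \<open>norm_iso_DComp\<close> only interchange in the two factors remains.\<close>

lemma dcan_hc:
  assumes "similar q r u u'" "similar p q v v'"
  shows "cn u u' \<star>\<^bsub>D\<^esub> cn v v' = cn (DComp u v) (DComp u' v')"
proof (rule dcan_eqI[OF similar_DComp[OF assms]])
  note c = cell_dcan[OF assms(1)] cell_dcan[OF assms(2)]
  note n = cell_norm_iso[OF similarD(2)[OF assms(1)]] cell_norm_iso[OF similarD(2)[OF assms(2)]]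
  note m = D.iso2_cell[OF D.iso2_mg_iso[OF wtyp_nf_dw[OF similarD(2)[OF assms(1)]] wtyp_nf_dw[OF similarD(2)[OF assms(2)]]]]
  show "D.cell p r (dv (DComp u v)) (dv (DComp u' v')) (cn u u' \<star>\<^bsub>D\<^esub> cn v v')"
    using D.cell_hc[OF c] by simp
  show "norm_iso (DComp u' v') \<cdot>\<^bsub>D\<^esub> (cn u u' \<star>\<^bsub>D\<^esub> cn v v') = norm_iso (DComp u v)"
    using D.cell_assoc[OF m D.cell_hc[OF n] D.cell_hc[OF c]]
    by (simp add: norm_iso_DComp[OF similarD(1)[OF assms(1)] similarD(1)[OF assms(2)]]
        norm_iso_DComp[OF similarD(2)[OF assms(1)] similarD(2)[OF assms(2)]]
        D.cell_interchange[OF n(1) c(1) n(2) c(2)] norm_iso_dcan[OF assms(1)] norm_iso_dcan[OF assms(2)]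
        similarD(3)[OF assms(1)] similarD(3)[OF assms(2)])
qed

text \<open>A segment without columns is \<open>WId\<close>, and its image under \<open>F\<close> or
  \<open>G\<close> is isomorphic to an identity of \<open>D\<close> without having to equal it. Such
  words and composites of them are the padding that the action inserts.\<close>

definition unit_word where
  "unit_word p E \<longleftrightarrow> dty E p p \<and> nf (dw E) = WId p"

lemma similar_unit_left:
  "\<lbrakk>unit_word q E; dty w p q\<rbrakk> \<Longrightarrow> similar p q (DComp E w) w \<and> similar p q w (DComp E w)"
  by (auto simp: similar_def unit_word_def intro: dtyp_comp)

lemma similar_unit_right:
  "\<lbrakk>unit_word p E; dty w p q; short_word (nf (dw w))\<rbrakk>
     \<Longrightarrow> similar p q (DComp w E) w \<and> similar p q w (DComp w E)"
  by (auto simp: similar_def unit_word_def mg_short_id intro: dtyp_comp)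

text \<open>Merging a unit word on the left is \<open>lun\<close> at the normal form of
  \<open>w\<close>; naturality of \<open>lun\<close> along \<open>norm_iso w\<close> brings it back
  to \<open>w\<close> itself.\<close>

lemma dcan_unit_left:
  assumes "unit_word q E" "dty w p q"
  shows "cn (DComp E w) w = lun D (dv w) \<cdot>\<^bsub>D\<^esub> (norm_iso E \<star>\<^bsub>D\<^esub> id2 D (dv w))"
proof (rule dcan_eqI[symmetric])
  have E: "dty E q q" and nE: "nf (dw E) = WId q" using assms(1) by (auto simp: unit_word_def)
  note t = dty_obj[OF assms(2)] dty_dv[OF assms(2)]
  have kE: "D.cell q q (dv E) (id1 D q) (norm_iso E)" using cell_norm_iso[OF E] nE by simp
  have kw: "D.cell p q (dv w) (nv w) (norm_iso w)" by (rule cell_norm_iso[OF assms(2)])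
  have iq: "D.cell q q (id1 D q) (id1 D q) (id2 D (id1 D q))" "D.cell p q (dv w) (dv w) (id2 D (dv w))"
    using t by (blast intro: D.cell_id2 D.id1_arr)+
  have lw: "D.cell p q (id1 D q \<odot>\<^bsub>D\<^esub> dv w) (dv w) (lun D (dv w))"
    and ln: "D.cell p q (id1 D q \<odot>\<^bsub>D\<^esub> nv w) (nv w) (lun D (nv w))"
    using t D.cell_arrD(4)[OF kw] by (blast intro: D.iso2_cell D.iso2_lun)+
  note kE1 = D.cell_hc[OF kE iq(2)]
  show "similar p q (DComp E w) w" using similar_unit_left[OF assms] by blast
  show "D.cell p q (dv (DComp E w)) (dv w) (lun D (dv w) \<cdot>\<^bsub>D\<^esub> (norm_iso E \<star>\<^bsub>D\<^esub> id2 D (dv w)))"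
    using D.cell_vc[OF lw kE1] by simp
  have "norm_iso w \<cdot>\<^bsub>D\<^esub> (lun D (dv w) \<cdot>\<^bsub>D\<^esub> (norm_iso E \<star>\<^bsub>D\<^esub> id2 D (dv w)))
      = (norm_iso w \<cdot>\<^bsub>D\<^esub> lun D (dv w)) \<cdot>\<^bsub>D\<^esub> (norm_iso E \<star>\<^bsub>D\<^esub> id2 D (dv w))"
    by (rule D.cell_assoc[OF kw lw kE1, symmetric])
  also have "\<dots> = lun D (nv w) \<cdot>\<^bsub>D\<^esub> ((id2 D (id1 D q) \<star>\<^bsub>D\<^esub> norm_iso w) \<cdot>\<^bsub>D\<^esub> (norm_iso E \<star>\<^bsub>D\<^esub> id2 D (dv w)))"
    using D.cell_assoc[OF ln D.cell_hc[OF iq(1) kw] kE1]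
    by (simp add: D.cell_lun_natural[OF kw])
  also have "\<dots> = norm_iso (DComp E w)"
    by (simp add: D.hc_split_right[OF kE kw] norm_iso_DComp[OF E assms(2)] nE)
  finally show "norm_iso w \<cdot>\<^bsub>D\<^esub> (lun D (dv w) \<cdot>\<^bsub>D\<^esub> (norm_iso E \<star>\<^bsub>D\<^esub> id2 D (dv w))) = norm_iso (DComp E w)" .
qed

text \<open>\<open>mg\<close> recurses on its first argument, so no defining equation disposes of a
  unit at the end of a longer word; for short normal forms \<open>mg_iso_short_id\<close> shows that
  merging it is \<open>run\<close>.\<close>

lemma dcan_unit_right:
  assumes "unit_word p E" "dty w p q" "short_word (nf (dw w))"
  shows "cn (DComp w E) w = run D (dv w) \<cdot>\<^bsub>D\<^esub> (id2 D (dv w) \<star>\<^bsub>D\<^esub> norm_iso E)"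
proof (rule dcan_eqI[symmetric])
  have E: "dty E p p" and nE: "nf (dw E) = WId p" using assms(1) by (auto simp: unit_word_def)
  note t = dty_obj[OF assms(2)] dty_dv[OF assms(2)]
  have kE: "D.cell p p (dv E) (id1 D p) (norm_iso E)" using cell_norm_iso[OF E] nE by simp
  have kw: "D.cell p q (dv w) (nv w) (norm_iso w)" by (rule cell_norm_iso[OF assms(2)])
  have iq: "D.cell p p (id1 D p) (id1 D p) (id2 D (id1 D p))" "D.cell p q (dv w) (dv w) (id2 D (dv w))"
    using t by (blast intro: D.cell_id2 D.id1_arr)+
  have rw: "D.cell p q (dv w \<odot>\<^bsub>D\<^esub> id1 D p) (dv w) (run D (dv w))"
    and rn: "D.cell p q (nv w \<odot>\<^bsub>D\<^esub> id1 D p) (nv w) (run D (nv w))"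
    using t D.cell_arrD(4)[OF kw] by (blast intro: D.iso2_cell D.iso2_run)+
  note kE1 = D.cell_hc[OF iq(2) kE]
  show "similar p q (DComp w E) w" using similar_unit_right[OF assms] by blast
  show "D.cell p q (dv (DComp w E)) (dv w) (run D (dv w) \<cdot>\<^bsub>D\<^esub> (id2 D (dv w) \<star>\<^bsub>D\<^esub> norm_iso E))"
    using D.cell_vc[OF rw kE1] by simp
  have "norm_iso w \<cdot>\<^bsub>D\<^esub> (run D (dv w) \<cdot>\<^bsub>D\<^esub> (id2 D (dv w) \<star>\<^bsub>D\<^esub> norm_iso E))
      = (norm_iso w \<cdot>\<^bsub>D\<^esub> run D (dv w)) \<cdot>\<^bsub>D\<^esub> (id2 D (dv w) \<star>\<^bsub>D\<^esub> norm_iso E)"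
    by (rule D.cell_assoc[OF kw rw kE1, symmetric])
  also have "\<dots> = run D (nv w) \<cdot>\<^bsub>D\<^esub> ((norm_iso w \<star>\<^bsub>D\<^esub> id2 D (id1 D p)) \<cdot>\<^bsub>D\<^esub> (id2 D (dv w) \<star>\<^bsub>D\<^esub> norm_iso E))"
    using D.cell_assoc[OF rn D.cell_hc[OF kw iq(1)] kE1]
    by (simp add: D.cell_run_natural[OF kw])
  also have "\<dots> = norm_iso (DComp w E)"
    by (simp add: D.hc_split_left[OF kw kE] norm_iso_DComp[OF assms(2) E] nE
        D.mg_iso_short_id[OF assms(3) wtyp_nf_dw[OF assms(2)]])
  finally show "norm_iso w \<cdot>\<^bsub>D\<^esub> (run D (dv w) \<cdot>\<^bsub>D\<^esub> (id2 D (dv w) \<star>\<^bsub>D\<^esub> norm_iso E)) = norm_iso (DComp w E)" .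
qed

text \<open>Here \<alpha> is an arbitrary degree 0 cell and \<open>w\<close>, \<open>w'\<close> need
  not be similar. This is how padding is moved past the noncanonical cells, namely the components of
  \<Gamma> and the constraints at \<open>f\<close>.\<close>

lemma dcan_unit_left_natural:
  assumes "unit_word q E" "dty w p q" "dty w' p q" "D.cell p q (dv w) (dv w') \<alpha>"
  shows "cn (DComp E w') w' \<cdot>\<^bsub>D\<^esub> (id2 D (dv E) \<star>\<^bsub>D\<^esub> \<alpha>) = \<alpha> \<cdot>\<^bsub>D\<^esub> cn (DComp E w) w"
proof -
  have E: "dty E q q" and nE: "nf (dw E) = WId q" using assms(1) by (auto simp: unit_word_def)
  note t = dty_obj[OF assms(2)] dty_dv[OF assms(2)] dty_dv[OF assms(3)] dty_dv[OF E]
  have kE: "D.cell q q (dv E) (id1 D q) (norm_iso E)" using cell_norm_iso[OF E] nE by simp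
  have i: "D.cell q q (id1 D q) (id1 D q) (id2 D (id1 D q))" "D.cell p q (dv w) (dv w) (id2 D (dv w))"
    "D.cell p q (dv w') (dv w') (id2 D (dv w'))" "D.cell q q (dv E) (dv E) (id2 D (dv E))"
    using t by (blast intro: D.cell_id2 D.id1_arr)+
  have l: "D.cell p q (id1 D q \<odot>\<^bsub>D\<^esub> dv w) (dv w) (lun D (dv w))"
    "D.cell p q (id1 D q \<odot>\<^bsub>D\<^esub> dv w') (dv w') (lun D (dv w'))"
    using t by (blast intro: D.iso2_cell D.iso2_lun)+
  have "cn (DComp E w') w' \<cdot>\<^bsub>D\<^esub> (id2 D (dv E) \<star>\<^bsub>D\<^esub> \<alpha>)
      = lun D (dv w') \<cdot>\<^bsub>D\<^esub> (norm_iso E \<star>\<^bsub>D\<^esub> \<alpha>)"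
    by (simp add: dcan_unit_left[OF assms(1,3)] D.cell_assoc[OF l(2) D.cell_hc[OF kE i(3)] D.cell_hc[OF i(4) assms(4)]]
        D.hc_split_left[OF kE assms(4)])
  also have "\<dots> = (lun D (dv w') \<cdot>\<^bsub>D\<^esub> (id2 D (id1 D q) \<star>\<^bsub>D\<^esub> \<alpha>)) \<cdot>\<^bsub>D\<^esub> (norm_iso E \<star>\<^bsub>D\<^esub> id2 D (dv w))"
    by (simp add: D.cell_assoc[OF l(2) D.cell_hc[OF i(1) assms(4)] D.cell_hc[OF kE i(2)]]
        D.hc_split_right[OF kE assms(4)])
  also have "\<dots> = \<alpha> \<cdot>\<^bsub>D\<^esub> cn (DComp E w) w"
    by (simp add: dcan_unit_left[OF assms(1,2)] D.cell_lun_natural[OF assms(4)]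
        D.cell_assoc[OF assms(4) l(1) D.cell_hc[OF kE i(2)]])
  finally show ?thesis .
qed

lemma dcan_unit_right_natural:
  assumes "unit_word p E" "dty w p q" "dty w' p q" "D.cell p q (dv w) (dv w') \<alpha>"
    and "short_word (nf (dw w))" "short_word (nf (dw w'))"
  shows "cn (DComp w' E) w' \<cdot>\<^bsub>D\<^esub> (\<alpha> \<star>\<^bsub>D\<^esub> id2 D (dv E)) = \<alpha> \<cdot>\<^bsub>D\<^esub> cn (DComp w E) w"
proof -
  have E: "dty E p p" and nE: "nf (dw E) = WId p" using assms(1) by (auto simp: unit_word_def)
  note t = dty_obj[OF assms(2)] dty_dv[OF assms(2)] dty_dv[OF assms(3)] dty_dv[OF E]
  have kE: "D.cell p p (dv E) (id1 D p) (norm_iso E)" using cell_norm_iso[OF E] nE by simp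
  have i: "D.cell p p (id1 D p) (id1 D p) (id2 D (id1 D p))" "D.cell p q (dv w) (dv w) (id2 D (dv w))"
    "D.cell p q (dv w') (dv w') (id2 D (dv w'))" "D.cell p p (dv E) (dv E) (id2 D (dv E))"
    using t by (blast intro: D.cell_id2 D.id1_arr)+
  have r: "D.cell p q (dv w \<odot>\<^bsub>D\<^esub> id1 D p) (dv w) (run D (dv w))"
    "D.cell p q (dv w' \<odot>\<^bsub>D\<^esub> id1 D p) (dv w') (run D (dv w'))"
    using t by (blast intro: D.iso2_cell D.iso2_run)+
  have "cn (DComp w' E) w' \<cdot>\<^bsub>D\<^esub> (\<alpha> \<star>\<^bsub>D\<^esub> id2 D (dv E))
      = run D (dv w') \<cdot>\<^bsub>D\<^esub> (\<alpha> \<star>\<^bsub>D\<^esub> norm_iso E)"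
    by (simp add: dcan_unit_right[OF assms(1,3,6)] D.cell_assoc[OF r(2) D.cell_hc[OF i(3) kE] D.cell_hc[OF assms(4) i(4)]]
        D.hc_split_right[OF assms(4) kE])
  also have "\<dots> = (run D (dv w') \<cdot>\<^bsub>D\<^esub> (\<alpha> \<star>\<^bsub>D\<^esub> id2 D (id1 D p))) \<cdot>\<^bsub>D\<^esub> (id2 D (dv w) \<star>\<^bsub>D\<^esub> norm_iso E)"
    by (simp add: D.cell_assoc[OF r(2) D.cell_hc[OF assms(4) i(1)] D.cell_hc[OF i(2) kE]]
        D.hc_split_left[OF assms(4) kE])
  also have "\<dots> = \<alpha> \<cdot>\<^bsub>D\<^esub> cn (DComp w E) w"
    by (simp add: dcan_unit_right[OF assms(1,2,5)] D.cell_run_natural[OF assms(4)]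
        D.cell_assoc[OF assms(4) r(1) D.cell_hc[OF i(2) kE]])
  finally show ?thesis .
qed

lemma dcan_dcan_vc:
  assumes "similar p q w w'" "similar p q w' w''" "D.cell p q h (dv w) \<alpha>"
  shows "cn w' w'' \<cdot>\<^bsub>D\<^esub> (cn w w' \<cdot>\<^bsub>D\<^esub> \<alpha>) = cn w w'' \<cdot>\<^bsub>D\<^esub> \<alpha>"
  using D.cell_assoc[OF cell_dcan[OF assms(2)] cell_dcan[OF assms(1)] assms(3)]
  by (simp add: dcan_dcan[OF assms(1,2)])

lemma dcan_inverse_vc:
  assumes "similar p q w w'" "D.cell p q h (dv w) \<alpha>"
  shows "cn w' w \<cdot>\<^bsub>D\<^esub> (cn w w' \<cdot>\<^bsub>D\<^esub> \<alpha>) = \<alpha>"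
proof -
  have "similar p q w' w" using assms(1) by (auto simp: similar_def)
  from dcan_dcan_vc[OF assms(1) this assms(2)] show ?thesis
    by (simp add: dcan_refl[OF similarD(1)[OF assms(1)]] D.cell_id_left[OF assms(2)])
qed

lemma whisker_left_dcan:
  assumes "dty u q r" "similar p q v v'"
  shows "id2 D (dv u) \<star>\<^bsub>D\<^esub> cn v v' = cn (DComp u v) (DComp u v')"
  using dcan_hc[OF _ assms(2), of r u u] assms(1) by (simp add: dcan_refl similar_def)

lemma whisker_right_dcan:
  assumes "dty v p q" "similar q r u u'"
  shows "cn u u' \<star>\<^bsub>D\<^esub> id2 D (dv v) = cn (DComp u v) (DComp u' v)"
  using dcan_hc[OF assms(2), of p v v] assms(1) by (simp add: dcan_refl similar_def)

text \<open>Inverting the two canonical sides of a commuting square turns naturality of removing a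
  unit word into naturality of inserting one.\<close>

lemma dcan_transport:
  assumes "similar p q w u" "similar p q w' u'"
    and "D.cell p q (dv w) (dv w') \<alpha>" "D.cell p q (dv u) (dv u') \<beta>"
    and "cn u' w' \<cdot>\<^bsub>D\<^esub> \<beta> = \<alpha> \<cdot>\<^bsub>D\<^esub> cn u w"
  shows "\<beta> \<cdot>\<^bsub>D\<^esub> cn w u = cn w' u' \<cdot>\<^bsub>D\<^esub> \<alpha>"
proof -
  have s: "similar p q u w" "similar p q u' w'" using assms(1,2) by (auto simp: similar_def)
  have "\<beta> \<cdot>\<^bsub>D\<^esub> cn w u = (cn w' u' \<cdot>\<^bsub>D\<^esub> (\<alpha> \<cdot>\<^bsub>D\<^esub> cn u w)) \<cdot>\<^bsub>D\<^esub> cn w u"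
    using dcan_inverse_vc[OF s(2) assms(4)] by (simp add: assms(5))
  also have "\<dots> = cn w' u' \<cdot>\<^bsub>D\<^esub> (\<alpha> \<cdot>\<^bsub>D\<^esub> (cn u w \<cdot>\<^bsub>D\<^esub> cn w u))"
    using D.cell_assoc[OF cell_dcan[OF assms(2)] D.cell_vc[OF assms(3) cell_dcan[OF s(1)]] cell_dcan[OF assms(1)]]
      D.cell_assoc[OF assms(3) cell_dcan[OF s(1)] cell_dcan[OF assms(1)]]
    by simp
  also have "\<dots> = cn w' u' \<cdot>\<^bsub>D\<^esub> \<alpha>"
    by (simp add: dcan_dcan[OF assms(1) s(1)] dcan_refl[OF similarD(1)[OF assms(1)]] D.cell_id_right[OF assms(3)])
  finally show ?thesis .
qed

lemma dcan_unit_left_natural':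
  assumes "unit_word q E" "dty w p q" "dty w' p q" "D.cell p q (dv w) (dv w') \<alpha>"
  shows "(id2 D (dv E) \<star>\<^bsub>D\<^esub> \<alpha>) \<cdot>\<^bsub>D\<^esub> cn w (DComp E w) = cn w' (DComp E w') \<cdot>\<^bsub>D\<^esub> \<alpha>"
proof (rule dcan_transport[OF _ _ assms(4) _ dcan_unit_left_natural[OF assms]])
  have E: "dty E q q" using assms(1) by (simp add: unit_word_def)
  show "D.cell p q (dv (DComp E w)) (dv (DComp E w')) (id2 D (dv E) \<star>\<^bsub>D\<^esub> \<alpha>)"
    using D.cell_hc[OF D.cell_id2 assms(4)] dty_obj[OF E] dty_dv[OF E] by simp
qed (use assms similar_unit_left in blast)+

lemma dcan_unit_right_natural':
  assumes "unit_word p E" "dty w p q" "dty w' p q" "D.cell p q (dv w) (dv w') \<alpha>"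
    and "short_word (nf (dw w))" "short_word (nf (dw w'))"
  shows "(\<alpha> \<star>\<^bsub>D\<^esub> id2 D (dv E)) \<cdot>\<^bsub>D\<^esub> cn w (DComp w E) = cn w' (DComp w' E) \<cdot>\<^bsub>D\<^esub> \<alpha>"
proof (rule dcan_transport[OF _ _ assms(4) _ dcan_unit_right_natural[OF assms]])
  have E: "dty E p p" using assms(1) by (simp add: unit_word_def)
  show "D.cell p q (dv (DComp w E)) (dv (DComp w' E)) (\<alpha> \<star>\<^bsub>D\<^esub> id2 D (dv E))"
    using D.cell_hc[OF assms(4) D.cell_id2] dty_obj[OF E] dty_dv[OF E] by simp
qed (use assms similar_unit_right in blast)+

end

section \<open>Constraints of a transformation at identities\<close>

locale dg_transformation = dg_functor_pair C D F G + strong_dg_transformation C D F G \<eta>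
  for C :: "('o, 'm, 'c::ab_group_add, 'k::field) dgbicat"
    and D :: "('p, 'n, 'd::ab_group_add, 'k) dgbicat"
    and F G :: "('o, 'm, 'c, 'p, 'n, 'd) sfun"
    and \<eta> :: "('o, 'm, 'n, 'd) strans"
begin

lemma iso2_tcell:
  "\<lbrakk>x \<in> obj C; y \<in> obj C; f \<in> arr C x y\<rbrakk>
     \<Longrightarrow> D.iso2 (fob F x) (fob G y) (farr G f \<odot>\<^bsub>D\<^esub> tarr \<eta> x) (tarr \<eta> y \<odot>\<^bsub>D\<^esub> farr F f) (tcell \<eta> f)"
  by (rule D.closed_iso_iso2[OF _ _ _ _ tcell_iso])
    (blast intro: F.fob_obj G.fob_obj F.farr_arr G.farr_arr tarr_arr D.cmp_arr)+

lemma dty_tarr: "x \<in> obj C \<Longrightarrow> dty (DArr (tarr \<eta> x)) (fob F x) (fob G x)"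
  by (auto intro: dtyp_arr F.fob_obj G.fob_obj tarr_arr)

lemma similar_unit_naturality:
  assumes "x \<in> obj C"
  shows "similar (fob F x) (fob G x) (DComp (DG (WId x)) (DArr (tarr \<eta> x))) (DComp (DArr (tarr \<eta> x)) (DF (WId x)))"
  using assms by (auto simp: similar_def intro!: dtyp_comp dty_tarr intro: dtyp_F dtyp_G wtyp_id)

text \<open>The unit axiom expresses the constraint through \<open>lun\<close>, \<open>run\<close>
  and the unit constraints of \<open>F\<close> and \<open>G\<close>. Normalizing
  \<open>G(id) \<odot> \<eta>\<close> and \<open>\<eta> \<odot> F(id)\<close> uses the same cells,
  because \<open>spread_iso\<close> at \<open>WId\<close> is the inverse of
  \<open>funit\<close>.\<close>

lemma tcell_id1_eq_dcan:
  assumes x: "x \<in> obj C"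
  shows "tcell \<eta> (id1 C x) = cn (DComp (DG (WId x)) (DArr (tarr \<eta> x))) (DComp (DArr (tarr \<eta> x)) (DF (WId x)))"
proof (rule dcan_eqI[OF similar_unit_naturality[OF x]])
  let ?e = "tarr \<eta> x" and ?p = "fob F x" and ?q = "fob G x" and ?t = "tcell \<eta> (id1 C x)"
  let ?uF = "funit F x" and ?uG = "funit G x"
  let ?vF = "inv2 D (id1 D ?p) (farr F (id1 C x)) ?uF" and ?vG = "inv2 D (id1 D ?q) (farr G (id1 C x)) ?uG"
  let ?rr = "inv2 D (?e \<odot>\<^bsub>D\<^esub> id1 D ?p) ?e (run D ?e)"
  have p: "?p \<in> obj D" and q: "?q \<in> obj D" and e: "?e \<in> arr D ?p ?q"
    using x by (blast intro: F.fob_obj G.fob_obj tarr_arr)+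
  note uF = F.iso2_funit[OF x] and uG = G.iso2_funit[OF x]
  note cuF = D.iso2_cell[OF uF] and cuG = D.iso2_cell[OF uG]
  note cvF = D.cell_inv2[OF uF] and cvG = D.cell_inv2[OF uG]
  have ie: "D.cell ?p ?q ?e ?e (id2 D ?e)" using p q e by (rule D.cell_id2)
  note r = D.iso2_run[OF p q e] and l = D.iso2_lun[OF p q e]
  note crr = D.cell_inv2[OF r] and cr = D.iso2_cell[OF r] and cl = D.iso2_cell[OF l]
  have t: "D.cell ?p ?q (farr G (id1 C x) \<odot>\<^bsub>D\<^esub> ?e) (?e \<odot>\<^bsub>D\<^esub> farr F (id1 C x)) ?t"
    using x by (blast intro: D.iso2_cell iso2_tcell C.id1_arr)
  then show "D.cell ?p ?q (dv (DComp (DG (WId x)) (DArr ?e))) (dv (DComp (DArr ?e) (DF (WId x)))) ?t"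
    by simp
  have nI: "norm_iso (DF (WId x)) = ?vF" and nJ: "norm_iso (DG (WId x)) = ?vG"
    and ne: "norm_iso (DArr ?e) = id2 D ?e"
    by (simp_all add: norm_iso_def D.cell_id_left[OF cvF] D.cell_id_left[OF cvG] D.cell_id_left[OF ie])
  have I: "dty (DF (WId x)) ?p ?p" and J: "dty (DG (WId x)) ?q ?q"
    using x by (blast intro: dtyp_F dtyp_G wtyp_id)+
  have L: "norm_iso (DComp (DArr ?e) (DF (WId x))) = run D ?e \<cdot>\<^bsub>D\<^esub> (id2 D ?e \<star>\<^bsub>D\<^esub> ?vF)"
    and R: "norm_iso (DComp (DG (WId x)) (DArr ?e)) = lun D ?e \<cdot>\<^bsub>D\<^esub> (?vG \<star>\<^bsub>D\<^esub> id2 D ?e)"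
    using norm_iso_DComp[OF dty_tarr[OF x] I] norm_iso_DComp[OF J dty_tarr[OF x]] by (simp_all add: nI nJ ne)
  note ee = D.cell_id_left[OF ie]
  \<comment> \<open>Precomposing with the invertible \<open>?uG \<star> id\<close> brings in the
    left side of the unit axiom; both composites then reduce to \<open>lun D ?e\<close>.\<close>
  have "((run D ?e \<cdot>\<^bsub>D\<^esub> (id2 D ?e \<star>\<^bsub>D\<^esub> ?vF)) \<cdot>\<^bsub>D\<^esub> ?t) \<cdot>\<^bsub>D\<^esub> (?uG \<star>\<^bsub>D\<^esub> id2 D ?e)
      = (run D ?e \<cdot>\<^bsub>D\<^esub> (id2 D ?e \<star>\<^bsub>D\<^esub> ?vF)) \<cdot>\<^bsub>D\<^esub> ((id2 D ?e \<star>\<^bsub>D\<^esub> ?uF) \<cdot>\<^bsub>D\<^esub> (?rr \<cdot>\<^bsub>D\<^esub> lun D ?e))"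
    using D.cell_assoc[OF D.cell_vc[OF cr D.cell_hc[OF ie cvF]] t D.cell_hc[OF cuG ie]]
    by (simp add: tcell_id1[OF x])
  also have "\<dots> = run D ?e \<cdot>\<^bsub>D\<^esub> ((id2 D ?e \<star>\<^bsub>D\<^esub> ?vF) \<cdot>\<^bsub>D\<^esub> ((id2 D ?e \<star>\<^bsub>D\<^esub> ?uF) \<cdot>\<^bsub>D\<^esub> (?rr \<cdot>\<^bsub>D\<^esub> lun D ?e)))"
    by (rule D.cell_assoc[OF cr D.cell_hc[OF ie cvF] D.cell_vc[OF D.cell_hc[OF ie cuF] D.cell_vc[OF crr cl]]])
  also have "\<dots> = run D ?e \<cdot>\<^bsub>D\<^esub> (((id2 D ?e \<star>\<^bsub>D\<^esub> ?vF) \<cdot>\<^bsub>D\<^esub> (id2 D ?e \<star>\<^bsub>D\<^esub> ?uF)) \<cdot>\<^bsub>D\<^esub> (?rr \<cdot>\<^bsub>D\<^esub> lun D ?e))"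
    by (simp add: D.cell_assoc[OF D.cell_hc[OF ie cvF] D.cell_hc[OF ie cuF] D.cell_vc[OF crr cl]])
  also have "\<dots> = lun D ?e"
    using p q e
    by (simp add: D.cell_interchange[OF ie ie cvF cuF] ee D.inv2_left[OF uF] D.hc_id2 D.id1_arr
        D.cell_id_left[OF D.cell_vc[OF crr cl]] D.inv2_cancel_left'[OF r cl])
  also have "\<dots> = (lun D ?e \<cdot>\<^bsub>D\<^esub> (?vG \<star>\<^bsub>D\<^esub> id2 D ?e)) \<cdot>\<^bsub>D\<^esub> (?uG \<star>\<^bsub>D\<^esub> id2 D ?e)"
    using p q e
    by (simp add: D.cell_assoc[OF cl D.cell_hc[OF cvG ie] D.cell_hc[OF cuG ie]]
        D.cell_interchange[OF cvG cuG ie ie] ee D.inv2_left[OF uG] D.hc_id2 D.id1_arr D.cell_id_right[OF cl])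
  finally show "norm_iso (DComp (DArr ?e) (DF (WId x))) \<cdot>\<^bsub>D\<^esub> ?t = norm_iso (DComp (DG (WId x)) (DArr ?e))"
    unfolding L R
    by (rule D.iso2_right_cancel[OF D.iso2_hc[OF uG D.iso2_id2[OF p q e]]
          D.cell_vc[OF D.cell_vc[OF cr D.cell_hc[OF ie cvF]] t] D.cell_vc[OF cl D.cell_hc[OF cvG ie]]])
qed

lemma inv2_tcell_id1:
  assumes x: "x \<in> obj C"
  shows "inv2 D (farr G (id1 C x) \<odot>\<^bsub>D\<^esub> tarr \<eta> x) (tarr \<eta> x \<odot>\<^bsub>D\<^esub> farr F (id1 C x)) (tcell \<eta> (id1 C x))
    = cn (DComp (DArr (tarr \<eta> x)) (DF (WId x))) (DComp (DG (WId x)) (DArr (tarr \<eta> x)))"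
proof -
  note s = similar_unit_naturality[OF x]
  have s': "similar (fob F x) (fob G x) (DComp (DArr (tarr \<eta> x)) (DF (WId x))) (DComp (DG (WId x)) (DArr (tarr \<eta> x)))"
    using s by (auto simp: similar_def)
  show ?thesis
    unfolding tcell_id1_eq_dcan[OF x]
    using D.inv2_eqI[OF cell_dcan[OF s] cell_dcan[OF s']]
    by (simp add: dcan_dcan[OF s s'] dcan_dcan[OF s' s] dcan_refl[OF similarD(1)[OF s]] dcan_refl[OF similarD(2)[OF s]])
qed

end

section \<open>Segments and blocks without columns\<close>

lemma down_same [simp]: "down p p = []"
  by (simp add: down_def)

text \<open>For a source without columns both cuts \<open>p\<close> and \<open>q\<close> of the
  action equal \<open>sob P 0\<close>, so the middle segments are empty.\<close>

lemma seg_same [simp]: "seg dat p p j = WId (fst dat ! p)"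
  by (simp add: seg_def)

lemma block_same [simp]: "block C dat \<sigma> p p lo hi = id2 C (id1 C (fst dat ! p))"
  by (simp add: block_def)

lemma block_places_same [simp]: "block_places p p lo hi = []"
  by (simp add: block_places_def)

lemma down_0_1 [simp]: "down 0 (Suc 0) = [Suc 0]"
  by (simp add: down_def)

text \<open>Neither the point nor ([1];[0]) has 2-cell inputs, so \<open>act_places\<close> reduces
  to the place (0,0) of \<Psi> and the sign is trivial.\<close>

lemma koszul_single [simp]: "koszul deg [a] = 0"
  by (simp add: koszul_def)

section \<open>Cochains at the point and their cofaces\<close>

locale dg_transformation_pair = dg_functor_pair C D F G
    + eta: dg_transformation C D F G \<eta> + theta: dg_transformation C D F G \<theta>
  for C :: "('o, 'm, 'c::ab_group_add, 'k::field) dgbicat"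
    and D :: "('p, 'n, 'd::ab_group_add, 'k) dgbicat"
    and F G :: "('o, 'm, 'c, 'p, 'n, 'd) sfun"
    and \<eta> \<theta> :: "('o, 'm, 'n, 'd) strans"
begin

definition inv_tcell where
  "inv_tcell \<zeta> x y f = inv2 D (farr G f \<odot>\<^bsub>D\<^esub> tarr \<zeta> x) (tarr \<zeta> y \<odot>\<^bsub>D\<^esub> farr F f) (tcell \<zeta> f)"

text \<open>The left side is \<open>act_mid\<close> for the point, where \<open>A_plus\<close> and
  \<open>A_minus\<close> are empty horizontal composites. Their whiskered images under
  \<open>G\<close> and \<open>F\<close> are identities, while the two \<open>dcan\<close> stay
  because of the padding by \<open>G(id)\<close> and \<open>F(id)\<close>.\<close>

lemma act_mid_point:
  assumes x: "x \<in> obj C" and \<Gamma>: "D.cell (fob F x) (fob G x) (tarr \<eta> x) (tarr \<theta> x) \<Gamma>"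
  shows "(fcell G (id2 C (id1 C x)) \<star>\<^bsub>D\<^esub> id2 D (tarr \<theta> x))
      \<cdot>\<^bsub>D\<^esub> cn (DArr (tarr \<theta> x)) (DComp (DG (WId x)) (DArr (tarr \<theta> x)))
      \<cdot>\<^bsub>D\<^esub> \<Gamma>
      \<cdot>\<^bsub>D\<^esub> cn (DComp (DArr (tarr \<eta> x)) (DF (WId x))) (DArr (tarr \<eta> x))
      \<cdot>\<^bsub>D\<^esub> (id2 D (tarr \<eta> x) \<star>\<^bsub>D\<^esub> fcell F (id2 C (id1 C x)))
    = cn (DArr (tarr \<theta> x)) (DComp (DG (WId x)) (DArr (tarr \<theta> x)))
      \<cdot>\<^bsub>D\<^esub> \<Gamma> \<cdot>\<^bsub>D\<^esub> cn (DComp (DArr (tarr \<eta> x)) (DF (WId x))) (DArr (tarr \<eta> x))"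
proof -
  let ?t = "DArr (tarr \<theta> x)" and ?n = "DArr (tarr \<eta> x)"
  have ty: "dty (DG (WId x)) (fob G x) (fob G x)" "dty (DF (WId x)) (fob F x) (fob F x)"
    using x by (blast intro: dtyp_F dtyp_G wtyp_id)+
  note ty' = eta.dty_tarr[OF x] theta.dty_tarr[OF x]
  have s: "similar (fob F x) (fob G x) ?t (DComp (DG (WId x)) ?t)"
    "similar (fob F x) (fob G x) (DComp ?n (DF (WId x))) ?n"
    using ty ty' by (auto simp: similar_def intro: dtyp_comp)
  note c = cell_dcan[OF s(1)] cell_dcan[OF s(2)]
  have \<Gamma>': "D.cell (fob F x) (fob G x) (dv ?n) (dv ?t) \<Gamma>" using \<Gamma> by simp
  have i: "fcell G (id2 C (id1 C x)) \<star>\<^bsub>D\<^esub> id2 D (tarr \<theta> x) = id2 D (dv (DComp (DG (WId x)) ?t))"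
    "id2 D (tarr \<eta> x) \<star>\<^bsub>D\<^esub> fcell F (id2 C (id1 C x)) = id2 D (dv (DComp ?n (DF (WId x))))"
    using x D.hc_id2[OF _ _ _ F.farr_arr[OF x x C.id1_arr[OF x]] eta.tarr_arr[OF x]]
      D.hc_id2[OF _ _ _ theta.tarr_arr[OF x] G.farr_arr[OF x x C.id1_arr[OF x]]]
    by (simp_all add: F.fcell_id2[OF x x] G.fcell_id2[OF x x] C.id1_arr F.fob_obj G.fob_obj)
  show ?thesis
    unfolding i
    by (simp only: D.cell_id_right[OF c(2)] D.cell_id_left[OF D.cell_vc[OF c(1) D.cell_vc[OF \<Gamma>' c(2)]]])
qed

text \<open>The left side is the action into ([1];[0]) with both cuts at 1: \<open>h0\<close>,
  \<open>h1\<close>, \<open>v0\<close>, \<open>v3\<close> are empty and \<open>u0\<close>,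
  \<open>u1\<close> consist of \<open>f\<close>. So the constraint of \<eta> is taken at an identity
  and is canonical, and only \<theta> contributes at \<open>f\<close>. Naturality collects the
  canonical cells on the left, where they cancel.\<close>

lemma act_at_target:
  assumes x: "x \<in> obj C" and y: "y \<in> obj C" and f: "f \<in> arr C x y"
    and \<Gamma>: "D.cell (fob F y) (fob G y) (tarr \<eta> y) (tarr \<theta> y) \<Gamma>"
  defines "J \<equiv> DG (WId y)" and "I \<equiv> DF (WId y)" and "Ff \<equiv> DF (WGen f)" and "Gf \<equiv> DG (WGen f)"
    and "n \<equiv> DArr (tarr \<eta> y)" and "t \<equiv> DArr (tarr \<theta> y)" and "tx \<equiv> DArr (tarr \<theta> x)"
  shows "cn (DComp (DComp J J) (DComp Gf tx)) (DComp Gf tx)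
      \<cdot>\<^bsub>D\<^esub> (id2 D (dv (DComp J J)) \<star>\<^bsub>D\<^esub> inv_tcell \<theta> x y f)
      \<cdot>\<^bsub>D\<^esub> cn (DComp J (DComp (DComp J t) Ff)) (DComp (DComp J J) (DComp t Ff))
      \<cdot>\<^bsub>D\<^esub> (id2 D (dv J) \<star>\<^bsub>D\<^esub> ((cn t (DComp J t) \<cdot>\<^bsub>D\<^esub> \<Gamma> \<cdot>\<^bsub>D\<^esub> cn (DComp n I) n) \<star>\<^bsub>D\<^esub> id2 D (dv Ff)))
      \<cdot>\<^bsub>D\<^esub> cn (DComp (DComp J n) (DComp I Ff)) (DComp J (DComp (DComp n I) Ff))
      \<cdot>\<^bsub>D\<^esub> (inv_tcell \<eta> y y (id1 C y) \<star>\<^bsub>D\<^esub> id2 D (dv (DComp I Ff)))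
      \<cdot>\<^bsub>D\<^esub> cn (DComp n Ff) (DComp (DComp n I) (DComp I Ff))
    = inv_tcell \<theta> x y f \<cdot>\<^bsub>D\<^esub> (\<Gamma> \<star>\<^bsub>D\<^esub> id2 D (farr F f))"
    (is "?a \<cdot>\<^bsub>D\<^esub> ?b \<cdot>\<^bsub>D\<^esub> ?c \<cdot>\<^bsub>D\<^esub> ?M \<cdot>\<^bsub>D\<^esub> ?d \<cdot>\<^bsub>D\<^esub> ?g \<cdot>\<^bsub>D\<^esub> ?h = ?th \<cdot>\<^bsub>D\<^esub> ?\<beta>")
proof -
  note defs = J_def I_def Ff_def Gf_def n_def t_def tx_def
  let ?p = "fob F x" and ?q = "fob F y" and ?s = "fob G x" and ?r = "fob G y"
  have ty: "dty J ?r ?r" "dty I ?q ?q" "dty Ff ?p ?q" "dty Gf ?s ?r" "dty n ?q ?r" "dty t ?q ?r" "dty tx ?p ?s"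
    unfolding defs using x y f by (blast intro: dtyp_F dtyp_G wtyp.intros eta.dty_tarr theta.dty_tarr)+
  have dw: "dw J = WId ?r" "dw I = WId ?q" "dw Ff = WGen (farr F f)" "dw Gf = WGen (farr G f)"
    "dw n = WGen (tarr \<eta> y)" "dw t = WGen (tarr \<theta> y)" "dw tx = WGen (tarr \<theta> x)"
    by (simp_all add: defs)
  note sim = similar_def dw
  have \<Gamma>': "D.cell ?q ?r (dv n) (dv t) \<Gamma>" using \<Gamma> by (simp add: defs)
  have iF: "D.cell ?p ?q (dv Ff) (dv Ff) (id2 D (dv Ff))" and iJ: "D.cell ?r ?r (dv J) (dv J) (id2 D (dv J))"
    using ty x y by (auto intro!: D.cell_id2 F.fob_obj G.fob_obj dest: dty_dv)
  have \<beta>: "D.cell ?p ?r (dv (DComp n Ff)) (dv (DComp t Ff)) ?\<beta>"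
    using D.cell_hc[OF \<Gamma>' iF] by (simp add: defs)
  have th: "D.cell ?p ?r (dv (DComp t Ff)) (dv (DComp Gf tx)) ?th"
    using D.cell_inv2[OF theta.iso2_tcell[OF x y f]] by (simp add: defs inv_tcell_def)
  have uJ: "unit_word ?r J" and uJJ: "unit_word ?r (DComp J J)"
    using ty by (auto simp: unit_word_def dw intro: dtyp_comp)
  let ?S1 = "DComp (DComp n I) (DComp I Ff)" and ?S2 = "DComp (DComp J n) (DComp I Ff)"
    and ?S3 = "DComp J (DComp (DComp n I) Ff)"
  have s01: "similar ?p ?r (DComp n Ff) ?S1" and s12: "similar ?p ?r ?S1 ?S2" and s23: "similar ?p ?r ?S2 ?S3"
    and s02: "similar ?p ?r (DComp n Ff) ?S2" and s03: "similar ?p ?r (DComp n Ff) ?S3"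
    using ty by (auto simp: sim intro: dtyp_comp)
  have g: "?g = cn ?S1 ?S2"
    using whisker_right_dcan[of "DComp I Ff" ?p ?q ?r "DComp n I" "DComp J n"] ty
    by (simp add: inv_tcell_def eta.inv2_tcell_id1[OF y] defs[symmetric]) (auto simp: sim intro: dtyp_comp)
  have dgh: "?d \<cdot>\<^bsub>D\<^esub> ?g \<cdot>\<^bsub>D\<^esub> ?h = cn (DComp n Ff) ?S3"
    unfolding g by (simp add: dcan_dcan[OF s01 s12] dcan_dcan[OF s02 s23])
  have t1: "similar ?q ?r t (DComp J t)" and t2: "similar ?q ?r (DComp n I) n"
    using ty by (auto simp: sim intro: dtyp_comp)
  note c1 = cell_dcan[OF t1] and c2 = cell_dcan[OF t2]
  let ?S4 = "DComp J (DComp n Ff)" and ?T1 = "DComp J (DComp t Ff)" and ?R3 = "DComp J (DComp (DComp J t) Ff)"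
  have t3: "similar ?p ?r (DComp t Ff) (DComp (DComp J t) Ff)" and t4: "similar ?p ?r (DComp (DComp n I) Ff) (DComp n Ff)"
    using ty by (auto simp: sim intro: dtyp_comp)
  have "(cn t (DComp J t) \<cdot>\<^bsub>D\<^esub> \<Gamma> \<cdot>\<^bsub>D\<^esub> cn (DComp n I) n) \<star>\<^bsub>D\<^esub> id2 D (dv Ff)
      = cn (DComp t Ff) (DComp (DComp J t) Ff) \<cdot>\<^bsub>D\<^esub> ?\<beta> \<cdot>\<^bsub>D\<^esub> cn (DComp (DComp n I) Ff) (DComp n Ff)"
    using D.cell_arrD[OF iF]
    by (simp add: D.whisker_right_vc[OF _ _ _ c1 D.cell_vc[OF \<Gamma>' c2]] D.whisker_right_vc[OF _ _ _ \<Gamma>' c2]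
        whisker_right_dcan[OF ty(3) t1] whisker_right_dcan[OF ty(3) t2]) (simp add: defs)
  then have M: "?M = cn ?T1 ?R3 \<cdot>\<^bsub>D\<^esub> (id2 D (dv J) \<star>\<^bsub>D\<^esub> ?\<beta>) \<cdot>\<^bsub>D\<^esub> cn ?S3 ?S4"
    using D.cell_arrD[OF iJ]
    by (simp add: D.whisker_left_vc[OF _ _ _ cell_dcan[OF t3] D.cell_vc[OF \<beta> cell_dcan[OF t4]]]
        D.whisker_left_vc[OF _ _ _ \<beta> cell_dcan[OF t4]] whisker_left_dcan[OF ty(1) t3] whisker_left_dcan[OF ty(1) t4])
  let ?R4 = "DComp (DComp J J) (DComp t Ff)"
  have s13: "similar ?p ?r ?T1 ?R3" and s34: "similar ?p ?r ?S3 ?S4"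
    and sT: "similar ?p ?r (DComp t Ff) ?T1" and sTR: "similar ?p ?r (DComp t Ff) ?R3"
    and sR: "similar ?p ?r ?R3 ?R4"
    and s56: "similar ?p ?r (DComp Gf tx) (DComp (DComp J J) (DComp Gf tx))"
    and sT4: "similar ?p ?r (DComp t Ff) ?R4"
    using ty by (auto simp: sim intro: dtyp_comp)
  have tyS: "dty (DComp n Ff) ?p ?r" "dty (DComp t Ff) ?p ?r" "dty (DComp Gf tx) ?p ?r"
    using ty by (blast intro: dtyp_comp)+
  have J\<beta>: "D.cell ?p ?r (dv ?S4) (dv ?T1) (id2 D (dv J) \<star>\<^bsub>D\<^esub> ?\<beta>)"
    using D.cell_hc[OF iJ \<beta>] by simp
  \<comment> \<open>\<open>?\<beta>\<close> is the only noncanonical factor inside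
    \<open>?M\<close>; naturality of the padding by \<open>J\<close> moves it to the right
    end.\<close>
  have "?M \<cdot>\<^bsub>D\<^esub> cn (DComp n Ff) ?S3 = cn ?T1 ?R3 \<cdot>\<^bsub>D\<^esub> (id2 D (dv J) \<star>\<^bsub>D\<^esub> ?\<beta>) \<cdot>\<^bsub>D\<^esub> cn (DComp n Ff) ?S4"
    unfolding M
    by (simp add: D.cell_assoc[OF cell_dcan[OF s13] D.cell_vc[OF J\<beta> cell_dcan[OF s34]] cell_dcan[OF s03]]
        D.cell_assoc[OF J\<beta> cell_dcan[OF s34] cell_dcan[OF s03]] dcan_dcan[OF s03 s34])
  also have "\<dots> = cn (DComp t Ff) ?R3 \<cdot>\<^bsub>D\<^esub> ?\<beta>"
    by (simp add: dcan_unit_left_natural'[OF uJ tyS(1,2) \<beta>] dcan_dcan_vc[OF sT s13 \<beta>])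
  finally have M2: "?M \<cdot>\<^bsub>D\<^esub> cn (DComp n Ff) ?S3 = cn (DComp t Ff) ?R3 \<cdot>\<^bsub>D\<^esub> ?\<beta>" .
  have bc: "D.cell ?p ?r (dv ?R4) (dv (DComp (DComp J J) (DComp Gf tx))) ?b"
    using D.cell_hc[OF D.cell_id2[OF _ _ dty_dv[OF dtyp_comp[OF ty(1,1)]]] th] dty_obj[OF ty(1)] by simp
  \<comment> \<open>The padding is now \<open>J J\<close>, again a unit word, and moves past the
    inverse constraint of \<theta>.\<close>
  have "?b \<cdot>\<^bsub>D\<^esub> cn (DComp t Ff) ?R4 \<cdot>\<^bsub>D\<^esub> ?\<beta>
      = cn (DComp Gf tx) (DComp (DComp J J) (DComp Gf tx)) \<cdot>\<^bsub>D\<^esub> ?th \<cdot>\<^bsub>D\<^esub> ?\<beta>"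
    by (simp only: D.cell_assoc[OF bc cell_dcan[OF sT4] \<beta>, symmetric] dcan_unit_left_natural'[OF uJJ tyS(2,3) th]
        D.cell_assoc[OF cell_dcan[OF s56] th \<beta>])
  then show ?thesis
    unfolding dgh M2 dcan_dcan_vc[OF sTR sR \<beta>]
    by (simp only: dcan_inverse_vc[OF s56 D.cell_vc[OF th \<beta>]])
qed

text \<open>Now both cuts are at 0: \<open>h0\<close>, \<open>h1\<close> consist of
  \<open>f\<close>, the other segments are empty, and \<eta> and \<theta> exchange roles. The
  padding by \<open>I\<close> stands on the right, so right unit naturality is needed; the words it
  meets have normal forms of one or two letters.\<close>

lemma act_at_source:
  assumes x: "x \<in> obj C" and y: "y \<in> obj C" and f: "f \<in> arr C x y"
    and \<Gamma>: "D.cell (fob F x) (fob G x) (tarr \<eta> x) (tarr \<theta> x) \<Gamma>"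
  defines "J \<equiv> DG (WId x)" and "I \<equiv> DF (WId x)" and "Ff \<equiv> DF (WGen f)" and "Gf \<equiv> DG (WGen f)"
    and "n \<equiv> DArr (tarr \<eta> x)" and "t \<equiv> DArr (tarr \<theta> x)" and "n1 \<equiv> DArr (tarr \<eta> y)"
  shows "cn (DComp (DComp Gf J) (DComp J t)) (DComp Gf t)
      \<cdot>\<^bsub>D\<^esub> (id2 D (dv (DComp Gf J)) \<star>\<^bsub>D\<^esub> inv_tcell \<theta> x x (id1 C x))
      \<cdot>\<^bsub>D\<^esub> cn (DComp Gf (DComp (DComp J t) I)) (DComp (DComp Gf J) (DComp t I))
      \<cdot>\<^bsub>D\<^esub> (id2 D (dv Gf) \<star>\<^bsub>D\<^esub> ((cn t (DComp J t) \<cdot>\<^bsub>D\<^esub> \<Gamma> \<cdot>\<^bsub>D\<^esub> cn (DComp n I) n) \<star>\<^bsub>D\<^esub> id2 D (dv I)))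
      \<cdot>\<^bsub>D\<^esub> cn (DComp (DComp Gf n) (DComp I I)) (DComp Gf (DComp (DComp n I) I))
      \<cdot>\<^bsub>D\<^esub> (inv_tcell \<eta> x y f \<star>\<^bsub>D\<^esub> id2 D (dv (DComp I I)))
      \<cdot>\<^bsub>D\<^esub> cn (DComp n1 Ff) (DComp (DComp n1 Ff) (DComp I I))
    = (id2 D (farr G f) \<star>\<^bsub>D\<^esub> \<Gamma>) \<cdot>\<^bsub>D\<^esub> inv_tcell \<eta> x y f"
    (is "?a \<cdot>\<^bsub>D\<^esub> ?b \<cdot>\<^bsub>D\<^esub> ?c \<cdot>\<^bsub>D\<^esub> ?M \<cdot>\<^bsub>D\<^esub> ?d \<cdot>\<^bsub>D\<^esub> ?g \<cdot>\<^bsub>D\<^esub> ?h = ?\<beta> \<cdot>\<^bsub>D\<^esub> ?et")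
proof -
  note defs = J_def I_def Ff_def Gf_def n_def t_def n1_def
  let ?p = "fob F x" and ?q = "fob F y" and ?s = "fob G x" and ?r = "fob G y"
  have ty: "dty J ?s ?s" "dty I ?p ?p" "dty Ff ?p ?q" "dty Gf ?s ?r" "dty n ?p ?s" "dty t ?p ?s" "dty n1 ?q ?r"
    unfolding defs using x y f by (blast intro: dtyp_F dtyp_G wtyp.intros eta.dty_tarr theta.dty_tarr)+
  have dw: "dw J = WId ?s" "dw I = WId ?p" "dw Ff = WGen (farr F f)" "dw Gf = WGen (farr G f)"
    "dw n = WGen (tarr \<eta> x)" "dw t = WGen (tarr \<theta> x)" "dw n1 = WGen (tarr \<eta> y)"
    by (simp_all add: defs)
  note sim = similar_def dw
  have \<Gamma>': "D.cell ?p ?s (dv n) (dv t) \<Gamma>" using \<Gamma> by (simp add: defs)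
  have iG: "D.cell ?s ?r (dv Gf) (dv Gf) (id2 D (dv Gf))" and iI: "D.cell ?p ?p (dv I) (dv I) (id2 D (dv I))"
    using ty x y by (auto intro!: D.cell_id2 F.fob_obj G.fob_obj dest: dty_dv)
  have \<Gamma>I: "D.cell ?p ?s (dv (DComp n I)) (dv (DComp t I)) (\<Gamma> \<star>\<^bsub>D\<^esub> id2 D (dv I))"
    using D.cell_hc[OF \<Gamma>' iI] by simp
  have \<beta>: "D.cell ?p ?r (dv (DComp Gf n)) (dv (DComp Gf t)) ?\<beta>"
    using D.cell_hc[OF iG \<Gamma>'] by (simp add: defs)
  have et: "D.cell ?p ?r (dv (DComp n1 Ff)) (dv (DComp Gf n)) ?et"
    using D.cell_inv2[OF eta.iso2_tcell[OF x y f]] by (simp add: defs inv_tcell_def)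
  have uI: "unit_word ?p I" and uII: "unit_word ?p (DComp I I)"
    using ty by (auto simp: unit_word_def dw intro: dtyp_comp)
  have tyS: "dty (DComp n1 Ff) ?p ?r" "dty (DComp Gf n) ?p ?r" "dty (DComp Gf t) ?p ?r"
    using ty by (blast intro: dtyp_comp)+
  let ?S2 = "DComp (DComp Gf n) (DComp I I)" and ?S3 = "DComp Gf (DComp (DComp n I) I)"
    and ?S4 = "DComp Gf (DComp n I)" and ?T4 = "DComp Gf (DComp t I)" and ?R3 = "DComp Gf (DComp (DComp J t) I)"
    and ?R4 = "DComp (DComp Gf J) (DComp t I)" and ?R5 = "DComp (DComp Gf J) (DComp J t)"
  have s2: "similar ?p ?r (DComp Gf n) ?S2" and s23: "similar ?p ?r ?S2 ?S3" and s3: "similar ?p ?r (DComp Gf n) ?S3"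
    and s34: "similar ?p ?r ?S3 ?S4" and s4: "similar ?p ?r (DComp Gf n) ?S4" and r43: "similar ?p ?r ?T4 ?R3"
    and r4: "similar ?p ?r (DComp Gf t) ?T4" and r3: "similar ?p ?r (DComp Gf t) ?R3" and r34: "similar ?p ?r ?R3 ?R4"
    and r4': "similar ?p ?r (DComp Gf t) ?R4" and r45: "similar ?p ?r ?R4 ?R5" and r5: "similar ?p ?r (DComp Gf t) ?R5"
    using ty by (auto simp: sim intro: dtyp_comp)
  have "?g \<cdot>\<^bsub>D\<^esub> ?h = cn (DComp Gf n) ?S2 \<cdot>\<^bsub>D\<^esub> ?et"
    by (rule dcan_unit_right_natural'[OF uII tyS(1,2) et]) (simp_all add: dw short_word_def)
  then have dgh: "?d \<cdot>\<^bsub>D\<^esub> ?g \<cdot>\<^bsub>D\<^esub> ?h = cn (DComp Gf n) ?S3 \<cdot>\<^bsub>D\<^esub> ?et"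
    by (simp only: dcan_dcan_vc[OF s2 s23 et])
  have t1: "similar ?p ?s t (DComp J t)" and t2: "similar ?p ?s (DComp n I) n"
    and t3: "similar ?p ?s (DComp t I) (DComp (DComp J t) I)" and t4: "similar ?p ?s (DComp (DComp n I) I) (DComp n I)"
    and t5: "similar ?p ?s n (DComp n I)" and t6: "similar ?p ?s t (DComp t I)"
    using ty by (auto simp: sim intro: dtyp_comp)
  note c1 = cell_dcan[OF t1] and c2 = cell_dcan[OF t2]
  have "(cn t (DComp J t) \<cdot>\<^bsub>D\<^esub> \<Gamma> \<cdot>\<^bsub>D\<^esub> cn (DComp n I) n) \<star>\<^bsub>D\<^esub> id2 D (dv I)
      = cn (DComp t I) (DComp (DComp J t) I) \<cdot>\<^bsub>D\<^esub> (\<Gamma> \<star>\<^bsub>D\<^esub> id2 D (dv I)) \<cdot>\<^bsub>D\<^esub> cn (DComp (DComp n I) I) (DComp n I)"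
    using D.cell_arrD[OF iI]
    by (simp add: D.whisker_right_vc[OF _ _ _ c1 D.cell_vc[OF \<Gamma>' c2]] D.whisker_right_vc[OF _ _ _ \<Gamma>' c2]
        whisker_right_dcan[OF ty(2) t1] whisker_right_dcan[OF ty(2) t2])
  then have M: "?M = cn ?T4 ?R3 \<cdot>\<^bsub>D\<^esub> (id2 D (dv Gf) \<star>\<^bsub>D\<^esub> (\<Gamma> \<star>\<^bsub>D\<^esub> id2 D (dv I))) \<cdot>\<^bsub>D\<^esub> cn ?S3 ?S4"
    using D.cell_arrD[OF iG]
    by (simp add: D.whisker_left_vc[OF _ _ _ cell_dcan[OF t3] D.cell_vc[OF \<Gamma>I cell_dcan[OF t4]]]
        D.whisker_left_vc[OF _ _ _ \<Gamma>I cell_dcan[OF t4]] whisker_left_dcan[OF ty(4) t3] whisker_left_dcan[OF ty(4) t4])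
  have G\<Gamma>I: "D.cell ?p ?r (dv ?S4) (dv ?T4) (id2 D (dv Gf) \<star>\<^bsub>D\<^esub> (\<Gamma> \<star>\<^bsub>D\<^esub> id2 D (dv I)))"
    using D.cell_hc[OF iG \<Gamma>I] by simp
  \<comment> \<open>The \<open>J\<close> next to \<Gamma> is absorbed into canonical isomorphisms,
    but \<open>I\<close> has to be moved past \<Gamma> itself.\<close>
  have nat: "(\<Gamma> \<star>\<^bsub>D\<^esub> id2 D (dv I)) \<cdot>\<^bsub>D\<^esub> cn n (DComp n I) = cn t (DComp t I) \<cdot>\<^bsub>D\<^esub> \<Gamma>"
    by (rule dcan_unit_right_natural'[OF uI ty(5,6) \<Gamma>']) (simp_all add: dw short_word_def)
  \<comment> \<open>Whiskering the whole square \<open>nat\<close> with \<open>Gf\<close> keeps the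
    bracketing \<open>Gf (n I)\<close>, so no associator enters.\<close>
  have "(id2 D (dv Gf) \<star>\<^bsub>D\<^esub> (\<Gamma> \<star>\<^bsub>D\<^esub> id2 D (dv I))) \<cdot>\<^bsub>D\<^esub> cn (DComp Gf n) ?S4
      = id2 D (dv Gf) \<star>\<^bsub>D\<^esub> ((\<Gamma> \<star>\<^bsub>D\<^esub> id2 D (dv I)) \<cdot>\<^bsub>D\<^esub> cn n (DComp n I))"
    using D.cell_arrD[OF iG]
    by (simp add: D.whisker_left_vc[OF _ _ _ \<Gamma>I cell_dcan[OF t5]] whisker_left_dcan[OF ty(4) t5])
  also have "\<dots> = cn (DComp Gf t) ?T4 \<cdot>\<^bsub>D\<^esub> ?\<beta>"
    using D.cell_arrD[OF iG]
    by (simp add: nat D.whisker_left_vc[OF _ _ _ cell_dcan[OF t6] \<Gamma>'] whisker_left_dcan[OF ty(4) t6]) (simp add: defs)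
  finally have N: "(id2 D (dv Gf) \<star>\<^bsub>D\<^esub> (\<Gamma> \<star>\<^bsub>D\<^esub> id2 D (dv I))) \<cdot>\<^bsub>D\<^esub> cn (DComp Gf n) ?S4
      = cn (DComp Gf t) ?T4 \<cdot>\<^bsub>D\<^esub> ?\<beta>" .
  have "?M \<cdot>\<^bsub>D\<^esub> (cn (DComp Gf n) ?S3 \<cdot>\<^bsub>D\<^esub> ?et)
      = cn ?T4 ?R3 \<cdot>\<^bsub>D\<^esub> ((id2 D (dv Gf) \<star>\<^bsub>D\<^esub> (\<Gamma> \<star>\<^bsub>D\<^esub> id2 D (dv I))) \<cdot>\<^bsub>D\<^esub> cn (DComp Gf n) ?S4) \<cdot>\<^bsub>D\<^esub> ?et"
    unfolding M
    by (simp only: D.cell_assoc[OF cell_dcan[OF r43] D.cell_vc[OF G\<Gamma>I cell_dcan[OF s34]] D.cell_vc[OF cell_dcan[OF s3] et]]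
        D.cell_assoc[OF G\<Gamma>I cell_dcan[OF s34] D.cell_vc[OF cell_dcan[OF s3] et]] dcan_dcan_vc[OF s3 s34 et]
        D.cell_assoc[OF G\<Gamma>I cell_dcan[OF s4] et])
  also have "\<dots> = cn (DComp Gf t) ?R3 \<cdot>\<^bsub>D\<^esub> ?\<beta> \<cdot>\<^bsub>D\<^esub> ?et"
    by (simp only: N D.cell_assoc[OF cell_dcan[OF r4] \<beta> et] dcan_dcan_vc[OF r4 r43 D.cell_vc[OF \<beta> et]])
  finally have M2: "?M \<cdot>\<^bsub>D\<^esub> (cn (DComp Gf n) ?S3 \<cdot>\<^bsub>D\<^esub> ?et) = cn (DComp Gf t) ?R3 \<cdot>\<^bsub>D\<^esub> ?\<beta> \<cdot>\<^bsub>D\<^esub> ?et" .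
  have b: "?b = cn ?R4 ?R5"
    using whisker_left_dcan[of "DComp Gf J" ?s ?r ?p "DComp t I" "DComp J t"] ty
    by (simp add: inv_tcell_def theta.inv2_tcell_id1[OF x] defs[symmetric]) (auto simp: sim intro: dtyp_comp)
  show ?thesis
    unfolding dgh M2 b dcan_dcan_vc[OF r3 r34 D.cell_vc[OF \<beta> et]] dcan_dcan_vc[OF r4' r45 D.cell_vc[OF \<beta> et]]
    by (rule dcan_inverse_vc[OF r5 D.cell_vc[OF \<beta> et]])
qed

end

section \<open>Strict functors between free bicategories\<close>

definition globset_map where
  "globset_map X Y a b c \<longleftrightarrow>
     (\<forall>x \<in> gobj X. a x \<in> gobj Y) \<and>
     (\<forall>f \<in> garr X. b f \<in> garr Y \<and> s0 Y (b f) = a (s0 X f) \<and> t0 Y (b f) = a (t0 X f)) \<and>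
     (\<forall>t \<in> gcel X. c t \<in> gcel Y \<and> s1 Y (c t) = b (s1 X t) \<and> t1 Y (c t) = b (t1 X t))"

text \<open>The sets \<open>cells (free_bicat X) f g\<close> forget the ends of a cell;
  \<open>wsrc\<close> and \<open>wtgt\<close> recover them from its boundary words.\<close>

primrec wsrc where
  "wsrc X (WGen f) = s0 X f"
| "wsrc X (WId x) = x"
| "wsrc X (WComp u v) = wsrc X v"

primrec wtgt where
  "wtgt X (WGen f) = t0 X f"
| "wtgt X (WId x) = x"
| "wtgt X (WComp u v) = wtgt X u"

lemma wty_ends: "wty X w x y \<Longrightarrow> x = wsrc X w \<and> y = wtgt X w"
  by (induction rule: wty.induct) auto

lemma cty_ends: "cty X a f g x y \<Longrightarrow> x = wsrc X f \<and> y = wtgt X f"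
  by (induction rule: cty.induct) (auto dest: wty_ends)

lemma cls_eqI: "ceq X a b \<Longrightarrow> cls X a = cls X b"
  unfolding cls_def by (blast intro: ceq_sym ceq_trans)

lemma cls_self: "cty X a f g x y \<Longrightarrow> a \<in> cls X a"
  unfolding cls_def by (blast intro: ceq_refl)

text \<open>Vertical composition in \<open>free_bicat\<close> is a union over all representatives;
  by congruence all sets in this union coincide.\<close>

lemma Union_cls_CV:
  assumes "cty X b g h x y" "cty X a f g x y"
  shows "(\<Union>b'\<in>cls X b. \<Union>a'\<in>cls X a. cls X (CV b' a')) = cls X (CV b a)"
proof -
  have "cls X (CV b' a') = cls X (CV b a)" if "b' \<in> cls X b" "a' \<in> cls X a" for a' b'
    using that assms by (intro cls_eqI[symmetric] ceq_CV) (auto simp: cls_def)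
  then show ?thesis using cls_self[OF assms(1)] cls_self[OF assms(2)] by blast
qed

lemma Union_cls_CH:
  assumes "cty X b g g' y z" "cty X a f f' x y"
  shows "(\<Union>b'\<in>cls X b. \<Union>a'\<in>cls X a. cls X (CH b' a')) = cls X (CH b a)"
proof -
  have "cls X (CH b' a') = cls X (CH b a)" if "b' \<in> cls X b" "a' \<in> cls X a" for a' b'
    using that assms by (intro cls_eqI[symmetric] ceq_CH) (auto simp: cls_def)
  then show ?thesis using cls_self[OF assms(1)] cls_self[OF assms(2)] by blast
qed

lemma cells_free_bicatD:
  assumes "\<alpha> \<in> cells (free_bicat X) f g" "f \<in> arr (free_bicat X) x y"
  obtains r where "\<alpha> = cls X r" "cty X r f g x y"
proof -
  obtain r u v where r: "\<alpha> = cls X r" "cty X r f g u v"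
    using assms(1) by (auto simp: free_bicat_def)
  have "u = x" "v = y"
    using cty_ends[OF r(2)] wty_ends[of X f x y] assms(2) by (auto simp: free_bicat_def)
  then show thesis using that r by blast
qed

context
  fixes X :: "('o, 'm, 't) globset" and Y :: "('p, 'n, 's) globset"
    and a :: "'o \<Rightarrow> 'p" and b :: "'m \<Rightarrow> 'n" and c :: "'t \<Rightarrow> 's"
  assumes map: "globset_map X Y a b c"
begin

lemma wty_map: "wty X w x y \<Longrightarrow> wty Y (map_word a b w) (a x) (a y)"
proof (induction rule: wty.induct)
  case (1 f)
  then show ?case using map wty.intros(1)[of "b f" Y] by (auto simp: globset_map_def)
next
  case (2 x)
  then show ?case using map by (auto simp: globset_map_def intro: wty.intros)
qed (auto intro: wty.intros)

lemma cty_map: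
  "cty X \<alpha> f g x y \<Longrightarrow> cty Y (map_fcell2 a b c \<alpha>) (map_word a b f) (map_word a b g) (a x) (a y)"
proof (induction rule: cty.induct)
  case (1 t x y)
  then show ?case
    using map wty_map[OF 1(2)] wty_map[OF 1(3)] cty.intros(1)[of "c t" Y]
    by (auto simp: globset_map_def)
qed (auto intro: cty.intros wty_map)

lemma ceq_map: "ceq X \<alpha> \<beta> \<Longrightarrow> ceq Y (map_fcell2 a b c \<alpha>) (map_fcell2 a b c \<beta>)"
proof (induction rule: ceq.induct)
  case (ceq_sym \<alpha> \<beta>) then show ?case by (blast intro: ceq.ceq_sym)
next
  case (ceq_trans \<alpha> \<beta> \<gamma>) then show ?case by (blast intro: ceq.ceq_trans)
qed ((simp only: fcell2.map word.map)?, blast intro: ceq_refl ceq_CV ceq_CH ceq_assoc ceq_id_left ceq_id_right ceq_CH_id ceq_interchange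
    ceq_asc_natural ceq_asc_inv1 ceq_asc_inv2 ceq_lun_natural ceq_lun_inv1 ceq_lun_inv2
    ceq_run_natural ceq_run_inv1 ceq_run_inv2 ceq_pentagon ceq_triangle cty_map wty_map)+

text \<open>The 2-cells of \<open>free_bicat\<close> are congruence classes, so \<open>scell\<close>
  collects the images of all representatives; by \<open>ceq_map\<close> these lie in one
  class.\<close>

definition free_map where
  "free_map = \<lparr> sob = a, sarr = map_word a b, scell = (\<lambda>A. \<Union>\<alpha>\<in>A. cls Y (map_fcell2 a b c \<alpha>)) \<rparr>"

lemma scell_free_map: "cty X \<alpha> f g x y \<Longrightarrow> scell free_map (cls X \<alpha>) = cls Y (map_fcell2 a b c \<alpha>)"
proof -
  assume \<alpha>: "cty X \<alpha> f g x y"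
  have "cls Y (map_fcell2 a b c \<beta>) = cls Y (map_fcell2 a b c \<alpha>)" if "\<beta> \<in> cls X \<alpha>" for \<beta>
    using that by (intro cls_eqI[symmetric] ceq_map) (simp add: cls_def)
  then have "(\<Union>\<beta>\<in>cls X \<alpha>. cls Y (map_fcell2 a b c \<beta>)) = cls Y (map_fcell2 a b c \<alpha>)"
    using cls_self[OF \<alpha>] by blast
  then show ?thesis
    by (simp add: free_map_def)
qed

lemma strict_functor_free_map: "strict_functor (free_bicat X) (free_bicat Y) free_map"
proof
  fix x y f g h \<alpha> \<beta>
  assume "f \<in> arr (free_bicat X) x y" "g \<in> arr (free_bicat X) x y" "h \<in> arr (free_bicat X) x y"
    "\<alpha> \<in> cells (free_bicat X) f g" "\<beta> \<in> cells (free_bicat X) g h"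
  then obtain r s where rs: "\<alpha> = cls X r" "cty X r f g x y" "\<beta> = cls X s" "cty X s g h x y"
    by (elim cells_free_bicatD)
  have "vc (free_bicat X) \<beta> \<alpha> = cls X (CV s r)"
    using Union_cls_CV[OF rs(4,2)] by (simp add: free_bicat_def rs)
  moreover have "vc (free_bicat Y) (scell free_map \<beta>) (scell free_map \<alpha>) = cls Y (CV (map_fcell2 a b c s) (map_fcell2 a b c r))"
    using Union_cls_CV[OF cty_map[OF rs(4)] cty_map[OF rs(2)]]
    by (simp add: free_bicat_def rs scell_free_map[OF rs(2)] scell_free_map[OF rs(4)])
  ultimately show "scell free_map (\<beta> \<cdot>\<^bsub>free_bicat X\<^esub> \<alpha>) = scell free_map \<beta> \<cdot>\<^bsub>free_bicat Y\<^esub> scell free_map \<alpha>"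
    using scell_free_map[OF cty.intros(3)[OF rs(4,2)]] by simp
next
  fix x y z f f' g g' \<alpha> \<beta>
  assume "f \<in> arr (free_bicat X) x y" "f' \<in> arr (free_bicat X) x y"
    "g \<in> arr (free_bicat X) y z" "g' \<in> arr (free_bicat X) y z"
    "\<alpha> \<in> cells (free_bicat X) f f'" "\<beta> \<in> cells (free_bicat X) g g'"
  then obtain r s where rs: "\<alpha> = cls X r" "cty X r f f' x y" "\<beta> = cls X s" "cty X s g g' y z"
    by (elim cells_free_bicatD)
  have "hc (free_bicat X) \<beta> \<alpha> = cls X (CH s r)"
    using Union_cls_CH[OF rs(4,2)] by (simp add: free_bicat_def rs)
  moreover have "hc (free_bicat Y) (scell free_map \<beta>) (scell free_map \<alpha>) = cls Y (CH (map_fcell2 a b c s) (map_fcell2 a b c r))"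
    using Union_cls_CH[OF cty_map[OF rs(4)] cty_map[OF rs(2)]]
    by (simp add: free_bicat_def rs scell_free_map[OF rs(2)] scell_free_map[OF rs(4)])
  ultimately show "scell free_map (\<beta> \<star>\<^bsub>free_bicat X\<^esub> \<alpha>) = scell free_map \<beta> \<star>\<^bsub>free_bicat Y\<^esub> scell free_map \<alpha>"
    using scell_free_map[OF cty.intros(4)[OF rs(4,2)]] by simp
next
  fix x y f g \<alpha>
  assume "\<alpha> \<in> cells (free_bicat X) f g"
  then obtain r u v where r: "\<alpha> = cls X r" "cty X r f g u v" by (auto simp: free_bicat_def)
  show "scell free_map \<alpha> \<in> cells (free_bicat Y) (sarr free_map f) (sarr free_map g)"
    using cty_map[OF r(2)] by (auto simp: r(1) scell_free_map[OF r(2)] free_bicat_def) (auto simp: free_map_def)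
next
  fix x assume "x \<in> obj (free_bicat X)"
  then show "sob free_map x \<in> obj (free_bicat Y)"
    using map by (simp add: free_bicat_def free_map_def globset_map_def)
next
  fix x y f assume "f \<in> arr (free_bicat X) x y"
  then have f: "wty X f x y" by (simp add: free_bicat_def)
  then show "sarr free_map f \<in> arr (free_bicat Y) (sob free_map x) (sob free_map y)"
    using wty_map by (simp add: free_bicat_def free_map_def)
  show "scell free_map (id2 (free_bicat X) f) = id2 (free_bicat Y) (sarr free_map f)"
    "scell free_map (lun (free_bicat X) f) = lun (free_bicat Y) (sarr free_map f)"
    "scell free_map (run (free_bicat X) f) = run (free_bicat Y) (sarr free_map f)"
    using scell_free_map[OF cty.intros(2)[OF f]] scell_free_map[OF cty.intros(7)[OF f]]
      scell_free_map[OF cty.intros(9)[OF f]]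
    by (simp_all add: free_bicat_def) (simp_all add: free_map_def)
next
  fix w x y z f g h
  assume "f \<in> arr (free_bicat X) w x" "g \<in> arr (free_bicat X) x y" "h \<in> arr (free_bicat X) y z"
  then have t: "wty X h y z" "wty X g x y" "wty X f w x" by (simp_all add: free_bicat_def)
  show "scell free_map (asc (free_bicat X) h g f)
      = asc (free_bicat Y) (sarr free_map h) (sarr free_map g) (sarr free_map f)"
    using scell_free_map[OF cty.intros(5)[OF t]] by (simp add: free_bicat_def) (simp add: free_map_def)
qed (simp_all add: free_bicat_def free_map_def)

end

text \<open>\<open>A_act\<close> picks a lift by \<open>SOME\<close>, which is informative only if a
  lift exists.\<close>

lemma hat_hom_vertex:
  assumes "i \<le> length T"
  shows "\<exists>P \<in> hat_hom [] T. sob P 0 = i"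
proof -
  \<comment> \<open>\<open>star []\<close> has no 1-cells or 2-cells, so \<open>id\<close> is a
    dummy value on them.\<close>
  have map: "globset_map (star []) (star T) (\<lambda>_. i) id id"
    using assms by (auto simp: globset_map_def star_def)
  from strict_functor_free_map[OF map] show ?thesis
    unfolding hat_hom_def
    by (intro bexI[of _ "free_map (star T) (\<lambda>_. i) id id"]) (auto simp: free_map_def[OF map])
qed

section \<open>Closed cochains and modifications\<close>

lemma linear_on_zero: "\<lbrakk>linear_on s V s' L; 0 \<in> V\<rbrakk> \<Longrightarrow> L 0 = 0"
  unfolding linear_on_def by (metis add_cancel_right_right)

lemma linear_on_comp:
  assumes "linear_on s V s' L" "\<And>u. u \<in> V \<Longrightarrow> L u \<in> W" "linear_on s' W s'' M"
  shows "linear_on s V s'' (\<lambda>u. M (L u))"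
  using assms unfolding linear_on_def by simp

lemma sgn_pow_zero [simp]: "sgn_pow n 0 = 0"
  by (simp add: sgn_pow_def)

lemma places_eq_empty [simp]: "places [] = {}" "places [0] = {}"
  by (auto simp: places_def)

lemma data_point: "data C [] = {([x], []) | x. x \<in> obj C}"
  by (auto simp: data_def length_Suc_conv)

lemma twos_point: "twos C [] f = {[]}"
  by (auto simp: twos_def)

lemma data_globe: "data C [0] = {([x, y], [[f]]) | x y f. x \<in> obj C \<and> y \<in> obj C \<and> f \<in> arr C x y}"
  by (auto simp: data_def length_Suc_conv)

lemma twos_globe: "twos C [0] f = {[[]]}"
  by (auto simp: twos_def length_Suc_conv)

lemma Ahat_act_outside:
  "\<not> (dat \<in> data C T \<and> \<sigma> \<in> twos C T (snd dat)) \<Longrightarrow> Ahat_act C D F G \<eta> \<theta> S T P d \<Psi> dat \<sigma> = 0"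
  by (simp only: Ahat_act_def if_False)

text \<open>With no columns in the source, the bounds taken from \<open>underlying P\<close> occur
  only in blocks from \<open>p\<close> to \<open>q = p\<close>, which are empty, and the pulled back
  datum is the single object at the vertex.\<close>

lemma Ahat_act_point_cong:
  "sob P 0 = sob P' 0 \<Longrightarrow> Ahat_act C D F G \<eta> \<theta> [] T P d \<Psi> = Ahat_act C D F G \<eta> \<theta> [] T P' d \<Psi>"
proof (intro ext)
  fix dat :: "('a, 'b) datum" and \<sigma>
  assume "sob P 0 = sob P' 0"
  then show "Ahat_act C D F G \<eta> \<theta> [] T P d \<Psi> dat \<sigma> = Ahat_act C D F G \<eta> \<theta> [] T P' d \<Psi> dat \<sigma>"
  proof (cases "dat \<in> data C T \<and> \<sigma> \<in> twos C T (snd dat)")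
    case False
    then show ?thesis by (simp only: Ahat_act_outside[OF False])
  qed (simp add: Ahat_act_def act_mid_def act_places_def pull_datum_def pull_twos_def Let_def)
qed

text \<open>Two lifts of the same map out of the point share their vertex and hence act
  equally.\<close>

lemma A_cpx_point: "A_cpx C D F G \<eta> \<theta> [] d = Ahat_cpx C D F G \<eta> \<theta> [] d"
  unfolding A_cpx_def
  by (auto simp: theta_eq_def underlying_def intro!: Ahat_act_point_cong)

text \<open>There are no places, so multilinearity is vacuous and the degree shift is an empty sum;
  the case \<open>k = 0\<close> of \<open>src_word\<close> and \<open>tgt_word\<close> gives \<eta>
  and \<theta> without a unit factor.\<close>

lemma Ahat_cpx_point_iff:
  "\<Psi> \<in> Ahat_cpx C D F G \<eta> \<theta> [] d \<longleftrightarrow>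
     (\<forall>dat \<sigma>. dat \<notin> data C [] \<or> \<sigma> \<noteq> [] \<longrightarrow> \<Psi> dat \<sigma> = 0) \<and> at_point \<Psi> \<in> prod_hom C D \<eta> \<theta> d"
proof -
  have *: "(\<forall>dat \<in> data C []. Q dat) \<longleftrightarrow> (\<forall>x \<in> obj C. Q ([x], []))" for Q
    by (auto simp: data_point)
  show ?thesis
    unfolding Ahat_cpx_def mem_Collect_eq *
    by (auto simp: data_point twos_point src_word_def tgt_word_def prod_hom_def at_point_def)
qed

lemma bij_at_point:
  fixes C :: "('o, 'm, 'c::ab_group_add, 'k::field) dgbicat" and D :: "('p, 'n, 'd::ab_group_add, 'k) dgbicat"
  shows "bij_betw at_point (Ahat_cpx C D F G \<eta> \<theta> [] d) (prod_hom C D \<eta> \<theta> d)"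
proof (rule bij_betwI')
  fix \<Psi> \<Psi>' :: "('o, 'm, 'c, 'd) cochain"
  assume "\<Psi> \<in> Ahat_cpx C D F G \<eta> \<theta> [] d" "\<Psi>' \<in> Ahat_cpx C D F G \<eta> \<theta> [] d"
  then have off: "\<Psi> dat \<sigma> = \<Psi>' dat \<sigma>" if "dat \<notin> data C [] \<or> \<sigma> \<noteq> []" for dat and \<sigma> :: "'c twos"
    using that unfolding Ahat_cpx_point_iff by metis
  show "at_point \<Psi> = at_point \<Psi>' \<longleftrightarrow> \<Psi> = \<Psi>'"
  proof
    assume e: "at_point \<Psi> = at_point \<Psi>'"
    have "\<Psi> dat \<sigma> = \<Psi>' dat \<sigma>" for dat and \<sigma> :: "'c twos"
      using off[of dat \<sigma>] fun_cong[OF e] by (cases "dat \<in> data C [] \<and> \<sigma> = []") (auto simp: data_point at_point_def)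
    then show "\<Psi> = \<Psi>'" by (intro ext)
  qed simp
next
  fix \<Gamma> assume \<Gamma>: "\<Gamma> \<in> prod_hom C D \<eta> \<theta> d"
  \<comment> \<open>A datum at the point lists exactly one object, which \<open>hd\<close> reads
    off.\<close>
  define \<Psi> where "\<Psi> dat \<sigma> = (if dat \<in> data C [] \<and> \<sigma> = [] then \<Gamma> (hd (fst dat)) else 0)" for dat :: "('o, 'm) datum" and \<sigma> :: "'c twos"
  have "at_point \<Psi> = \<Gamma>"
    using \<Gamma> by (auto simp: at_point_def \<Psi>_def data_point prod_hom_def fun_eq_iff)
  moreover from this have "\<Psi> \<in> Ahat_cpx C D F G \<eta> \<theta> [] d"
    using \<Gamma> by (simp add: Ahat_cpx_point_iff \<Psi>_def)
  ultimately show "\<exists>\<Psi> \<in> Ahat_cpx C D F G \<eta> \<theta> [] d. \<Gamma> = at_point \<Psi>" by blast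
qed (simp add: Ahat_cpx_point_iff)

lemma linear_at_point: "linear_on (scl_cochain D) V (scl_family D) at_point"
  by (simp add: linear_on_def scl_cochain_def scl_family_def at_point_def fun_eq_iff)

text \<open>For source \<open>[]\<close> the relation \<open>theta_eq\<close> compares only the
  vertex, so this is all that is known about the chosen lift.\<close>

lemma A_act_point:
  assumes "\<Phi> \<in> theta_hom [] T"
  obtains P where "A_act C D F G \<eta> \<theta> [] T \<Phi> = Ahat_act C D F G \<eta> \<theta> [] T P" "sob P 0 = fst \<Phi> 0"
proof -
  have "fst \<Phi> 0 \<le> length T" using assms by (auto simp: theta_hom_def)
  then have "\<exists>P. P \<in> hat_hom [] T \<and> theta_eq [] (underlying P) \<Phi>"
    using hat_hom_vertex by (fastforce simp: theta_eq_def underlying_def)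
  from someI_ex[OF this] show thesis
    by (intro that[OF A_act_def]) (simp add: theta_eq_def underlying_def)
qed

lemma cofaces_point: "{\<delta> \<in> cofaces []. coface_tgt [] \<delta> = T} = (if T = [0] then {DMin, DMax} else {})"
  by (auto simp: cofaces_def)

section \<open>The two coface actions and the total differential at the point\<close>

context dg_transformation_pair
begin

abbreviation "A \<equiv> A_complex C D F G \<eta> \<theta>"

lemma cpx_point: "cpx A point n = Ahat_cpx C D F G \<eta> \<theta> [] n"
  by (simp add: A_complex_def point_def A_cpx_point)

lemma cell_component: "\<lbrakk>\<Gamma> \<in> prod_hom C D \<eta> \<theta> 0; x \<in> obj C\<rbrakk> \<Longrightarrow> D.cell (fob F x) (fob G x) (tarr \<eta> x) (tarr \<theta> x) (\<Gamma> x)"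
  by (simp add: D.cell_def prod_hom_def F.fob_obj G.fob_obj eta.tarr_arr theta.tarr_arr)

text \<open>Vertex 1 belongs to \<open>DMin\<close>, whose map on vertices omits 0, and vertex 0 to
  \<open>DMax\<close>.\<close>

lemma Ahat_act_globe:
  assumes xyf: "x \<in> obj C" "y \<in> obj C" "f \<in> arr C x y" and \<Psi>: "\<Psi> \<in> Ahat_cpx C D F G \<eta> \<theta> [] 0"
  shows "sob P 0 = 1 \<Longrightarrow> Ahat_act C D F G \<eta> \<theta> [] [0] P 0 \<Psi> ([x, y], [[f]]) [[]]
      = inv_tcell \<theta> x y f \<cdot>\<^bsub>D\<^esub> (at_point \<Psi> y \<star>\<^bsub>D\<^esub> id2 D (farr F f))"
    and "sob P 0 = 0 \<Longrightarrow> Ahat_act C D F G \<eta> \<theta> [] [0] P 0 \<Psi> ([x, y], [[f]]) [[]]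
      = (id2 D (farr G f) \<star>\<^bsub>D\<^esub> at_point \<Psi> x) \<cdot>\<^bsub>D\<^esub> inv_tcell \<eta> x y f"
proof -
  have \<Gamma>: "at_point \<Psi> \<in> prod_hom C D \<eta> \<theta> 0" using \<Psi> by (simp add: Ahat_cpx_point_iff)
  have dat: "([x, y], [[f]]) \<in> data C [0]" using xyf by (auto simp: data_globe)
  note unf = Ahat_act_def Let_def act_places_def act_mid_def twos_globe pull_datum_def pull_twos_def
     src_word_def tgt_word_def wmin_def wmax_def block_places_def seg_def block_def sgn_pow_def
  note ids = F.fcell_id2[OF xyf] G.fcell_id2[OF xyf]
  have Iz: "fcell G (id2 C (id1 C z)) = id2 D (farr G (id1 C z))" "fcell F (id2 C (id1 C z)) = id2 D (farr F (id1 C z))"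
    if "z \<in> obj C" for z
    using that F.fcell_id2[OF _ _ C.id1_arr] G.fcell_id2[OF _ _ C.id1_arr] by simp_all
  \<comment> \<open>This is \<open>act_mid_point\<close> in the shape in which simplification leaves
    the unfolded action, with the images of identities already evaluated.\<close>
  have m: "(id2 D (farr G (id1 C z)) \<star>\<^bsub>D\<^esub> id2 D (tarr \<theta> z))
      \<cdot>\<^bsub>D\<^esub> cn (DArr (tarr \<theta> z)) (DComp (DG (WId z)) (DArr (tarr \<theta> z)))
      \<cdot>\<^bsub>D\<^esub> \<Psi> ([z], []) []
      \<cdot>\<^bsub>D\<^esub> cn (DComp (DArr (tarr \<eta> z)) (DF (WId z))) (DArr (tarr \<eta> z))
      \<cdot>\<^bsub>D\<^esub> (id2 D (tarr \<eta> z) \<star>\<^bsub>D\<^esub> id2 D (farr F (id1 C z)))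
    = cn (DArr (tarr \<theta> z)) (DComp (DG (WId z)) (DArr (tarr \<theta> z)))
      \<cdot>\<^bsub>D\<^esub> \<Psi> ([z], []) [] \<cdot>\<^bsub>D\<^esub> cn (DComp (DArr (tarr \<eta> z)) (DF (WId z))) (DArr (tarr \<eta> z))"
    if "z \<in> obj C" for z
    using act_mid_point[OF that cell_component[OF \<Gamma> that]] by (simp only: Iz[OF that] at_point_def)
  show "Ahat_act C D F G \<eta> \<theta> [] [0] P 0 \<Psi> ([x, y], [[f]]) [[]]
      = inv_tcell \<theta> x y f \<cdot>\<^bsub>D\<^esub> (at_point \<Psi> y \<star>\<^bsub>D\<^esub> id2 D (farr F f))" if "sob P 0 = 1"
  proof -
    \<comment> \<open>The short side of the goal is expanded into the long composite, which the
      unfolded action then matches factor by factor.\<close>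
    note t = act_at_target[OF xyf cell_component[OF \<Gamma> xyf(2)], symmetric]
    show ?thesis
      unfolding t by (simp add: that dat unf ids Iz[OF xyf(2)] m[OF xyf(2)] inv_tcell_def at_point_def)
  qed
  show "Ahat_act C D F G \<eta> \<theta> [] [0] P 0 \<Psi> ([x, y], [[f]]) [[]]
      = (id2 D (farr G f) \<star>\<^bsub>D\<^esub> at_point \<Psi> x) \<cdot>\<^bsub>D\<^esub> inv_tcell \<eta> x y f" if "sob P 0 = 0"
  proof -
    note t = act_at_source[OF xyf cell_component[OF \<Gamma> xyf(1)], symmetric]
    show ?thesis
      unfolding t by (simp add: that dat unf ids Iz[OF xyf(1)] m[OF xyf(1)] inv_tcell_def at_point_def)
  qed
qed

text \<open>Composing with \<open>tcell \<theta> f\<close> on the left and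
  \<open>tcell \<eta> f\<close> on the right passes from the first equation to the second; composing
  with the inverses passes back.\<close>

lemma inv_tcell_commute:
  assumes xyf: "x \<in> obj C" "y \<in> obj C" "f \<in> arr C x y" and \<Gamma>: "\<Gamma> \<in> prod_hom C D \<eta> \<theta> 0"
  shows "inv_tcell \<theta> x y f \<cdot>\<^bsub>D\<^esub> (\<Gamma> y \<star>\<^bsub>D\<^esub> id2 D (farr F f)) = (id2 D (farr G f) \<star>\<^bsub>D\<^esub> \<Gamma> x) \<cdot>\<^bsub>D\<^esub> inv_tcell \<eta> x y f
    \<longleftrightarrow> tcell \<theta> f \<cdot>\<^bsub>D\<^esub> (id2 D (farr G f) \<star>\<^bsub>D\<^esub> \<Gamma> x) = (\<Gamma> y \<star>\<^bsub>D\<^esub> id2 D (farr F f)) \<cdot>\<^bsub>D\<^esub> tcell \<eta> f"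
    (is "?it \<cdot>\<^bsub>D\<^esub> ?b = ?a \<cdot>\<^bsub>D\<^esub> ?ie \<longleftrightarrow> ?t \<cdot>\<^bsub>D\<^esub> ?a = ?b \<cdot>\<^bsub>D\<^esub> ?e")
proof -
  note t = theta.iso2_tcell[OF xyf] and e = eta.iso2_tcell[OF xyf]
  note ct = D.iso2_cell[OF t] and ce = D.iso2_cell[OF e]
  note cit = D.cell_inv2[OF t, folded inv_tcell_def] and cie = D.cell_inv2[OF e, folded inv_tcell_def]
  have a: "D.cell (fob F x) (fob G y) (farr G f \<odot>\<^bsub>D\<^esub> tarr \<eta> x) (farr G f \<odot>\<^bsub>D\<^esub> tarr \<theta> x) ?a"
    by (rule D.cell_hc[OF D.cell_id2 cell_component[OF \<Gamma> xyf(1)]])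
      (use xyf in \<open>blast intro: G.fob_obj G.farr_arr\<close>)+
  have b: "D.cell (fob F x) (fob G y) (tarr \<eta> y \<odot>\<^bsub>D\<^esub> farr F f) (tarr \<theta> y \<odot>\<^bsub>D\<^esub> farr F f) ?b"
    by (rule D.cell_hc[OF cell_component[OF \<Gamma> xyf(2)] D.cell_id2])
      (use xyf in \<open>blast intro: F.fob_obj F.farr_arr\<close>)+
  show ?thesis
  proof
    assume h: "?it \<cdot>\<^bsub>D\<^esub> ?b = ?a \<cdot>\<^bsub>D\<^esub> ?ie"
    have "?b \<cdot>\<^bsub>D\<^esub> ?e = ?t \<cdot>\<^bsub>D\<^esub> (?it \<cdot>\<^bsub>D\<^esub> (?b \<cdot>\<^bsub>D\<^esub> ?e))"
      using D.inv2_cancel_left'[OF t D.cell_vc[OF b ce]] by (simp add: inv_tcell_def)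
    also have "\<dots> = ?t \<cdot>\<^bsub>D\<^esub> (?a \<cdot>\<^bsub>D\<^esub> (?ie \<cdot>\<^bsub>D\<^esub> ?e))"
      by (simp add: D.cell_assoc[OF cit b ce, symmetric] h D.cell_assoc[OF a cie ce])
    also have "\<dots> = ?t \<cdot>\<^bsub>D\<^esub> ?a"
      using D.inv2_left[OF e] by (simp add: inv_tcell_def D.cell_id_right[OF a])
    finally show "?t \<cdot>\<^bsub>D\<^esub> ?a = ?b \<cdot>\<^bsub>D\<^esub> ?e" by simp
  next
    assume h: "?t \<cdot>\<^bsub>D\<^esub> ?a = ?b \<cdot>\<^bsub>D\<^esub> ?e"
    have "?a \<cdot>\<^bsub>D\<^esub> ?ie = ?it \<cdot>\<^bsub>D\<^esub> (?t \<cdot>\<^bsub>D\<^esub> (?a \<cdot>\<^bsub>D\<^esub> ?ie))"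
      using D.inv2_cancel_left[OF t D.cell_vc[OF a cie]] by (simp add: inv_tcell_def)
    also have "\<dots> = ?it \<cdot>\<^bsub>D\<^esub> (?b \<cdot>\<^bsub>D\<^esub> (?e \<cdot>\<^bsub>D\<^esub> ?ie))"
      by (simp add: D.cell_assoc[OF ct a cie, symmetric] h D.cell_assoc[OF b ce cie])
    also have "\<dots> = ?it \<cdot>\<^bsub>D\<^esub> ?b"
      using D.inv2_right[OF e] by (simp add: inv_tcell_def D.cell_id_right[OF b])
    finally show "?it \<cdot>\<^bsub>D\<^esub> ?b = ?a \<cdot>\<^bsub>D\<^esub> ?ie" by simp
  qed
qed

lemma module_scl: "module (scl D)"
  using D.vector_space_scl by (simp add: vector_space_def module_def)

lemma zero_hom:
  "\<lbrakk>x \<in> obj D; y \<in> obj D; f \<in> arr D x y; g \<in> arr D x y\<rbrakk> \<Longrightarrow> 0 \<in> hom D f g n"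
  using D.hom_subspace by (auto simp: module.subspace_def[OF module_scl])

lemma zero_component: "x \<in> obj C \<Longrightarrow> 0 \<in> hom D (tarr \<eta> x) (tarr \<theta> x) n"
  by (rule zero_hom[OF _ _ eta.tarr_arr theta.tarr_arr]) (auto intro: F.fob_obj G.fob_obj)

text \<open>With \<open>linear_mod_right\<close> this makes the modification equation linear in
  \<Gamma>, which yields the subspace property and settles the zero family.\<close>

lemma linear_mod_left:
  assumes xyf: "x \<in> obj C" "y \<in> obj C" "f \<in> arr C x y"
  shows "linear_on (scl D) (hom D (tarr \<eta> x) (tarr \<theta> x) 0) (scl D)
    (\<lambda>\<gamma>. tcell \<theta> f \<cdot>\<^bsub>D\<^esub> (id2 D (farr G f) \<star>\<^bsub>D\<^esub> \<gamma>))"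
proof (rule linear_on_comp[where M = "\<lambda>\<gamma>. tcell \<theta> f \<cdot>\<^bsub>D\<^esub> \<gamma>"])
  note o = F.fob_obj[OF xyf(1)] G.fob_obj[OF xyf(1)] G.fob_obj[OF xyf(2)]
  note Gf = G.farr_arr[OF xyf] and ar = eta.tarr_arr[OF xyf(1)] theta.tarr_arr[OF xyf(1)]
  note id = D.id2_hom[OF o(2,3) Gf]
  note t = D.cell_arrD[OF D.iso2_cell[OF theta.iso2_tcell[OF xyf]]]
  show "linear_on (scl D) (hom D (tarr \<eta> x) (tarr \<theta> x) 0) (scl D) (\<lambda>\<gamma>. id2 D (farr G f) \<star>\<^bsub>D\<^esub> \<gamma>)"
    by (rule D.hc_linear_right[OF o ar Gf Gf id])
  show "id2 D (farr G f) \<star>\<^bsub>D\<^esub> \<gamma> \<in> hom D (farr G f \<odot>\<^bsub>D\<^esub> tarr \<eta> x) (farr G f \<odot>\<^bsub>D\<^esub> tarr \<theta> x) 0"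
    if "\<gamma> \<in> hom D (tarr \<eta> x) (tarr \<theta> x) 0" for \<gamma>
    using D.hc_hom[OF o ar Gf Gf that id] by simp
  show "linear_on (scl D) (hom D (farr G f \<odot>\<^bsub>D\<^esub> tarr \<eta> x) (farr G f \<odot>\<^bsub>D\<^esub> tarr \<theta> x) 0) (scl D)
      (\<lambda>\<gamma>. tcell \<theta> f \<cdot>\<^bsub>D\<^esub> \<gamma>)"
    by (rule D.vc_linear_right[OF t(1,2) D.cmp_arr[OF o ar(1) Gf] t(3-5)])
qed

lemma linear_mod_right:
  assumes xyf: "x \<in> obj C" "y \<in> obj C" "f \<in> arr C x y"
  shows "linear_on (scl D) (hom D (tarr \<eta> y) (tarr \<theta> y) 0) (scl D)
    (\<lambda>\<gamma>. (\<gamma> \<star>\<^bsub>D\<^esub> id2 D (farr F f)) \<cdot>\<^bsub>D\<^esub> tcell \<eta> f)"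
proof (rule linear_on_comp[where M = "\<lambda>\<gamma>. \<gamma> \<cdot>\<^bsub>D\<^esub> tcell \<eta> f"])
  note o = F.fob_obj[OF xyf(1)] F.fob_obj[OF xyf(2)] G.fob_obj[OF xyf(2)]
  note Ff = F.farr_arr[OF xyf] and ar = eta.tarr_arr[OF xyf(2)] theta.tarr_arr[OF xyf(2)]
  note id = D.id2_hom[OF o(1,2) Ff]
  note e = D.cell_arrD[OF D.iso2_cell[OF eta.iso2_tcell[OF xyf]]]
  show "linear_on (scl D) (hom D (tarr \<eta> y) (tarr \<theta> y) 0) (scl D) (\<lambda>\<gamma>. \<gamma> \<star>\<^bsub>D\<^esub> id2 D (farr F f))"
    by (rule D.hc_linear_left[OF o Ff Ff ar id])
  show "\<gamma> \<star>\<^bsub>D\<^esub> id2 D (farr F f) \<in> hom D (tarr \<eta> y \<odot>\<^bsub>D\<^esub> farr F f) (tarr \<theta> y \<odot>\<^bsub>D\<^esub> farr F f) 0"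
    if "\<gamma> \<in> hom D (tarr \<eta> y) (tarr \<theta> y) 0" for \<gamma>
    using D.hc_hom[OF o Ff Ff ar id that] by simp
  show "linear_on (scl D) (hom D (tarr \<eta> y \<odot>\<^bsub>D\<^esub> farr F f) (tarr \<theta> y \<odot>\<^bsub>D\<^esub> farr F f) 0) (scl D)
      (\<lambda>\<gamma>. \<gamma> \<cdot>\<^bsub>D\<^esub> tcell \<eta> f)"
    by (rule D.vc_linear_left[OF e(1-4) D.cmp_arr[OF o Ff ar(2)] e(5)])
qed

text \<open>\<open>dif\<close> is linear only on hom spaces, so one of them is needed to evaluate it
  at 0; an object supplies the endomorphisms of its identity.\<close>

lemma dif_zero: "x \<in> obj D \<Longrightarrow> dif D 0 = 0"
  using linear_on_zero[OF D.dif_linear[of x x "id1 D x" "id1 D x" 0] zero_hom] D.id1_arr by blast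

lemma Ahat_dif_zero: "Ahat_dif C D T d (0 :: ('o, 'm, 'c, 'd) cochain) = 0"
proof (intro ext)
  fix dat :: "('o, 'm) datum" and \<sigma>
  have "dif D 0 = 0" if dat: "dat \<in> data C T"
  proof -
    \<comment> \<open>A datum contains at least one object of \<open>C\<close>, and its image under
      \<open>F\<close> is the object of \<open>D\<close> that \<open>dif_zero\<close> asks
      for.\<close>
    have "fst dat \<noteq> []" "set (fst dat) \<subseteq> obj C"
      using dat by (auto simp: data_def)
    then have "hd (fst dat) \<in> obj C" by auto
    then show ?thesis by (intro dif_zero[OF F.fob_obj])
  qed
  then show "Ahat_dif C D T d 0 dat \<sigma> = (0 :: ('o, 'm, 'c, 'd) cochain) dat \<sigma>"
    by (simp add: Ahat_dif_def)
qed

text \<open>The sum over cofaces in \<open>Tot_dif\<close> runs over the support of its argument, so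
  the component at ([1];[0]) is this difference only for nonzero \<Psi>; hence the side condition in
  the second case.\<close>

lemma Tot_dif_point:
  "Tot_dif A 0 (Tot_incl [] \<Psi>) T =
     (if T = [] then Ahat_dif C D [] 0 \<Psi>
      else if T = [0] \<and> \<Psi> \<noteq> 0 then A_act C D F G \<eta> \<theta> [] [0] (coface_mor [] DMin) 0 \<Psi>
             - A_act C D F G \<eta> \<theta> [] [0] (coface_mor [] DMax) 0 \<Psi>
      else 0)"
proof -
  have "{S. tdim S + 1 = tdim T \<and> Tot_incl [] \<Psi> S \<noteq> 0} = (if \<Psi> \<noteq> 0 \<and> tdim T = 1 then {[]} else {})"
    by (auto simp: Tot_incl_def tdim_def)
  moreover have "tdim [] = 0" "tdim [0] = 1" by (simp_all add: tdim_def)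
  ultimately show ?thesis
    by (simp add: Tot_dif_def cofaces_point A_complex_def Tot_incl_def Ahat_dif_zero sgn_pow_def esum_def)
qed

lemma closed_point_iff:
  assumes \<Psi>: "\<Psi> \<in> Ahat_cpx C D F G \<eta> \<theta> [] 0"
  shows "Tot_dif A 0 (Tot_incl [] \<Psi>) = 0 \<longleftrightarrow> at_point \<Psi> \<in> modifications C D F G \<eta> \<theta>"
proof -
  have \<Gamma>: "at_point \<Psi> \<in> prod_hom C D \<eta> \<theta> 0"
    using \<Psi> by (simp add: Ahat_cpx_point_iff)
  have dif: "Ahat_dif C D [] 0 \<Psi> = 0 \<longleftrightarrow> (\<forall>x \<in> obj C. dif D (at_point \<Psi> x) = 0)"
    by (auto simp: Ahat_dif_def fun_eq_iff data_point twos_point at_point_def)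
  have min: "coface_mor [] DMin \<in> theta_hom [] [0]" and max: "coface_mor [] DMax \<in> theta_hom [] [0]"
    using coface_mor_theta_hom[of DMin "[]"] coface_mor_theta_hom[of DMax "[]"] by (simp_all add: cofaces_def)
  \<comment> \<open>Of the chosen lifts only the vertices are known, and the action depends on
    nothing else.\<close>
  obtain P where P: "A_act C D F G \<eta> \<theta> [] [0] (coface_mor [] DMin) = Ahat_act C D F G \<eta> \<theta> [] [0] P" "sob P 0 = 1"
    by (rule A_act_point[OF min]) (simp add: delta_face_def)
  obtain Q where Q: "A_act C D F G \<eta> \<theta> [] [0] (coface_mor [] DMax) = Ahat_act C D F G \<eta> \<theta> [] [0] Q" "sob Q 0 = 0"
    by (rule A_act_point[OF max]) (simp add: delta_face_def)
  let ?mod = "\<lambda>\<Gamma>. \<forall>x \<in> obj C. \<forall>y \<in> obj C. \<forall>f \<in> arr C x y.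
     tcell \<theta> f \<cdot>\<^bsub>D\<^esub> (id2 D (farr G f) \<star>\<^bsub>D\<^esub> \<Gamma> x) = (\<Gamma> y \<star>\<^bsub>D\<^esub> id2 D (farr F f)) \<cdot>\<^bsub>D\<^esub> tcell \<eta> f"
  have "Ahat_act C D F G \<eta> \<theta> [] [0] P 0 \<Psi> - Ahat_act C D F G \<eta> \<theta> [] [0] Q 0 \<Psi> = 0 \<longleftrightarrow>
      (\<forall>dat \<in> data C [0]. Ahat_act C D F G \<eta> \<theta> [] [0] P 0 \<Psi> dat [[]] = Ahat_act C D F G \<eta> \<theta> [] [0] Q 0 \<Psi> dat [[]])"
    (is "?l - ?r = 0 \<longleftrightarrow> ?same")
  proof
    assume ?same
    then have "?l dat \<sigma> = ?r dat \<sigma>" for dat \<sigma>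
      by (cases "dat \<in> data C [0] \<and> \<sigma> = [[]]") (auto simp: Ahat_act_outside twos_globe)
    then show "?l - ?r = 0" by (simp add: fun_eq_iff)
  qed simp
  also have "\<dots> \<longleftrightarrow> ?mod (at_point \<Psi>)"
  proof -
    have "(\<forall>dat \<in> data C [0]. R dat) \<longleftrightarrow> (\<forall>x \<in> obj C. \<forall>y \<in> obj C. \<forall>f \<in> arr C x y. R ([x, y], [[f]]))" for R
      by (auto simp: data_globe)
    then show ?thesis
      by (simp add: Ahat_act_globe(1)[OF _ _ _ \<Psi> P(2)] Ahat_act_globe(2)[OF _ _ _ \<Psi> Q(2)]
          inv_tcell_commute[OF _ _ _ \<Gamma>])
  qed
  finally have act: "?l - ?r = 0 \<longleftrightarrow> ?mod (at_point \<Psi>)" .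
  \<comment> \<open>For \<Psi> = 0 the coface terms are absent from \<open>Tot_dif_point\<close>, so
    the modification equation has to come from linearity instead.\<close>
  have "?mod (at_point \<Psi>)" if "\<Psi> = 0"
  proof (intro ballI)
    fix x y f assume xyf: "x \<in> obj C" "y \<in> obj C" "f \<in> arr C x y"
    have z: "at_point \<Psi> z = 0" for z using that by (simp add: at_point_def)
    show "tcell \<theta> f \<cdot>\<^bsub>D\<^esub> (id2 D (farr G f) \<star>\<^bsub>D\<^esub> at_point \<Psi> x)
        = (at_point \<Psi> y \<star>\<^bsub>D\<^esub> id2 D (farr F f)) \<cdot>\<^bsub>D\<^esub> tcell \<eta> f"
      using linear_on_zero[OF linear_mod_left[OF xyf] zero_component[OF xyf(1)]]
        linear_on_zero[OF linear_mod_right[OF xyf] zero_component[OF xyf(2)]]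
      by (simp only: z)
  qed
  then have "(\<forall>T. Tot_dif A 0 (Tot_incl [] \<Psi>) T = 0) \<longleftrightarrow> (\<forall>x \<in> obj C. dif D (at_point \<Psi> x) = 0) \<and> ?mod (at_point \<Psi>)"
    unfolding Tot_dif_point P(1) Q(1) using dif act by auto
  then show ?thesis
    using \<Gamma> by (simp add: fun_eq_iff modifications_def)
qed

lemma Tot_closed_point:
  "Tot_closed A point 0 = {\<Psi> \<in> Ahat_cpx C D F G \<eta> \<theta> [] 0. at_point \<Psi> \<in> modifications C D F G \<eta> \<theta>}"
proof -
  have "Tot_incl [] \<Psi> \<in> Tot A 0" if "\<Psi> \<in> Ahat_cpx C D F G \<eta> \<theta> [] 0" for \<Psi>
  proof -
    have "{T. tdim T = l \<and> Tot_incl [] \<Psi> T \<noteq> 0} \<subseteq> {[]}" for l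
      by (auto simp: Tot_incl_def)
    then have "finite {T. tdim T = l \<and> Tot_incl [] \<Psi> T \<noteq> 0}" for l
      by (rule finite_subset) simp
    then show ?thesis
      using that by (auto simp: Tot_def A_complex_def A_cpx_point Tot_incl_def tdim_def)
  qed
  then show ?thesis
    using closed_point_iff
    by (auto simp: Tot_closed_def point_def tdim_def A_complex_def A_cpx_point)
qed

section \<open>Vector space structures and the isomorphism\<close>

lemma module_scl_cochain: "module (scl_cochain D)" and module_scl_family: "module (scl_family D)"
  using module_scl by (simp_all add: module_def scl_cochain_def scl_family_def fun_eq_iff)

lemma subspace_modifications: "module.subspace (scl_family D) (modifications C D F G \<eta> \<theta>)"
  unfolding module.subspace_def[OF module_scl_family]
proof (intro conjI ballI allI)
  have dlin: "linear_on (scl D) (hom D (tarr \<eta> x) (tarr \<theta> x) 0) (scl D) (dif D)" if "x \<in> obj C" for x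
    using that by (intro D.dif_linear[OF _ _ eta.tarr_arr theta.tarr_arr]) (auto intro: F.fob_obj G.fob_obj)
  have h: "module.subspace (scl D) (hom D (tarr \<eta> x) (tarr \<theta> x) 0)" if "x \<in> obj C" for x
    using that by (intro D.hom_subspace[OF _ _ eta.tarr_arr theta.tarr_arr]) (auto intro: F.fob_obj G.fob_obj)
  note sub = h[unfolded module.subspace_def[OF module_scl]]
  show "0 \<in> modifications C D F G \<eta> \<theta>"
    using linear_on_zero[OF linear_mod_left zero_component] linear_on_zero[OF linear_mod_right zero_component]
      linear_on_zero[OF dlin zero_component]
    by (simp add: modifications_def prod_hom_def zero_component)
  fix \<Gamma> assume \<Gamma>: "\<Gamma> \<in> modifications C D F G \<eta> \<theta>"
  \<comment> \<open>\<open>module.scale_zero_right\<close> covers the arguments outside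
    \<open>obj C\<close>, where families vanish.\<close>
  show "scl_family D r \<Gamma> \<in> modifications C D F G \<eta> \<theta>" for r
    using \<Gamma> sub dlin linear_mod_left linear_mod_right module.scale_zero_right[OF module_scl]
    unfolding modifications_def prod_hom_def scl_family_def linear_on_def by simp
  fix \<Gamma>' assume \<Gamma>': "\<Gamma>' \<in> modifications C D F G \<eta> \<theta>"
  show "\<Gamma> + \<Gamma>' \<in> modifications C D F G \<eta> \<theta>"
    using \<Gamma> \<Gamma>' sub dlin linear_mod_left linear_mod_right
    unfolding modifications_def prod_hom_def linear_on_def by simp
qed

text \<open>The closure properties are pulled back from the modifications along the linear map
  \<open>at_point\<close>; what remains is vanishing off the relevant arguments.\<close>

lemma subspace_Tot_closed: "module.subspace (scl_cochain D) (Tot_closed A point 0)"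
proof -
  have "at_point (0 :: ('o, 'm, 'c, 'd) cochain) = 0" "at_point (\<Psi> + \<Psi>') = at_point \<Psi> + at_point \<Psi>'"
    "at_point (scl_cochain D r \<Psi>) = scl_family D r (at_point \<Psi>)" for r and \<Psi> \<Psi>' :: "('o, 'm, 'c, 'd) cochain"
    by (simp_all add: at_point_def scl_cochain_def scl_family_def fun_eq_iff)
  moreover have "modifications C D F G \<eta> \<theta> \<subseteq> prod_hom C D \<eta> \<theta> 0"
    by (auto simp: modifications_def)
  ultimately show ?thesis
    using subspace_modifications module.scale_zero_right[OF module_scl]
    unfolding module.subspace_def[OF module_scl_family] module.subspace_def[OF module_scl_cochain]
      Tot_closed_point Ahat_cpx_point_iff
    by (auto simp: scl_cochain_def subset_iff)
qed

text \<open>By \<open>Tot_closed_point\<close> the closed cochains are the preimage of the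
  modifications under the bijection \<open>at_point\<close>, which therefore restricts.\<close>

lemma vs_isomorphic_modifications:
  "vs_isomorphic (scl_cochain D) (Tot_closed A point 0) (scl_family D) (modifications C D F G \<eta> \<theta>)"
proof -
  have "modifications C D F G \<eta> \<theta> \<subseteq> prod_hom C D \<eta> \<theta> 0"
    by (auto simp: modifications_def)
  then have "bij_betw at_point (Tot_closed A point 0) (modifications C D F G \<eta> \<theta>)"
    using bij_at_point[of C D F G \<eta> \<theta> 0] unfolding Tot_closed_point bij_betw_def
    by (auto simp: inj_on_def)
  then show ?thesis
    using subspace_Tot_closed subspace_modifications linear_at_point unfolding vs_isomorphic_def by blast
qed

end

theorem proposition4p4:
  fixes C :: "('o, 'm, 'c::ab_group_add, 'k::field) dgbicat"
    and D :: "('p, 'n, 'd::ab_group_add, 'k) dgbicat"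
    and F G :: "('o, 'm, 'c, 'p, 'n, 'd) sfun"
    and \<eta> \<theta> :: "('o, 'm, 'n, 'd) strans"
  assumes "dg_bicategory C" and "dg_bicategory D"
    and "strong_dg_functor C D F" and "strong_dg_functor C D G"
    and "strong_dg_transformation C D F G \<eta>" and "strong_dg_transformation C D F G \<theta>"
  shows "let A = A_complex C D F G \<eta> \<theta> in
      (\<forall>n. linear_on (scl_cochain D) (cpx A point n) (scl_family D) at_point
         \<and> bij_betw at_point (cpx A point n) (prod_hom C D \<eta> \<theta> n))
      \<and> vs_isomorphic (scl_cochain D) (Tot_closed A point 0)
           (scl_family D) (modifications C D F G \<eta> \<theta>)"
proof -
  interpret dg_transformation_pair C D F G \<eta> \<theta>
    using assms by (intro dg_transformation_pair.intro dg_transformation.intro dg_functor_pair.intro)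
  show ?thesis
    using vs_isomorphic_modifications
    by (auto simp: Let_def cpx_point intro: linear_at_point bij_at_point)
qed

end
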